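(* Let $\Omega\subset\mathbb{R}^2$ be an (open) equilateral triangle of side $L>0$, with area $|\Omega|$ and perimeter $|\partial\Omega|$. Then, as $t\to0^+$, $$Z_\Omega(t)=\frac{|\Omega|}{4\pi t}-\frac{|\partial\Omega|}{8\sqrt{\pi t}}+\frac13+o(1).$$
   Context: $Z_\Omega(t)=\mathrm{Tr}(e^{t\Delta_D})=\int_\Omega p_t(x,x)\,dx$ is the Dirichlet partition function, where $\Delta_D$ is the Dirichlet Laplacian on $\Omega$ and $p_t(x,y)$ is the Dirichlet heat kernel of $\partial_t u=\Delta u$ on $\Omega$. *)

theory Defs
  imports "HOL-Analysis.Analysis" "HOL-Library.Landau_Symbols"
begin

definition C2_on :: "'a::euclidean_space set \<Rightarrow> ('a \<Rightarrow> real) \<Rightarrow> bool" where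
  "C2_on S f \<longleftrightarrow>
     (\<exists>(grad :: 'a \<Rightarrow> 'a) (hess :: 'a \<Rightarrow> 'a \<Rightarrow>\<^sub>L 'a).
        (\<forall>x\<in>S. (f has_derivative (\<lambda>h. grad x \<bullet> h)) (at x) \<and>
               (grad has_derivative blinfun_apply (hess x)) (at x)) \<and>
        continuous_on S hess)"

definition laplacian :: "('a::euclidean_space \<Rightarrow> real) \<Rightarrow> 'a \<Rightarrow> real" where
  "laplacian f x = (\<Sum>b\<in>Basis. (deriv ^^ 2) (\<lambda>s. f (x + s *\<^sub>R b)) 0)"

definition compact_support_in :: "'a::euclidean_space set \<Rightarrow> ('a \<Rightarrow> real) \<Rightarrow> bool" where
  "compact_support_in \<Omega> f \<longleftrightarrow>
     compact (closure {x. f x \<noteq> 0}) \<and> closure {x. f x \<noteq> 0} \<subseteq> \<Omega>"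

text \<open>
  Classical solutions of \<open>\<partial>\<^sub>t u = \<Delta> u\<close> on \<open>\<Omega>\<close> with Dirichlet boundary condition and initial
  datum \<open>f\<close>, for \<open>f\<close> continuous with compact support in \<open>\<Omega>\<close>. Boundary and initial values are
  attained continuously on \<open>[0, \<infinity>) \<times> closure \<Omega>\<close>, so the notion is intended for
  bounded open sets all of whose boundary points are regular, such as triangles.
\<close>

definition dirichlet_heat_solution ::
  "'a::euclidean_space set \<Rightarrow> ('a \<Rightarrow> real) \<Rightarrow> (real \<Rightarrow> 'a \<Rightarrow> real) \<Rightarrow> bool" where
  "dirichlet_heat_solution \<Omega> f u \<longleftrightarrow>
     continuous_on ({0..} \<times> closure \<Omega>) (\<lambda>(t, x). u t x) \<and>
     (\<forall>x\<in>closure \<Omega>. u 0 x = f x) \<and>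
     (\<forall>t\<ge>0. \<forall>x\<in>frontier \<Omega>. u t x = 0) \<and>
     (\<forall>t>0. C2_on \<Omega> (u t) \<and>
        (\<forall>x\<in>\<Omega>. ((\<lambda>s. u s x) has_real_derivative laplacian (u t) x) (at t)))"

text \<open>
  The Dirichlet heat kernel is the continuous integral kernel of the solution operator
  \<open>f \<mapsto> u t\<close>, that is, of \<open>e\<close> to the power \<open>t \<Delta>\<^sub>D\<close>. On bounded \<open>\<Omega>\<close> the maximum
  principle determines it for \<open>t > 0\<close> and \<open>x, y \<in> \<Omega>\<close>; the value 0 elsewhere is a convention that
  makes the definite description below meaningful.
\<close>

definition is_dirichlet_heat_kernel ::
  "'a::euclidean_space set \<Rightarrow> (real \<Rightarrow> 'a \<Rightarrow> 'a \<Rightarrow> real) \<Rightarrow> bool" where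
  "is_dirichlet_heat_kernel \<Omega> p \<longleftrightarrow>
     (\<forall>t>0. continuous_on (\<Omega> \<times> \<Omega>) (\<lambda>(x, y). p t x y)) \<and>
     (\<forall>f. continuous_on UNIV f \<and> compact_support_in \<Omega> f \<longrightarrow>
        (\<exists>u. dirichlet_heat_solution \<Omega> f u \<and>
             (\<forall>t>0. \<forall>x\<in>\<Omega>. u t x = (LINT y:\<Omega>|lborel. p t x y * f y)))) \<and>
     (\<forall>t x y. t \<le> 0 \<or> x \<notin> \<Omega> \<or> y \<notin> \<Omega> \<longrightarrow> p t x y = 0)"

definition dirichlet_heat_kernel :: "'a::euclidean_space set \<Rightarrow> real \<Rightarrow> 'a \<Rightarrow> 'a \<Rightarrow> real" where
  "dirichlet_heat_kernel \<Omega> = (THE p. is_dirichlet_heat_kernel \<Omega> p)"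

definition dirichlet_partition_function :: "'a::euclidean_space set \<Rightarrow> real \<Rightarrow> real" where
  "dirichlet_partition_function \<Omega> t = (LINT x:\<Omega>|lborel. dirichlet_heat_kernel \<Omega> t x x)"

end

theory Submission
  imports Defs "HOL-Probability.Distributions" "HOL-Real_Asymp.Real_Asymp"
begin

text \<open>
  The triangle is a fundamental domain of the affine Weyl group \<open>W\<close> generated by the reflections in
  its sides, so the method of images gives the Dirichlet heat kernel as the sum over \<open>g \<in> W\<close> of
  \<open>det g\<close> times the Gaussian kernel between \<open>x\<close> and \<open>g y\<close>. Reflecting in a side permutes this sum and
  flips its sign, whence the boundary values; the maximum principle makes the kernel unique. On the
  diagonal only the 13 elements of \<open>W\<close> with a fixed point in the closed triangle contribute in the
  limit. The identity gives the area term. For each side, the reflection in it and the reflection in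
  the parallel line through the opposite vertex together integrate to a multiple of a one-dimensional
  Gaussian integral over \<open>[0, 1]\<close>, which is the perimeter term. Each of the six rotations about a vertex
  sees a full sector of angle \<open>\<pi>/3\<close> and contributes \<open>1/18\<close>.
\<close>


subsection \<open>Parameter integrals\<close>

text \<open>The definition of a solution asks for continuity down to time 0, where the image kernel
  is singular. The solution with datum \<open>f\<close> is therefore written in two ways that agree
  for t > 0: \<open>G.U\<close>, a superposition of Gaussians that is differentiated under the
  integral, and \<open>v\<close>, rescaled so that t enters only through the argument of
  \<open>f\<close>. Both are single integrals over \<open>count_space weyl\<close> times the plane,
  so dominated convergence treats lattice sum and space integral together. In the basis
  \<open>e1\<close>, \<open>e2\<close> the group is six integer matrices combined with the
  translations p = q mod 3, and its geometry becomes integer arithmetic. The 13 elements form the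
  union of the stabilizers of the three vertices, dihedral groups of order 6: the identity is common
  to all, each side reflection belongs to two, which leaves 1 + 6 + 6 elements. A rotation by 2 pi/3
  moves a point at distance r from its centre by sqrt 3 r, and (1 / (4 pi t)) (pi/3) times the
  integral of r exp (-3 r^2 / (4 t)) over r > 0 is 1/18. All other elements move every point of the
  triangle by at least L, so they are uniformly negligible.\<close>

lemma continuous_on_LINT_dominated:
  fixes f :: "'a::metric_space \<Rightarrow> 'm \<Rightarrow> 'b::{banach, second_countable_topology}"
  assumes meas: "\<And>x. x \<in> S \<Longrightarrow> f x \<in> borel_measurable M"
    and cont: "\<And>\<omega>. \<omega> \<in> space M \<Longrightarrow> continuous_on S (\<lambda>x. f x \<omega>)"
    and dom: "\<And>x. x \<in> S \<Longrightarrow> \<exists>U w. open U \<and> x \<in> U \<and> integrable M w \<and>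
                (\<forall>y\<in>S \<inter> U. \<forall>\<omega>\<in>space M. norm (f y \<omega>) \<le> w \<omega>)"
  shows "continuous_on S (\<lambda>x. LINT \<omega>|M. f x \<omega>)"
proof (unfold continuous_on_sequentially, intro ballI allI impI, elim conjE)
  fix x :: "nat \<Rightarrow> 'a" and a
  assume a: "a \<in> S" and x: "\<forall>n. x n \<in> S" and lim: "x \<longlonglongrightarrow> a"
  obtain U w where U: "open U" "a \<in> U" and w: "integrable M w"
    and b: "\<And>y \<omega>. y \<in> S \<Longrightarrow> y \<in> U \<Longrightarrow> \<omega> \<in> space M \<Longrightarrow> norm (f y \<omega>) \<le> w \<omega>"
    using dom[OF a] by blast
  obtain N where N: "\<And>n. n \<ge> N \<Longrightarrow> x n \<in> U"
    using topological_tendstoD[OF lim U] by (auto simp: eventually_sequentially)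
  have "(\<lambda>n. LINT \<omega>|M. f (x (n + N)) \<omega>) \<longlonglongrightarrow> (LINT \<omega>|M. f a \<omega>)"
  proof (rule integral_dominated_convergence[where w = w])
    show "AE \<omega> in M. (\<lambda>n. f (x (n + N)) \<omega>) \<longlonglongrightarrow> f a \<omega>"
    proof (rule AE_I2)
      fix \<omega> assume "\<omega> \<in> space M"
      then have "(\<lambda>n. f (x n) \<omega>) \<longlonglongrightarrow> f a \<omega>"
        using cont[of \<omega>] a x lim unfolding continuous_on_sequentially by (auto simp: o_def)
      then show "(\<lambda>n. f (x (n + N)) \<omega>) \<longlonglongrightarrow> f a \<omega>"
        by (rule LIMSEQ_ignore_initial_segment)
    qed
  qed (use meas a x w b N in auto)
  then have "(\<lambda>n. LINT \<omega>|M. f (x n) \<omega>) \<longlonglongrightarrow> (LINT \<omega>|M. f a \<omega>)"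
    by (rule LIMSEQ_offset)
  then show "((\<lambda>x. LINT \<omega>|M. f x \<omega>) \<circ> x) \<longlonglongrightarrow> (LINT \<omega>|M. f a \<omega>)"
    by (simp add: o_def)
qed

text \<open>The mean value inequality on the ball bounds difference quotients by \<open>w\<close>,
  so the normalized Frechet remainder is dominated by \<open>2 * w\<close> and tends to 0 pointwise.
  Stating the derivative through a gradient vector lets the same lemma serve for the space variable
  and, with \<open>'a = real\<close>, for time.\<close>

lemma has_derivative_LINT_dominated:
  fixes K :: "'a::euclidean_space \<Rightarrow> 'm \<Rightarrow> real" and g :: "'a \<Rightarrow> 'm \<Rightarrow> 'a"
  assumes r: "r > 0"
    and int: "\<And>x. x \<in> ball x0 r \<Longrightarrow> integrable M (K x)"
    and meas[measurable]: "g x0 \<in> borel_measurable M"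
    and deriv: "\<And>x \<omega>. x \<in> ball x0 r \<Longrightarrow> \<omega> \<in> space M \<Longrightarrow>
                  ((\<lambda>x. K x \<omega>) has_derivative (\<lambda>h. g x \<omega> \<bullet> h)) (at x)"
    and bound: "\<And>x \<omega>. x \<in> ball x0 r \<Longrightarrow> \<omega> \<in> space M \<Longrightarrow> norm (g x \<omega>) \<le> w \<omega>"
    and w: "integrable M w"
  shows "((\<lambda>x. LINT \<omega>|M. K x \<omega>) has_derivative (\<lambda>h. (LINT \<omega>|M. g x0 \<omega>) \<bullet> h)) (at x0)"
proof -
  have x0: "x0 \<in> ball x0 r" using r by simp
  have ig: "integrable M (g x0)"
    by (rule Bochner_Integration.integrable_bound[OF w]) (use bound[OF x0] order_trans[OF _ abs_ge_self] in \<open>auto intro!: AE_I2\<close>)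
  define N where "N h \<omega> = (K (x0 + h) \<omega> - K x0 \<omega> - g x0 \<omega> \<bullet> h) / norm h" for h \<omega>
  have Nb: "norm (N h \<omega>) \<le> 2 * w \<omega>" if h: "x0 + h \<in> ball x0 r" and \<omega>: "\<omega> \<in> space M" for h \<omega>
  proof -
    have "norm (K (x0 + h) \<omega> - K x0 \<omega>) \<le> w \<omega> * norm (x0 + h - x0)"
    proof (rule differentiable_bound[where S = "ball x0 r" and f' = "\<lambda>x h. g x \<omega> \<bullet> h"])
      fix x assume x: "x \<in> ball x0 r"
      show "((\<lambda>x. K x \<omega>) has_derivative (\<lambda>h. g x \<omega> \<bullet> h)) (at x within ball x0 r)"
        using deriv[OF x \<omega>] by (rule has_derivative_at_withinI)
      show "onorm (\<lambda>h. g x \<omega> \<bullet> h) \<le> w \<omega>"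
        using bound[OF x \<omega>]
        by (intro onorm_le) (metis Cauchy_Schwarz_ineq2 mult_right_mono norm_ge_zero order_trans real_norm_def)
    qed (use x0 h in auto)
    moreover have "norm (g x0 \<omega> \<bullet> h) \<le> w \<omega> * norm h"
      using Cauchy_Schwarz_ineq2[of "g x0 \<omega>" h] mult_right_mono[OF bound[OF x0 \<omega>] norm_ge_zero[of h]] by simp
    ultimately have "norm (K (x0 + h) \<omega> - K x0 \<omega> - g x0 \<omega> \<bullet> h) \<le> 2 * w \<omega> * norm h"
      by simp
    moreover have "w \<omega> \<ge> 0" using bound[OF x0 \<omega>] norm_ge_zero order_trans by blast
    ultimately show ?thesis
      by (cases "h = 0") (auto simp: N_def divide_simps)
  qed
  have lim: "((\<lambda>h. LINT \<omega>|M. N h \<omega>) \<longlongrightarrow> 0) (at 0)"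
    unfolding tendsto_at_iff_sequentially
  proof (intro allI impI)
    fix X :: "nat \<Rightarrow> 'a"
    assume X: "\<forall>i. X i \<in> UNIV - {0}" and X0: "X \<longlonglongrightarrow> 0"
    obtain k where k: "\<And>n. n \<ge> k \<Longrightarrow> x0 + X n \<in> ball x0 r"
    proof -
      from X0 r obtain k where "\<And>n. n \<ge> k \<Longrightarrow> norm (X n) < r"
        unfolding lim_sequentially dist_norm by (metis diff_zero)
      then show thesis by (intro that[of k]) (auto simp: dist_norm)
    qed
    have "(\<lambda>n. LINT \<omega>|M. N (X (n + k)) \<omega>) \<longlonglongrightarrow> (LINT \<omega>|M. 0)"
    proof (rule integral_dominated_convergence[where w = "\<lambda>\<omega>. 2 * w \<omega>"])
      show "integrable M (\<lambda>\<omega>. 2 * w \<omega>)" using w by simp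
      show "N (X (i + k)) \<in> borel_measurable M" for i
        unfolding N_def using int[OF x0] int[OF k[of "i + k"]] by measurable
      show "AE \<omega> in M. norm (N (X (i + k)) \<omega>) \<le> 2 * w \<omega>" for i
        using Nb k by (intro AE_I2) simp
      show "AE \<omega> in M. (\<lambda>n. N (X (n + k)) \<omega>) \<longlonglongrightarrow> 0"
      proof (rule AE_I2)
        fix \<omega> assume \<omega>: "\<omega> \<in> space M"
        have "((\<lambda>h. norm (K (x0 + h) \<omega> - K x0 \<omega> - g x0 \<omega> \<bullet> h) / norm h) \<longlongrightarrow> 0) (at 0)"
          using deriv[OF x0 \<omega>] unfolding has_derivative_at by simp
        then have "(\<lambda>n. norm (N (X n) \<omega>)) \<longlonglongrightarrow> 0"
          using X X0 unfolding tendsto_at_iff_sequentially by (auto simp: o_def N_def)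
        then have "(\<lambda>n. N (X n) \<omega>) \<longlonglongrightarrow> 0" by (rule tendsto_norm_zero_cancel)
        then show "(\<lambda>n. N (X (n + k)) \<omega>) \<longlonglongrightarrow> 0" by (rule LIMSEQ_ignore_initial_segment)
      qed
    qed simp
    then have "(\<lambda>n. LINT \<omega>|M. N (X n) \<omega>) \<longlonglongrightarrow> 0"
      using LIMSEQ_offset by fastforce
    then show "((\<lambda>h. LINT \<omega>|M. N h \<omega>) \<circ> X) \<longlonglongrightarrow> 0" by (simp add: o_def)
  qed
  have eq: "(LINT \<omega>|M. N h \<omega>) = ((LINT \<omega>|M. K (x0 + h) \<omega>) - (LINT \<omega>|M. K x0 \<omega>) - (LINT \<omega>|M. g x0 \<omega>) \<bullet> h) / norm h"
    if "norm h < r" for h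
  proof -
    have "x0 + h \<in> ball x0 r" using that by (simp add: dist_norm)
    then show ?thesis
      unfolding N_def using int[OF x0] int ig by simp
  qed
  have ev: "eventually (\<lambda>h. norm h < r) (at (0::'a))"
    using r by (auto simp: eventually_at dist_norm intro!: exI[of _ r])
  have "((\<lambda>h. ((LINT \<omega>|M. K (x0 + h) \<omega>) - (LINT \<omega>|M. K x0 \<omega>) - (LINT \<omega>|M. g x0 \<omega>) \<bullet> h) / norm h) \<longlongrightarrow> 0) (at 0)"
    by (rule Lim_transform_eventually[OF lim]) (use ev eq in \<open>auto elim!: eventually_mono\<close>)
  then have "((\<lambda>h. norm ((LINT \<omega>|M. K (x0 + h) \<omega>) - (LINT \<omega>|M. K x0 \<omega>) - (LINT \<omega>|M. g x0 \<omega>) \<bullet> h) / norm h) \<longlongrightarrow> 0) (at 0)"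
    by (drule_tac tendsto_norm) simp
  then show ?thesis
    unfolding has_derivative_at by (simp add: bounded_linear_inner_right)
qed

subsection \<open>Superpositions of planar heat kernels\<close>

text \<open>Bridge between two notions of derivative: \<open>laplacian\<close> iterates one-variable
  \<open>deriv\<close> along the axes, while \<open>C2_on\<close> supplies Frechet derivatives. The
  second and third claims are the derivatives along a line, which the maximum principle uses
  directly.\<close>

lemma laplacian_eq_trace_hessian:
  fixes f :: "'a::euclidean_space \<Rightarrow> real"
  assumes S: "open S" "x \<in> S"
    and f: "\<And>x. x \<in> S \<Longrightarrow> (f has_derivative (\<lambda>h. grad x \<bullet> h)) (at x)"
    and grad: "(grad has_derivative hess) (at x)"
  shows "laplacian f x = (\<Sum>b\<in>Basis. hess b \<bullet> b)"
    and "\<forall>\<^sub>F s in nhds 0. ((\<lambda>s. f (x + s *\<^sub>R b)) has_real_derivative grad (x + s *\<^sub>R b) \<bullet> b) (at s)"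
    and "((\<lambda>s. grad (x + s *\<^sub>R b) \<bullet> b) has_real_derivative hess b \<bullet> b) (at 0)"
proof -
  show A: "\<forall>\<^sub>F s in nhds 0. ((\<lambda>s. f (x + s *\<^sub>R b)) has_real_derivative grad (x + s *\<^sub>R b) \<bullet> b) (at s)" for b
  proof -
    have "((\<lambda>s::real. x + s *\<^sub>R b) \<longlongrightarrow> x + 0 *\<^sub>R b) (nhds 0)"
      by (intro tendsto_intros filterlim_ident)
    then have "\<forall>\<^sub>F s in nhds 0. x + s *\<^sub>R b \<in> S"
      using S by (auto intro: topological_tendstoD)
    then show ?thesis
    proof eventually_elim
      case (elim s)
      have line: "((\<lambda>s. x + s *\<^sub>R b) has_derivative (\<lambda>h. h *\<^sub>R b)) (at s)"
        by (auto intro!: derivative_eq_intros)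
      have "(\<lambda>h. grad (x + s *\<^sub>R b) \<bullet> (h *\<^sub>R b)) = (*) (grad (x + s *\<^sub>R b) \<bullet> b)"
        by (simp add: fun_eq_iff)
      with has_derivative_compose[OF line f[OF elim]] show ?case
        by (simp add: has_field_derivative_def)
    qed
  qed
  show B: "((\<lambda>s. grad (x + s *\<^sub>R b) \<bullet> b) has_real_derivative hess b \<bullet> b) (at 0)" for b
  proof -
    have 1: "((\<lambda>s::real. x + s *\<^sub>R b) has_derivative (\<lambda>h. h *\<^sub>R b)) (at 0)"
      by (auto intro!: derivative_eq_intros)
    have 2: "(grad has_derivative hess) (at (x + 0 *\<^sub>R b))" using grad by simp
    have "((\<lambda>s. grad (x + s *\<^sub>R b) \<bullet> b) has_derivative (\<lambda>h. hess (h *\<^sub>R b) \<bullet> b)) (at 0)"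
      by (rule has_derivative_inner_left[OF has_derivative_compose[OF 1 2]])
    moreover have "hess (h *\<^sub>R b) = h *\<^sub>R hess b" for h
      using has_derivative_bounded_linear[OF grad] by (simp add: bounded_linear.linear linear_cmul)
    moreover have "(\<lambda>h. (h *\<^sub>R hess b) \<bullet> b) = (*) (hess b \<bullet> b)"
      by (simp add: fun_eq_iff)
    ultimately show ?thesis
      by (simp add: has_field_derivative_def)
  qed
  have "(deriv ^^ 2) (\<lambda>s. f (x + s *\<^sub>R b)) 0 = hess b \<bullet> b" for b
  proof -
    have "\<forall>\<^sub>F s in nhds 0. deriv (\<lambda>s. f (x + s *\<^sub>R b)) s = grad (x + s *\<^sub>R b) \<bullet> b"
      using A[of b] by eventually_elim (rule DERIV_imp_deriv)
    then have "deriv (deriv (\<lambda>s. f (x + s *\<^sub>R b))) 0 = deriv (\<lambda>s. grad (x + s *\<^sub>R b) \<bullet> b) 0"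
      by (rule deriv_cong_ev) simp
    also have "\<dots> = hess b \<bullet> b" using B by (rule DERIV_imp_deriv)
    finally show ?thesis by (simp add: numeral_2_eq_2)
  qed
  then show "laplacian f x = (\<Sum>b\<in>Basis. hess b \<bullet> b)"
    unfolding laplacian_def by simp
qed

text \<open>The normalization is the one for the plane, whatever the dimension of \<open>'a\<close>.\<close>

definition gauss :: "real \<Rightarrow> 'a::euclidean_space \<Rightarrow> real" where
  "gauss t z = exp (- (norm z)\<^sup>2 / (4 * t)) / (4 * pi * t)"

lemma gauss_nonneg: "t > 0 \<Longrightarrow> gauss t z \<ge> 0"
  by (simp add: gauss_def)

lemma borel_measurable_gauss[measurable (raw)]:
  assumes [measurable]: "f \<in> borel_measurable M"
  shows "(\<lambda>\<omega>. gauss t (f \<omega>)) \<in> borel_measurable M"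
  unfolding gauss_def by measurable

text \<open>With s the squared distance, t \<le> 2 T leaves a decay of s / (8 T). One half of it
  absorbs the moment 1 + s; the other half, s / (16 T), is traded for decay in y through |y|^2 \<le>
  2 R^2 + 2 s, whence 1 / (32 T). The moment 1 + s suffices for two space derivatives and one time
  derivative of the kernel.\<close>

lemma gaussian_moment_domination:
  fixes R T :: real
  assumes T: "T > 0"
  shows "\<exists>C. \<forall>t\<in>{T/2..2*T}. \<forall>x y::'a::euclidean_space. norm x \<le> R \<longrightarrow>
     (1 + (norm (x - y))\<^sup>2) * exp (- (norm (x - y))\<^sup>2 / (4 * t)) \<le> C * exp (- (1 / (32 * T)) * (norm y)\<^sup>2)"
proof (intro exI ballI allI impI)
  fix t and x y :: 'a assume t: "t \<in> {T/2..2*T}" and x: "norm x \<le> R"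
  define s where "s = (norm (x - y))\<^sup>2"
  have s: "s \<ge> 0" by (simp add: s_def)
  have "norm y \<le> norm x + norm (x - y)" by norm
  then have "(norm y)\<^sup>2 \<le> (norm x + norm (x - y))\<^sup>2" by (simp add: power_mono)
  also have "\<dots> \<le> 2 * (norm x)\<^sup>2 + 2 * s"
    using sum_squares_bound[of "norm x" "norm (x - y)"] by (simp add: s_def power2_sum)
  also have "\<dots> \<le> 2 * R\<^sup>2 + 2 * s" using x by (simp add: power_mono)
  finally have y: "(norm y)\<^sup>2 \<le> 2 * R\<^sup>2 + 2 * s" .
  have "s / (8 * T) \<le> s / (4 * t)"
    using t T s by (intro divide_left_mono) auto
  then have "- s / (4 * t) \<le> - s / (8 * T)" by simp
  then have "(1 + s) * exp (- s / (4 * t)) \<le> (1 + s) * exp (- s / (8 * T))"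
    using s by (intro mult_left_mono) auto
  also have "\<dots> \<le> ((1 + 16 * T) * exp (s / (16 * T))) * exp (- s / (8 * T))"
  proof (rule mult_right_mono)
    have "(1 + 16 * T) * (1 + s / (16 * T)) = 1 + s + (16 * T + s / (16 * T))"
      using T by (simp add: distrib_left distrib_right add_divide_distrib)
    moreover have "0 \<le> 16 * T + s / (16 * T)" using T s by simp
    ultimately have "1 + s \<le> (1 + 16 * T) * (1 + s / (16 * T))" by linarith
    also have "\<dots> \<le> (1 + 16 * T) * exp (s / (16 * T))" using T by (intro mult_left_mono exp_ge_add_one_self) auto
    finally show "1 + s \<le> (1 + 16 * T) * exp (s / (16 * T))" .
  qed simp
  also have "\<dots> = (1 + 16 * T) * exp (- s / (16 * T))"
  proof -
    have "s / (16 * T) + - s / (8 * T) = - s / (16 * T)" using T by (simp add: divide_simps)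
    then show ?thesis by (simp only: mult.assoc flip: exp_add)
  qed
  also have "\<dots> \<le> (1 + 16 * T) * (exp (R\<^sup>2 / (16 * T)) * exp (- (1 / (32 * T)) * (norm y)\<^sup>2))"
  proof (rule mult_left_mono)
    have "- s / (16 * T) \<le> R\<^sup>2 / (16 * T) + - (1 / (32 * T)) * (norm y)\<^sup>2"
    proof -
      have "(norm y)\<^sup>2 / (32 * T) \<le> (2 * R\<^sup>2 + 2 * s) / (32 * T)"
        using y T by (intro divide_right_mono) auto
      also have "\<dots> = R\<^sup>2 / (16 * T) + s / (16 * T)" using T by (simp add: divide_simps)
      finally show ?thesis by simp
    qed
    then show "exp (- s / (16 * T)) \<le> exp (R\<^sup>2 / (16 * T)) * exp (- (1 / (32 * T)) * (norm y)\<^sup>2)"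
      by (simp flip: exp_add)
  qed (use T in auto)
  finally show "(1 + (norm (x - y))\<^sup>2) * exp (- (norm (x - y))\<^sup>2 / (4 * t))
      \<le> ((1 + 16 * T) * exp (R\<^sup>2 / (16 * T))) * exp (- (1 / (32 * T)) * (norm y)\<^sup>2)"
    by (simp add: s_def mult.assoc)
qed

lemma has_derivative_gauss:
  fixes x y :: "'a::euclidean_space"
  assumes "t > 0"
  shows "((\<lambda>x. gauss t (x - y)) has_derivative (\<lambda>h. ((- (gauss t (x - y) / (2 * t))) *\<^sub>R (x - y)) \<bullet> h)) (at x)"
proof -
  have 1: "((\<lambda>x. (x - y) \<bullet> (x - y)) has_derivative (\<lambda>h. 2 * ((x - y) \<bullet> h))) (at x)"
    by (auto intro!: derivative_eq_intros simp: inner_commute)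
  have 2: "((\<lambda>s. exp (- s / (4 * t)) / (4 * pi * t)) has_real_derivative
      (- (exp (- s / (4 * t)) / (4 * pi * t) / (4 * t)))) (at s)" for s
    using assms by (auto intro!: derivative_eq_intros)
  from has_derivative_compose[OF 1 2[unfolded has_field_derivative_def]] show ?thesis
    unfolding gauss_def power2_norm_eq_inner by (simp add: mult_ac)
qed

lemma has_derivative_gauss_time:
  fixes z :: "'a::euclidean_space"
  assumes "t > 0"
  shows "((\<lambda>t. gauss t z) has_real_derivative gauss t z * ((norm z)\<^sup>2 / (4 * t\<^sup>2) - 1 / t)) (at t)"
  unfolding gauss_def using assms
  by (auto intro!: derivative_eq_intros simp: field_simps power2_eq_square power3_eq_cube power4_eq_xxxx)

lemma le_one_plus_square: "a \<le> 1 + a\<^sup>2" for a :: real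
proof -
  have "0 \<le> (a - 1 / 2)\<^sup>2" by simp
  then show ?thesis by (simp add: power2_eq_square algebra_simps)
qed

text \<open>
  Sums and integrals of translated heat kernels are treated at once: a lattice sum, an integral against
  the initial datum, and the combination of both are all integrals over a suitable measure \<open>M\<close>.
\<close>

locale gauss_superposition =
  fixes M :: "'m measure" and Y :: "'m \<Rightarrow> 'a::euclidean_space" and h :: "'m \<Rightarrow> real"
  assumes Y[measurable]: "Y \<in> borel_measurable M" and h[measurable]: "h \<in> borel_measurable M"
    and int: "\<And>\<kappa>. \<kappa> > 0 \<Longrightarrow> integrable M (\<lambda>\<omega>. exp (- \<kappa> * (norm (Y \<omega>))\<^sup>2) * h \<omega>)"
begin

definition "U t x = (LINT \<omega>|M. gauss t (x - Y \<omega>) * h \<omega>)"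

text \<open>One majorant for a whole time interval around \<open>T\<close> and all bounded
  \<open>x\<close>. The prefactor 1 / (4 pi t) is largest at t = T / 2, which is where 2 pi T comes
  from.\<close>

lemma domination:
  assumes T: "T > 0"
  obtains w where "integrable M w"
    "\<And>t x \<omega>. t \<in> {T/2..2*T} \<Longrightarrow> norm x \<le> R \<Longrightarrow>
       (1 + (norm (x - Y \<omega>))\<^sup>2) * (gauss t (x - Y \<omega>) * \<bar>h \<omega>\<bar>) \<le> w \<omega>"
proof -
  obtain C where C: "\<And>t x y::'a. t \<in> {T/2..2*T} \<Longrightarrow> norm x \<le> R \<Longrightarrow>
     (1 + (norm (x - y))\<^sup>2) * exp (- (norm (x - y))\<^sup>2 / (4 * t)) \<le> C * exp (- (1 / (32 * T)) * (norm y)\<^sup>2)"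
    using gaussian_moment_domination[OF T, of R] by blast
  show thesis
  proof (rule that[of "\<lambda>\<omega>. C / (2 * pi * T) * \<bar>exp (- (1 / (32 * T)) * (norm (Y \<omega>))\<^sup>2) * h \<omega>\<bar>"])
    show "integrable M (\<lambda>\<omega>. C / (2 * pi * T) * \<bar>exp (- (1 / (32 * T)) * (norm (Y \<omega>))\<^sup>2) * h \<omega>\<bar>)"
      using T by (intro integrable_mult_right integrable_abs int) simp
    fix t \<omega> and x :: 'a assume t: "t \<in> {T/2..2*T}" and x: "norm x \<le> R"
    let ?e = "(1 + (norm (x - Y \<omega>))\<^sup>2) * exp (- (norm (x - Y \<omega>))\<^sup>2 / (4 * t))"
    have e0: "?e \<ge> 0" by simp
    have "(1 + (norm (x - Y \<omega>))\<^sup>2) * (gauss t (x - Y \<omega>) * \<bar>h \<omega>\<bar>) = ?e / (4 * pi * t) * \<bar>h \<omega>\<bar>"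
      by (simp add: gauss_def)
    also have "\<dots> \<le> (C * exp (- (1 / (32 * T)) * (norm (Y \<omega>))\<^sup>2)) / (2 * pi * T) * \<bar>h \<omega>\<bar>"
      using t T C[OF t x, of "Y \<omega>"] order_trans[OF e0 C[OF t x, of "Y \<omega>"]]
      by (intro mult_right_mono frac_le) auto
    finally show "(1 + (norm (x - Y \<omega>))\<^sup>2) * (gauss t (x - Y \<omega>) * \<bar>h \<omega>\<bar>) \<le>
       C / (2 * pi * T) * \<bar>exp (- (1 / (32 * T)) * (norm (Y \<omega>))\<^sup>2) * h \<omega>\<bar>"
      by (simp add: abs_mult mult.assoc)
  qed
qed

lemma domination_fixed_time:
  fixes F :: "'a \<Rightarrow> 'm \<Rightarrow> 'c::{banach, second_countable_topology}"
  assumes t: "t > 0" and F[measurable]: "\<And>x. x \<in> ball x0 1 \<Longrightarrow> F x \<in> borel_measurable M"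
    and F_le: "\<And>x \<omega>. norm (F x \<omega>) \<le> c * ((1 + (norm (x - Y \<omega>))\<^sup>2) * (gauss t (x - Y \<omega>) * \<bar>h \<omega>\<bar>))"
    and c: "c \<ge> 0"
  obtains w where "integrable M w"
    "\<And>x \<omega>. x \<in> ball x0 1 \<Longrightarrow> norm (F x \<omega>) \<le> w \<omega>" 
    "\<And>x. x \<in> ball x0 1 \<Longrightarrow> integrable M (F x)"
proof -
  obtain w where w: "integrable M w" "\<And>s x \<omega>. s \<in> {t/2..2*t} \<Longrightarrow> norm x \<le> norm x0 + 1 \<Longrightarrow>
       (1 + (norm (x - Y \<omega>))\<^sup>2) * (gauss s (x - Y \<omega>) * \<bar>h \<omega>\<bar>) \<le> w \<omega>"
    using domination[OF t, of "norm x0 + 1"] by blast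
  have le: "norm (F x \<omega>) \<le> c * w \<omega>" if "x \<in> ball x0 1" for x \<omega>
  proof -
    have "norm x \<le> norm x0 + 1" using that unfolding mem_ball dist_norm by norm
    then have "c * ((1 + (norm (x - Y \<omega>))\<^sup>2) * (gauss t (x - Y \<omega>) * \<bar>h \<omega>\<bar>)) \<le> c * w \<omega>"
      using t c by (intro mult_left_mono w) auto
    with F_le[of x \<omega>] show ?thesis by linarith
  qed
  have cw: "integrable M (\<lambda>\<omega>. c * w \<omega>)" using w by simp
  show thesis
    by (rule that[of "\<lambda>\<omega>. c * w \<omega>"])
      (use cw le in \<open>auto intro!: Bochner_Integration.integrable_bound[OF cw F] AE_I2 order_trans[OF le abs_ge_self]\<close>)
qed

text \<open>\<open>gU\<close> is the gradient of \<open>U\<close>, and \<open>hU b\<close> below is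
  the gradient of its component along \<open>b\<close>, both found by formal differentiation under
  the integral; the lemmas that follow justify this.\<close>

definition "gU t x = (LINT \<omega>|M. (- (gauss t (x - Y \<omega>) * h \<omega> / (2 * t))) *\<^sub>R (x - Y \<omega>))"

definition "hU b t x = (LINT \<omega>|M. (gauss t (x - Y \<omega>) * h \<omega>) *\<^sub>R
    (((x - Y \<omega>) \<bullet> b / (4 * t\<^sup>2)) *\<^sub>R (x - Y \<omega>) - (1 / (2 * t)) *\<^sub>R b))"

lemma gauss_h_le:
  assumes t: "t > 0"
  shows "norm (gauss t (x - Y \<omega>) * h \<omega>) \<le> 1 * ((1 + (norm (x - Y \<omega>))\<^sup>2) * (gauss t (x - Y \<omega>) * \<bar>h \<omega>\<bar>))"
proof -
  have "1 * (gauss t (x - Y \<omega>) * \<bar>h \<omega>\<bar>) \<le> (1 + (norm (x - Y \<omega>))\<^sup>2) * (gauss t (x - Y \<omega>) * \<bar>h \<omega>\<bar>)"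
    using gauss_nonneg[OF t, of "x - Y \<omega>"] by (intro mult_right_mono) auto
  then show ?thesis using gauss_nonneg[OF t, of "x - Y \<omega>"] by (simp add: abs_mult)
qed

lemma gU_le:
  assumes t: "t > 0"
  shows "norm ((- (gauss t (x - Y \<omega>) * h \<omega> / (2 * t))) *\<^sub>R (x - Y \<omega>))
      \<le> 1 / (2 * t) * ((1 + (norm (x - Y \<omega>))\<^sup>2) * (gauss t (x - Y \<omega>) * \<bar>h \<omega>\<bar>))"
proof -
  have "norm (x - Y \<omega>) * (gauss t (x - Y \<omega>) * \<bar>h \<omega>\<bar>) \<le> (1 + (norm (x - Y \<omega>))\<^sup>2) * (gauss t (x - Y \<omega>) * \<bar>h \<omega>\<bar>)"
    using gauss_nonneg[OF t, of "x - Y \<omega>"] le_one_plus_square by (intro mult_right_mono) auto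
  then show ?thesis using gauss_nonneg[OF t, of "x - Y \<omega>"] t
    by (simp add: abs_mult divide_simps mult_ac)
qed

lemma hU_le:
  assumes t: "t > 0" and b: "b \<in> Basis"
  shows "norm ((gauss t (x - Y \<omega>) * h \<omega>) *\<^sub>R
    (((x - Y \<omega>) \<bullet> b / (4 * t\<^sup>2)) *\<^sub>R (x - Y \<omega>) - (1 / (2 * t)) *\<^sub>R b))
      \<le> (1 / (4 * t\<^sup>2) + 1 / (2 * t)) * ((1 + (norm (x - Y \<omega>))\<^sup>2) * (gauss t (x - Y \<omega>) * \<bar>h \<omega>\<bar>))"
proof -
  let ?z = "x - Y \<omega>" and ?g = "gauss t (x - Y \<omega>) * \<bar>h \<omega>\<bar>"
  have g: "?g \<ge> 0" using gauss_nonneg[OF t, of "x - Y \<omega>"] by simp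
  have "norm ((?z \<bullet> b / (4 * t\<^sup>2)) *\<^sub>R ?z - (1 / (2 * t)) *\<^sub>R b)
     \<le> norm ((?z \<bullet> b / (4 * t\<^sup>2)) *\<^sub>R ?z) + norm ((1 / (2 * t)) *\<^sub>R b)"
    by (rule norm_triangle_ineq4)
  also have "\<dots> = \<bar>?z \<bullet> b\<bar> * norm ?z / (4 * t\<^sup>2) + 1 / (2 * t)"
    using t b by simp
  also have "\<dots> \<le> (norm ?z)\<^sup>2 / (4 * t\<^sup>2) + 1 / (2 * t)"
    using Basis_le_norm[OF b, of ?z] t
    by (intro add_right_mono divide_right_mono) (auto simp: power2_eq_square intro: mult_right_mono)
  also have "\<dots> \<le> (1 / (4 * t\<^sup>2) + 1 / (2 * t)) * (1 + (norm ?z)\<^sup>2)"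
    using t by (simp add: field_simps)
  finally have "?g * norm ((?z \<bullet> b / (4 * t\<^sup>2)) *\<^sub>R ?z - (1 / (2 * t)) *\<^sub>R b)
     \<le> ?g * ((1 / (4 * t\<^sup>2) + 1 / (2 * t)) * (1 + (norm ?z)\<^sup>2))"
    using g by (rule mult_left_mono)
  then show ?thesis using gauss_nonneg[OF t, of ?z] by (simp add: abs_mult mult_ac)
qed

lemma integrable_U: "t > 0 \<Longrightarrow> integrable M (\<lambda>\<omega>. gauss t (x - Y \<omega>) * h \<omega>)"
  by (rule domination_fixed_time[of t "x" "\<lambda>x \<omega>. gauss t (x - Y \<omega>) * h \<omega>" 1])
    (use gauss_h_le in auto)

lemma has_derivative_U:
  assumes t: "t > 0"
  shows "(U t has_derivative (\<lambda>k. gU t x \<bullet> k)) (at x)"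
proof -
  obtain w where w: "integrable M w"
    "\<And>y \<omega>. y \<in> ball x 1 \<Longrightarrow> norm ((- (gauss t (y - Y \<omega>) * h \<omega> / (2 * t))) *\<^sub>R (y - Y \<omega>)) \<le> w \<omega>"
    by (rule domination_fixed_time[of t x "\<lambda>y \<omega>. (- (gauss t (y - Y \<omega>) * h \<omega> / (2 * t))) *\<^sub>R (y - Y \<omega>)" "1 / (2 * t)"])
      (use t gU_le in auto)
  show ?thesis
    unfolding U_def[abs_def] gU_def
  proof (rule has_derivative_LINT_dominated[where r = 1 and w = w])
    fix y \<omega>
    show "((\<lambda>x. gauss t (x - Y \<omega>) * h \<omega>) has_derivative
       (\<lambda>k. ((- (gauss t (y - Y \<omega>) * h \<omega> / (2 * t))) *\<^sub>R (y - Y \<omega>)) \<bullet> k)) (at y)"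
      using has_derivative_mult_left[OF has_derivative_gauss[OF t, of "Y \<omega>" y], of "h \<omega>"]
      by (simp add: mult_ac)
  qed (use w t integrable_U in auto)
qed

text \<open>Differentiation under the integral is available for scalar functions, so each component
  of \<open>gU\<close> is differentiated separately and the vector is reassembled from the
  basis.\<close>

lemma has_derivative_gU:
  assumes t: "t > 0"
  shows "(gU t has_derivative (\<lambda>k. \<Sum>b\<in>Basis. (hU b t x \<bullet> k) *\<^sub>R b)) (at x)"
proof -
  have "((\<lambda>x. gU t x \<bullet> b) has_derivative (\<lambda>k. hU b t x \<bullet> k)) (at x)" if b: "b \<in> Basis" for b
  proof -
    have i1: "integrable M (\<lambda>\<omega>. (- (gauss t (y - Y \<omega>) * h \<omega> / (2 * t))) *\<^sub>R (y - Y \<omega>))" for y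
      by (rule domination_fixed_time[of t y "\<lambda>y \<omega>. (- (gauss t (y - Y \<omega>) * h \<omega> / (2 * t))) *\<^sub>R (y - Y \<omega>)" "1 / (2 * t)"])
        (use t gU_le in auto)
    obtain w where w: "integrable M w"
      "\<And>y \<omega>. y \<in> ball x 1 \<Longrightarrow> norm ((gauss t (y - Y \<omega>) * h \<omega>) *\<^sub>R
          (((y - Y \<omega>) \<bullet> b / (4 * t\<^sup>2)) *\<^sub>R (y - Y \<omega>) - (1 / (2 * t)) *\<^sub>R b)) \<le> w \<omega>"
      by (rule domination_fixed_time[of t x "\<lambda>y \<omega>. (gauss t (y - Y \<omega>) * h \<omega>) *\<^sub>R
          (((y - Y \<omega>) \<bullet> b / (4 * t\<^sup>2)) *\<^sub>R (y - Y \<omega>) - (1 / (2 * t)) *\<^sub>R b)" "1 / (4 * t\<^sup>2) + 1 / (2 * t)"])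
        (use t hU_le b in auto)
    have eq: "gU t y \<bullet> b = (LINT \<omega>|M. ((- (gauss t (y - Y \<omega>) * h \<omega> / (2 * t))) *\<^sub>R (y - Y \<omega>)) \<bullet> b)" for y
      unfolding gU_def by (rule integral_inner_left[symmetric]) (rule i1)
    show ?thesis
      unfolding eq hU_def
    proof (rule has_derivative_LINT_dominated[where r = 1 and w = w])
      fix y \<omega>
      have *: "((\<lambda>x. (x - Y \<omega>) \<bullet> b) has_derivative (\<lambda>k. k \<bullet> b)) (at y)"
        by (auto intro!: derivative_eq_intros)
      show "((\<lambda>x. ((- (gauss t (x - Y \<omega>) * h \<omega> / (2 * t))) *\<^sub>R (x - Y \<omega>)) \<bullet> b) has_derivative
       (\<lambda>k. ((gauss t (y - Y \<omega>) * h \<omega>) *\<^sub>R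
          (((y - Y \<omega>) \<bullet> b / (4 * t\<^sup>2)) *\<^sub>R (y - Y \<omega>) - (1 / (2 * t)) *\<^sub>R b)) \<bullet> k)) (at y)"
      proof -
        have d1: "((\<lambda>x. (- h \<omega> / (2 * t)) * (gauss t (x - Y \<omega>) * ((x - Y \<omega>) \<bullet> b))) has_derivative
          (\<lambda>k. (- h \<omega> / (2 * t)) * (gauss t (y - Y \<omega>) * (k \<bullet> b) +
             (((- (gauss t (y - Y \<omega>) / (2 * t))) *\<^sub>R (y - Y \<omega>)) \<bullet> k) * ((y - Y \<omega>) \<bullet> b)))) (at y)"
          by (intro has_derivative_mult_right has_derivative_mult[OF has_derivative_gauss[OF t] *])
        have d2: "(- h \<omega> / (2 * t)) * (gauss t (y - Y \<omega>) * (k \<bullet> b) +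
             (((- (gauss t (y - Y \<omega>) / (2 * t))) *\<^sub>R (y - Y \<omega>)) \<bullet> k) * ((y - Y \<omega>) \<bullet> b)) =
            ((gauss t (y - Y \<omega>) * h \<omega>) *\<^sub>R
              (((y - Y \<omega>) \<bullet> b / (4 * t\<^sup>2)) *\<^sub>R (y - Y \<omega>) - (1 / (2 * t)) *\<^sub>R b)) \<bullet> k" for k
        proof -
          have "(- h \<omega> / (2 * t)) * (G * B + (- (G / (2 * t)) * C) * A)
              = G * h \<omega> * (A / (4 * t\<^sup>2) * C - 1 / (2 * t) * B)" for A B C G
            using t by (simp add: divide_simps power2_eq_square) (simp add: algebra_simps)
          then show ?thesis
            unfolding inner_diff_left inner_scaleR_left inner_commute[of k b] by simp
        qed
        have d3: "(- h \<omega> / (2 * t)) * (gauss t (x - Y \<omega>) * ((x - Y \<omega>) \<bullet> b)) =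
            ((- (gauss t (x - Y \<omega>) * h \<omega> / (2 * t))) *\<^sub>R (x - Y \<omega>)) \<bullet> b" for x
          by simp
        show ?thesis using d1 unfolding d2 d3 .
      qed
    next
      show "integrable M (\<lambda>\<omega>. ((- (gauss t (y - Y \<omega>) * h \<omega> / (2 * t))) *\<^sub>R (y - Y \<omega>)) \<bullet> b)" for y
        by (rule integrable_inner_left) (rule i1)
    qed (use w t b in auto)
  qed
  then have "((\<lambda>x. \<Sum>b\<in>Basis. (gU t x \<bullet> b) *\<^sub>R b) has_derivative (\<lambda>k. \<Sum>b\<in>Basis. (hU b t x \<bullet> k) *\<^sub>R b)) (at x)"
    by (intro has_derivative_sum has_derivative_scaleR_left)
  then show ?thesis by (simp add: euclidean_representation)
qed

lemma continuous_on_hU: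
  assumes t: "t > 0" and b: "b \<in> Basis"
  shows "continuous_on UNIV (hU b t)"
  unfolding hU_def[abs_def]
proof (rule continuous_on_LINT_dominated)
  fix x
  obtain w where w: "integrable M w"
    "\<And>y \<omega>. y \<in> ball x 1 \<Longrightarrow> norm ((gauss t (y - Y \<omega>) * h \<omega>) *\<^sub>R
        (((y - Y \<omega>) \<bullet> b / (4 * t\<^sup>2)) *\<^sub>R (y - Y \<omega>) - (1 / (2 * t)) *\<^sub>R b)) \<le> w \<omega>"
    by (rule domination_fixed_time[of t x "\<lambda>y \<omega>. (gauss t (y - Y \<omega>) * h \<omega>) *\<^sub>R
        (((y - Y \<omega>) \<bullet> b / (4 * t\<^sup>2)) *\<^sub>R (y - Y \<omega>) - (1 / (2 * t)) *\<^sub>R b)" "1 / (4 * t\<^sup>2) + 1 / (2 * t)"])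
      (use t hU_le b in auto)
  then show "\<exists>U w. open U \<and> x \<in> U \<and> integrable M w \<and> (\<forall>y\<in>UNIV \<inter> U. \<forall>\<omega>\<in>space M. norm ((gauss t (y - Y \<omega>) * h \<omega>) *\<^sub>R
        (((y - Y \<omega>) \<bullet> b / (4 * t\<^sup>2)) *\<^sub>R (y - Y \<omega>) - (1 / (2 * t)) *\<^sub>R b)) \<le> w \<omega>)"
    by (intro exI[of _ "ball x 1"] exI[of _ w]) auto
qed (use t in \<open>auto simp: gauss_def intro!: continuous_intros\<close>)

lemma C2_on_U:
  assumes t: "t > 0"
  shows "C2_on S (U t)"
  unfolding C2_on_def
proof (intro exI conjI ballI)
  \<comment> \<open>Composed from \<open>blinfun_inner_right\<close>, so that continuity in the
    operator norm is inherited from the vectors \<open>hU b t x\<close>.\<close>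
  define H where "H x = (\<Sum>b\<in>Basis. blinfun_scaleR_left b o\<^sub>L blinfun_inner_right (hU b t x))" for x
  fix x
  show "(U t has_derivative (\<lambda>h. gU t x \<bullet> h)) (at x)" by (rule has_derivative_U[OF t])
  show "(gU t has_derivative blinfun_apply (H x)) (at x)"
  proof -
    have "blinfun_apply (H x) = (\<lambda>k. \<Sum>b\<in>Basis. (hU b t x \<bullet> k) *\<^sub>R b)"
      by (rule ext) (simp add: H_def blinfun.sum_left)
    then show ?thesis using has_derivative_gU[OF t, of x] by simp
  qed
  show "continuous_on S H"
    unfolding H_def using continuous_on_subset[OF continuous_on_hU[OF t]]
    by (auto intro!: continuous_intros)
qed

text \<open>The trace of the Hessian produces the term -DIM / (2 t), the time derivative of the
  planar prefactor produces -1 / t. They agree precisely in dimension 2.\<close>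

lemma heat_equation_U:
  assumes t: "t > 0" and dim: "DIM('a) = 2"
  shows "((\<lambda>s. U s x) has_real_derivative laplacian (U t) x) (at t)"
proof -
  have i2: "integrable M (\<lambda>\<omega>. (gauss t (x - Y \<omega>) * h \<omega>) *\<^sub>R
          (((x - Y \<omega>) \<bullet> b / (4 * t\<^sup>2)) *\<^sub>R (x - Y \<omega>) - (1 / (2 * t)) *\<^sub>R b))" if b: "b \<in> Basis" for b
    by (rule domination_fixed_time[of t x "\<lambda>y \<omega>. (gauss t (y - Y \<omega>) * h \<omega>) *\<^sub>R
          (((y - Y \<omega>) \<bullet> b / (4 * t\<^sup>2)) *\<^sub>R (y - Y \<omega>) - (1 / (2 * t)) *\<^sub>R b)" "1 / (4 * t\<^sup>2) + 1 / (2 * t)"])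
        (use t hU_le b in auto)
  define D where "D s \<omega> = gauss s (x - Y \<omega>) * ((norm (x - Y \<omega>))\<^sup>2 / (4 * s\<^sup>2) - 1 / s) * h \<omega>" for s \<omega>
  have "laplacian (U t) x = (\<Sum>b'\<in>Basis. (\<Sum>b\<in>Basis. (hU b t x \<bullet> b') *\<^sub>R b) \<bullet> b')"
    by (rule laplacian_eq_trace_hessian(1)[OF open_UNIV UNIV_I has_derivative_U[OF t] has_derivative_gU[OF t]])
  also have "\<dots> = (\<Sum>b\<in>Basis. hU b t x \<bullet> b)"
    by (intro sum.cong refl) (simp add: inner_sum_left inner_Basis if_distrib sum.If_cases cong: if_cong)
  also have "\<dots> = (\<Sum>b\<in>Basis. (LINT \<omega>|M. ((gauss t (x - Y \<omega>) * h \<omega>) *\<^sub>R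
    (((x - Y \<omega>) \<bullet> b / (4 * t\<^sup>2)) *\<^sub>R (x - Y \<omega>) - (1 / (2 * t)) *\<^sub>R b)) \<bullet> b))"
    unfolding hU_def using i2 by (intro sum.cong refl integral_inner_left[symmetric])
  also have "\<dots> = (LINT \<omega>|M. (\<Sum>b\<in>Basis. ((gauss t (x - Y \<omega>) * h \<omega>) *\<^sub>R
    (((x - Y \<omega>) \<bullet> b / (4 * t\<^sup>2)) *\<^sub>R (x - Y \<omega>) - (1 / (2 * t)) *\<^sub>R b)) \<bullet> b))"
    using i2 by (intro Bochner_Integration.integral_sum[symmetric] integrable_inner_left) auto
  also have "\<dots> = (LINT \<omega>|M. D t \<omega>)"
  proof (rule Bochner_Integration.integral_cong[OF refl])
    fix \<omega>
    let ?z = "x - Y \<omega>"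
    have "(\<Sum>b\<in>Basis. ((gauss t ?z * h \<omega>) *\<^sub>R ((?z \<bullet> b / (4 * t\<^sup>2)) *\<^sub>R ?z - (1 / (2 * t)) *\<^sub>R b)) \<bullet> b)
       = (\<Sum>b\<in>Basis. gauss t ?z * h \<omega> * ((?z \<bullet> b)\<^sup>2 / (4 * t\<^sup>2) - 1 / (2 * t)))"
      by (intro sum.cong refl) (simp add: inner_diff_left power2_eq_square)
    also have "\<dots> = gauss t ?z * h \<omega> * ((\<Sum>b\<in>Basis. (?z \<bullet> b)\<^sup>2) / (4 * t\<^sup>2) - DIM('a) / (2 * t))"
      by (simp add: sum_distrib_left sum_subtractf sum_divide_distrib right_diff_distrib)
    also have "(\<Sum>b\<in>Basis. (?z \<bullet> b)\<^sup>2) = (norm ?z)\<^sup>2"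
      by (subst power2_norm_eq_inner, subst euclidean_inner) (simp add: power2_eq_square)
    finally show "(\<Sum>b\<in>Basis. ((gauss t ?z * h \<omega>) *\<^sub>R ((?z \<bullet> b / (4 * t\<^sup>2)) *\<^sub>R ?z - (1 / (2 * t)) *\<^sub>R b)) \<bullet> b) = D t \<omega>"
      by (simp add: D_def dim)
  qed
  finally have lap: "laplacian (U t) x = (LINT \<omega>|M. D t \<omega>)" .
  obtain w where w: "integrable M w" "\<And>s y \<omega>. s \<in> {t/2..2*t} \<Longrightarrow> norm y \<le> norm x \<Longrightarrow>
       (1 + (norm (y - Y \<omega>))\<^sup>2) * (gauss s (y - Y \<omega>) * \<bar>h \<omega>\<bar>) \<le> w \<omega>"
    using domination[OF t, of "norm x"] by blast
  \<comment> \<open>On the ball of radius t / 2 about t, s > t / 2 gives 1 / (4 s^2) \<le> 1 / t^2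
    and 1 / s \<le> 2 / t.\<close>
  define c where "c = 1 / t\<^sup>2 + 2 / t"
  have c: "c \<ge> 0" using t by (simp add: c_def)
  have "((\<lambda>s. U s x) has_derivative (\<lambda>k. (LINT \<omega>|M. D t \<omega>) \<bullet> k)) (at t)"
    unfolding U_def
  proof (rule has_derivative_LINT_dominated[where r = "t/2" and w = "\<lambda>\<omega>. c * w \<omega>"])
    fix s assume "s \<in> ball t (t/2)"
    then have s: "s > t/2" "s < 2 * t" "s > 0" by (auto simp: dist_real_def abs_if split: if_splits)
    show "integrable M (\<lambda>\<omega>. gauss s (x - Y \<omega>) * h \<omega>)" by (rule integrable_U) (use s in simp)
    fix \<omega>
    let ?z = "x - Y \<omega>"
    show "((\<lambda>s. gauss s ?z * h \<omega>) has_derivative (\<lambda>k. D s \<omega> \<bullet> k)) (at s)"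
      using DERIV_cmult_right[OF has_derivative_gauss_time[of s ?z], of "h \<omega>"] s
      by (simp add: D_def has_field_derivative_def)
    have "\<bar>(norm ?z)\<^sup>2 / (4 * s\<^sup>2) - 1 / s\<bar> \<le> (norm ?z)\<^sup>2 / (4 * s\<^sup>2) + 1 / s"
      using s abs_triangle_ineq4[of "(norm ?z)\<^sup>2 / (4 * s\<^sup>2)" "1 / s"] by simp
    also have "\<dots> \<le> (norm ?z)\<^sup>2 / t\<^sup>2 + 2 / t"
    proof (rule add_mono)
      have "t\<^sup>2 \<le> (2 * s)\<^sup>2" using s t by (intro power_mono) auto
      then show "(norm ?z)\<^sup>2 / (4 * s\<^sup>2) \<le> (norm ?z)\<^sup>2 / t\<^sup>2" using t s by (intro divide_left_mono) auto
      show "1 / s \<le> 2 / t" using s t by (simp add: field_simps)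
    qed
    also have "\<dots> \<le> c * (1 + (norm ?z)\<^sup>2)" using t by (simp add: c_def field_simps)
    finally have "gauss s ?z * \<bar>h \<omega>\<bar> * \<bar>(norm ?z)\<^sup>2 / (4 * s\<^sup>2) - 1 / s\<bar> \<le> gauss s ?z * \<bar>h \<omega>\<bar> * (c * (1 + (norm ?z)\<^sup>2))"
      using gauss_nonneg[OF s(3), of ?z] by (intro mult_left_mono) auto
    also have "\<dots> = c * ((1 + (norm ?z)\<^sup>2) * (gauss s ?z * \<bar>h \<omega>\<bar>))" by simp
    also have "\<dots> \<le> c * w \<omega>" using c s by (intro mult_left_mono w) auto
    finally show "norm (D s \<omega>) \<le> c * w \<omega>"
      using gauss_nonneg[OF s(3), of ?z] by (simp add: D_def abs_mult mult_ac)
  qed (use t w in \<open>auto simp: D_def\<close>)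
  then show ?thesis
    by (simp add: has_field_derivative_def lap)
qed

end

subsection \<open>Uniqueness of the Dirichlet heat kernel\<close>

text \<open>If \<open>d\<close> were positive, \<phi>' would vanish at 0 and be positive just to the
  right, so \<phi> would exceed its maximum there by the mean value theorem. The second derivative
  is assumed at the single point 0, which is all that a Frechet derivative of the gradient at one
  point provides.\<close>

lemma second_derivative_nonpos_at_local_max:
  fixes \<phi> \<phi>' :: "real \<Rightarrow> real"
  assumes d1: "\<forall>\<^sub>F s in nhds 0. (\<phi> has_real_derivative \<phi>' s) (at s)"
    and d2: "(\<phi>' has_real_derivative d) (at 0)"
    and mx: "\<forall>\<^sub>F s in nhds 0. \<phi> s \<le> \<phi> 0"
  shows "d \<le> 0"
proof (rule ccontr)
  assume "\<not> d \<le> 0" then have d: "d > 0" by simp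
  obtain e1 where e1: "e1 > 0" "\<And>s. \<bar>s\<bar> < e1 \<Longrightarrow> (\<phi> has_real_derivative \<phi>' s) (at s)"
    using d1 unfolding eventually_nhds_metric by (auto simp: dist_real_def)
  obtain e2 where e2: "e2 > 0" "\<And>s. \<bar>s\<bar> < e2 \<Longrightarrow> \<phi> s \<le> \<phi> 0"
    using mx unfolding eventually_nhds_metric by (auto simp: dist_real_def)
  have "\<phi>' 0 = 0"
    using DERIV_local_max[of \<phi> "\<phi>' 0" 0 e2] e1(2)[of 0] e1(1) e2 by (auto simp: abs_minus_commute)
  obtain e3 where e3: "e3 > 0" "\<And>h. 0 < h \<Longrightarrow> h < e3 \<Longrightarrow> \<phi>' 0 < \<phi>' (0 + h)"
    using DERIV_pos_inc_right[OF d2 d] by auto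
  define s where "s = min e1 (min e2 e3) / 2"
  have s: "0 < s" "s < e1" "s < e2" "s < e3" using e1 e2 e3 by (auto simp: s_def)
  obtain z where z: "0 < z" "z < s" "\<phi> s - \<phi> 0 = (s - 0) * \<phi>' z"
    using MVT2[of 0 s \<phi> \<phi>'] s e1(2) by auto
  have "\<phi>' z > 0" using e3(2)[of z] z s \<open>\<phi>' 0 = 0\<close> by simp
  then have "\<phi> s > \<phi> 0" using z s by (smt (verit) mult_pos_pos)
  with e2(2)[of s] s show False by simp
qed

text \<open>Weak maximum principle for the difference of two solutions with the same datum, made
  strict by subtracting \<epsilon> t. A positive maximum lies at positive time and in the interior;
  there the Laplacian of the difference is at most 0, so the time derivative is at most -\<epsilon>
  and the value was larger slightly earlier. Looking only backwards in time also covers a maximum at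
  the final time.\<close>

lemma dirichlet_heat_solution_le:
  fixes \<Omega> :: "'a::euclidean_space set"
  assumes \<Omega>: "open \<Omega>" "bounded \<Omega>"
    and u: "dirichlet_heat_solution \<Omega> f u" and v: "dirichlet_heat_solution \<Omega> f v"
    and t0: "t0 \<ge> 0" and x0: "x0 \<in> closure \<Omega>"
  shows "u t0 x0 \<le> v t0 x0"
proof (rule ccontr)
  assume "\<not> u t0 x0 \<le> v t0 x0"
  then have pos: "u t0 x0 - v t0 x0 > 0" by simp
  \<comment> \<open>Small enough that the penalty at time \<open>t0\<close> eats at most half of the
    assumed gap, so the maximum stays positive; \<open>t0 + 1\<close> avoids division by 0.\<close>
  define \<epsilon> where "\<epsilon> = (u t0 x0 - v t0 x0) / 2 / (t0 + 1)"
  have \<epsilon>: "\<epsilon> > 0" using pos t0 by (simp add: \<epsilon>_def)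
  have "\<epsilon> * t0 \<le> \<epsilon> * (t0 + 1)" using \<epsilon> by simp
  also have "\<dots> = (u t0 x0 - v t0 x0) / 2"
    using t0 \<epsilon>_def nonzero_eq_divide_eq[of "t0 + 1" \<epsilon> "(u t0 x0 - v t0 x0) / 2"] by linarith
  finally have \<epsilon>t: "\<epsilon> * t0 < u t0 x0 - v t0 x0" using pos by simp
  define m where "m = (\<lambda>(t, x). u t x - v t x - \<epsilon> * t)"
  let ?K = "{0..t0} \<times> closure \<Omega>"
  have K: "compact ?K" using \<Omega> by (intro compact_Times) auto
  have cu: "continuous_on ?K (\<lambda>(t, x). u t x)" and cv: "continuous_on ?K (\<lambda>(t, x). v t x)"
    using u v unfolding dirichlet_heat_solution_def
    by (auto elim!: continuous_on_subset)
  have cm: "continuous_on ?K m"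
  proof -
    have m_eq: "m = (\<lambda>z. (\<lambda>(t, x). u t x) z - (\<lambda>(t, x). v t x) z - \<epsilon> * fst z)"
      by (auto simp: m_def)
    show ?thesis unfolding m_eq by (intro continuous_intros cu cv)
  qed
  have "?K \<noteq> {}" using t0 x0 by auto
  from continuous_attains_sup[OF K this cm] obtain t1 x1
    where tx: "0 \<le> t1" "t1 \<le> t0" "x1 \<in> closure \<Omega>"
      and mx: "\<And>t x. 0 \<le> t \<Longrightarrow> t \<le> t0 \<Longrightarrow> x \<in> closure \<Omega> \<Longrightarrow> m (t, x) \<le> m (t1, x1)"
    by auto
  have "m (t0, x0) > 0" using \<epsilon>t by (simp add: m_def)
  with mx[of t0 x0] t0 x0 have m1: "m (t1, x1) > 0" by simp
  then have w1: "u t1 x1 - v t1 x1 > 0" using \<epsilon> tx by (simp add: m_def) (smt (verit) mult_nonneg_nonneg)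
  have "t1 \<noteq> 0" using w1 u v tx unfolding dirichlet_heat_solution_def by auto
  with tx have t1: "t1 > 0" by simp
  have "x1 \<notin> frontier \<Omega>" using w1 u v tx unfolding dirichlet_heat_solution_def by auto
  then have x1: "x1 \<in> \<Omega>" using tx \<Omega> by (simp add: frontier_def interior_open)
  obtain gu hu where gu: "\<And>x. x \<in> \<Omega> \<Longrightarrow> (u t1 has_derivative (\<lambda>h. gu x \<bullet> h)) (at x)"
      "\<And>x. x \<in> \<Omega> \<Longrightarrow> (gu has_derivative blinfun_apply (hu x)) (at x)"
    using u t1 unfolding dirichlet_heat_solution_def C2_on_def by meson
  obtain gv hv where gv: "\<And>x. x \<in> \<Omega> \<Longrightarrow> (v t1 has_derivative (\<lambda>h. gv x \<bullet> h)) (at x)"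
      "\<And>x. x \<in> \<Omega> \<Longrightarrow> (gv has_derivative blinfun_apply (hv x)) (at x)"
    using v t1 unfolding dirichlet_heat_solution_def C2_on_def by meson
  note U = laplacian_eq_trace_hessian[OF \<Omega>(1) x1 gu(1) gu(2)[OF x1]]
  note V = laplacian_eq_trace_hessian[OF \<Omega>(1) x1 gv(1) gv(2)[OF x1]]
  have "hu x1 b \<bullet> b - hv x1 b \<bullet> b \<le> 0" for b
  proof (rule second_derivative_nonpos_at_local_max)
    show "\<forall>\<^sub>F s in nhds 0. ((\<lambda>s. u t1 (x1 + s *\<^sub>R b) - v t1 (x1 + s *\<^sub>R b)) has_real_derivative
        gu (x1 + s *\<^sub>R b) \<bullet> b - gv (x1 + s *\<^sub>R b) \<bullet> b) (at s)"
      by (rule eventually_elim2[OF U(2)[of b] V(2)[of b] DERIV_diff])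
    show "((\<lambda>s. gu (x1 + s *\<^sub>R b) \<bullet> b - gv (x1 + s *\<^sub>R b) \<bullet> b) has_real_derivative
        hu x1 b \<bullet> b - hv x1 b \<bullet> b) (at 0)"
      by (rule DERIV_diff[OF U(3) V(3)])
    have "((\<lambda>s::real. x1 + s *\<^sub>R b) \<longlongrightarrow> x1 + 0 *\<^sub>R b) (nhds 0)"
      by (intro tendsto_intros filterlim_ident)
    then have "\<forall>\<^sub>F s in nhds 0. x1 + s *\<^sub>R b \<in> \<Omega>"
      using \<Omega> x1 by (auto intro: topological_tendstoD)
    then show "\<forall>\<^sub>F s in nhds 0. u t1 (x1 + s *\<^sub>R b) - v t1 (x1 + s *\<^sub>R b)
        \<le> u t1 (x1 + 0 *\<^sub>R b) - v t1 (x1 + 0 *\<^sub>R b)"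
    proof eventually_elim
      case (elim s)
      then have "m (t1, x1 + s *\<^sub>R b) \<le> m (t1, x1)"
        using closure_subset[of \<Omega>] tx by (intro mx) auto
      then show ?case by (simp add: m_def)
    qed
  qed
  then have lap: "laplacian (u t1) x1 - laplacian (v t1) x1 \<le> 0"
    by (simp add: U(1) V(1) sum_mono)
  have "((\<lambda>s. u s x1 - v s x1 - \<epsilon> * s) has_real_derivative
      laplacian (u t1) x1 - laplacian (v t1) x1 - \<epsilon>) (at t1)"
    using u v t1 x1 unfolding dirichlet_heat_solution_def
    by (auto intro!: derivative_eq_intros)
  from DERIV_neg_dec_left[OF this] lap \<epsilon> obtain d where d: "d > 0"
    "\<And>h. 0 < h \<Longrightarrow> h < d \<Longrightarrow> m (t1, x1) < m (t1 - h, x1)"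
    by (auto simp: m_def)
  define h where "h = min d t1 / 2"
  have h: "0 < h" "h < d" "h < t1" using d t1 by (auto simp: h_def)
  with d(2)[of h] mx[of "t1 - h" x1] tx show False by simp
qed

lemma open_nonempty_not_AE_notin:
  fixes S :: "'a::euclidean_space set"
  assumes "open S" "AE y in lborel. y \<notin> S"
  shows "S = {}"
proof -
  have "S \<in> null_sets lborel"
    using assms by (subst AE_iff_null_sets) auto
  then have "negligible S"
    by (simp add: negligible_iff_null_sets null_sets_completionI)
  then show ?thesis using assms open_not_negligible by blast
qed

text \<open>If one kernel exceeds the other at a point, then by continuity it does so on a small
  ball in the second variable. A nonnegative datum living on that ball yields two solutions that
  agree by the maximum principle, although the integral of their difference is positive.\<close>

lemma dirichlet_heat_kernel_le:
  fixes \<Omega> :: "'a::euclidean_space set"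
  assumes \<Omega>: "open \<Omega>" "bounded \<Omega>"
    and p: "is_dirichlet_heat_kernel \<Omega> p" and q: "is_dirichlet_heat_kernel \<Omega> q"
  shows "p t x y \<le> q t x y"
proof (rule ccontr)
  assume neg: "\<not> p t x y \<le> q t x y"
  then have t: "t > 0" and x: "x \<in> \<Omega>" and y: "y \<in> \<Omega>"
    using p q unfolding is_dirichlet_heat_kernel_def by (smt (verit))+
  have cont: "continuous_on \<Omega> (\<lambda>y. k t x y)" if k: "is_dirichlet_heat_kernel \<Omega> k" for k
  proof -
    have "continuous_on (\<Omega> \<times> \<Omega>) (\<lambda>(x, y). k t x y)"
      using k t unfolding is_dirichlet_heat_kernel_def by auto
    then have "continuous_on \<Omega> ((\<lambda>(x, y). k t x y) \<circ> (\<lambda>y. (x, y)))"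
      using x by (intro continuous_on_compose) (auto intro!: continuous_intros elim!: continuous_on_subset)
    then show ?thesis by (simp add: o_def)
  qed
  have "continuous_on \<Omega> (\<lambda>y. p t x y - q t x y)" by (intro continuous_intros cont p q)
  then have "open {y \<in> \<Omega>. p t x y - q t x y > 0}"
    using \<Omega> continuous_on_open_vimage[of \<Omega> "\<lambda>y. p t x y - q t x y"]
    by (auto simp: vimage_def Collect_conj_eq Int_commute dest!: spec[of _ "{0<..}"])
  then obtain r where r: "r > 0" "cball y r \<subseteq> {y \<in> \<Omega>. p t x y - q t x y > 0}"
    using neg y by (force simp: open_contains_cball)
  \<comment> \<open>A tent that is positive exactly on the open ball; its support is the closed
    ball, hence compact in \<Omega>.\<close>
  define f where "f z = max 0 (r - dist y z)" for z
  have cf: "continuous_on S f" for S unfolding f_def by (intro continuous_intros)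
  have supp: "{z. f z \<noteq> 0} = ball y r" by (auto simp: f_def)
  then have cs: "compact_support_in \<Omega> f"
    using r by (auto simp: compact_support_in_def)
  obtain u where u: "dirichlet_heat_solution \<Omega> f u" "\<And>t x. t > 0 \<Longrightarrow> x \<in> \<Omega> \<Longrightarrow> u t x = (LINT y:\<Omega>|lborel. p t x y * f y)"
    using p cf[of UNIV] cs unfolding is_dirichlet_heat_kernel_def by blast
  obtain v where v: "dirichlet_heat_solution \<Omega> f v" "\<And>t x. t > 0 \<Longrightarrow> x \<in> \<Omega> \<Longrightarrow> v t x = (LINT y:\<Omega>|lborel. q t x y * f y)"
    using q cf[of UNIV] cs unfolding is_dirichlet_heat_kernel_def by blast
  have xc: "x \<in> closure \<Omega>" using x closure_subset by auto
  have uv: "u t x = v t x"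
    using dirichlet_heat_solution_le[OF \<Omega> u(1) v(1) _ xc] dirichlet_heat_solution_le[OF \<Omega> v(1) u(1) _ xc] t
    by (simp add: order_antisym)
  \<comment> \<open>A kernel is known only to be continuous in \<Omega>, so integrability is secured
    on the compact ball, outside of which \<open>f\<close> vanishes; this makes the integrals
    subtractable.\<close>
  have int: "integrable lborel (\<lambda>z. indicator (cball y r) z *\<^sub>R (k t x z * f z))"
    and eq: "(LINT z:\<Omega>|lborel. k t x z * f z) = (LINT z|lborel. indicator (cball y r) z *\<^sub>R (k t x z * f z))"
    if k: "is_dirichlet_heat_kernel \<Omega> k" for k
  proof -
    show "integrable lborel (\<lambda>z. indicator (cball y r) z *\<^sub>R (k t x z * f z))"
      using r by (intro borel_integrable_compact continuous_intros cf continuous_on_subset[OF cont[OF k]]) auto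
    show "(LINT z:\<Omega>|lborel. k t x z * f z) = (LINT z|lborel. indicator (cball y r) z *\<^sub>R (k t x z * f z))"
      unfolding set_lebesgue_integral_def
      by (rule Bochner_Integration.integral_cong[OF refl]) (use r supp in \<open>auto simp: indicator_def f_def\<close>)
  qed
  define D where "D z = indicator (cball y r) z *\<^sub>R ((p t x z - q t x z) * f z)" for z
  have D: "D z = indicator (cball y r) z *\<^sub>R (p t x z * f z) - indicator (cball y r) z *\<^sub>R (q t x z * f z)" for z
    by (simp add: D_def algebra_simps)
  have Dint: "integrable lborel D" unfolding D[abs_def] using int[OF p] int[OF q] by (rule Bochner_Integration.integrable_diff)
  have "integral\<^sup>L lborel D = u t x - v t x"
    unfolding D[abs_def] using int[OF p] int[OF q] eq[OF p] eq[OF q] u(2)[OF t x] v(2)[OF t x]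
    by (simp del: real_scaleR_def)
  then have D0: "integral\<^sup>L lborel D = 0" using uv by simp
  have Dnn: "D z \<ge> 0" for z
  proof (cases "z \<in> cball y r")
    case True
    with r have "p t x z - q t x z > 0" by blast
    then show ?thesis by (simp add: D_def f_def)
  qed (simp add: D_def)
  have "AE z in lborel. D z = 0"
    using integral_nonneg_eq_0_iff_AE[OF Dint] Dnn D0 by simp
  then have "AE z in lborel. z \<notin> ball y r"
  proof eventually_elim
    case (elim z)
    show ?case
    proof
      assume z: "z \<in> ball y r"
      then have "z \<in> cball y r" by simp
      with r have "p t x z - q t x z > 0" by blast
      with z elim show False by (auto simp: D_def f_def indicator_def)
    qed
  qed
  then have "ball y r = {}" by (intro open_nonempty_not_AE_notin) auto
  with r show False by simp
qed

lemma dirichlet_heat_kernel_eqI: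
  fixes \<Omega> :: "'a::euclidean_space set"
  assumes "open \<Omega>" "bounded \<Omega>" and p: "is_dirichlet_heat_kernel \<Omega> p"
  shows "dirichlet_heat_kernel \<Omega> = p"
  unfolding dirichlet_heat_kernel_def using assms dirichlet_heat_kernel_le
  by (intro the_equality) (auto intro!: ext order_antisym)

subsection \<open>Planar integrals\<close>

lemma measurable_vec2[measurable]: "(\<lambda>z. vector [fst z, snd z] :: real ^ 2) \<in> borel_measurable borel"
proof -
  have vec: "(vector [fst p, snd p] :: real ^ 2) = (\<chi> i. if i = 1 then fst p else snd p)" for p
  proof -
    have "(vector [fst p, snd p] :: real ^ 2) $ i = (if i = 1 then fst p else snd p)" for i :: 2
      using exhaust_2[of i] by auto
    then show ?thesis by (simp add: vec_eq_iff)
  qed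
  show ?thesis
    unfolding vec
  proof (intro borel_measurable_continuous_onI continuous_on_vec_lambda)
    fix i :: 2
    show "continuous_on UNIV (\<lambda>p :: real \<times> real. if i = 1 then fst p else snd p)"
      by (cases "i = 1") (auto intro!: continuous_intros)
  qed
qed

text \<open>The image of product Lebesgue measure under \<open>T\<close> has the right value on
  boxes, which characterizes \<open>lborel\<close>; Tonelli does the rest.\<close>

lemma nn_integral_lborel_vec2:
  fixes F :: "real ^ 2 \<Rightarrow> ennreal"
  assumes F[measurable]: "F \<in> borel_measurable borel"
  shows "(\<integral>\<^sup>+x. F x \<partial>lborel) = (\<integral>\<^sup>+y. \<integral>\<^sup>+x. F (vector [x, y]) \<partial>lborel \<partial>lborel)"
proof -
  define T where "T = (\<lambda>(x, y). vector [x, y] :: real ^ 2)"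
  have T[measurable]: "T \<in> borel_measurable borel"
    using measurable_vec2 by (simp add: T_def case_prod_beta)
  have basis: "(Basis :: (real ^ 2) set) = {axis 1 1, axis 2 1}"
    by (auto simp: Basis_vec_def UNIV_2)
  note prod_basis = prod.insert[of "{axis 2 1 :: real ^ 2}" "axis 1 1"]
  have "lborel = distr (lborel :: (real \<times> real) measure) borel T"
  proof (rule lborel_eqI)
    fix l u :: "real ^ 2" assume lu: "\<And>b. b \<in> Basis \<Longrightarrow> l \<bullet> b \<le> u \<bullet> b"
    have le: "l $ 1 \<le> u $ 1" "l $ 2 \<le> u $ 2"
      using lu[of "axis 1 1"] lu[of "axis 2 1"] by (auto simp: basis inner_axis)
    have "T -` box l u = box (l $ 1, l $ 2) (u $ 1, u $ 2)"
      by (auto simp: T_def mem_box_cart forall_2 box_prod mem_box)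
    then have "emeasure (distr lborel borel T) (box l u) = emeasure lborel (box (l $ 1, l $ 2) (u $ 1, u $ 2))"
      by (simp add: emeasure_distr)
    also have "\<dots> = ennreal ((u $ 1 - l $ 1) * (u $ 2 - l $ 2))"
      using le by (simp add: emeasure_lborel_box_eq Basis_prod_def prod.union_disjoint)
    also have "(u $ 1 - l $ 1) * (u $ 2 - l $ 2) = (\<Prod>b\<in>Basis. (u - l) \<bullet> b)"
      by (simp add: basis prod_basis axis_eq_axis inner_axis)
    finally show "emeasure (distr lborel borel T) (box l u) = (\<Prod>b\<in>Basis. (u - l) \<bullet> b)" .
  qed simp
  then have "(\<integral>\<^sup>+x. F x \<partial>lborel) = (\<integral>\<^sup>+x. F x \<partial>distr (lborel :: (real \<times> real) measure) borel T)"
    by simp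
  also have "\<dots> = (\<integral>\<^sup>+p. F (T p) \<partial>(lborel \<Otimes>\<^sub>M lborel))"
    by (subst nn_integral_distr) (simp_all add: lborel_prod)
  also have "\<dots> = (\<integral>\<^sup>+y. \<integral>\<^sup>+x. F (T (x, y)) \<partial>lborel \<partial>lborel)"
    by (subst lborel_pair.nn_integral_snd[symmetric]) (simp_all add: lborel_prod)
  finally show ?thesis by (simp add: T_def)
qed

text \<open>The planar substitution is split into two one-dimensional affine ones, of factor
  \<open>m\<close> for y at fixed x and of factor \<open>a\<close> for x at fixed v, with Tonelli in
  between. This requires a \<noteq> 0; otherwise u and v exchange roles in the next lemma.\<close>

lemma nn_integral_affine2_aux:
  fixes G :: "real \<times> real \<Rightarrow> ennreal"
  assumes G[measurable]: "G \<in> borel_measurable borel" and a: "a \<noteq> 0" and D: "a * d - b * c \<noteq> 0"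
  shows "(\<integral>\<^sup>+y. \<integral>\<^sup>+x. G (x, y) \<partial>lborel \<partial>lborel) =
    ennreal \<bar>a * d - b * c\<bar> * (\<integral>\<^sup>+v. \<integral>\<^sup>+u. G (p + a * u + c * v, q + b * u + d * v) \<partial>lborel \<partial>lborel)"
proof -
  have G'[measurable]: "G \<in> borel_measurable (borel \<Otimes>\<^sub>M borel)" by (simp add: borel_prod)
  \<comment> \<open>The integrand in mixed coordinates, old x and new v: here u = (x - p - c v) / a
    has been eliminated.\<close>
  define H where "H x v = G (x, q + d * v + b / a * (x - p - c * v))" for x v
  have [measurable]: "case_prod H \<in> borel_measurable (borel \<Otimes>\<^sub>M borel)" unfolding H_def by measurable
  define m where "m = (a * d - b * c) / a"
  have m: "m \<noteq> 0" using a D by (simp add: m_def)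
  have 1: "(\<integral>\<^sup>+x. H x v \<partial>lborel) = ennreal \<bar>a\<bar> * (\<integral>\<^sup>+u. G (p + a * u + c * v, q + b * u + d * v) \<partial>lborel)" for v
  proof (subst nn_integral_real_affine[of _ a "p + c * v"])
    have "H (p + c * v + a * u) v = G (p + a * u + c * v, q + b * u + d * v)" for u
      using a by (simp add: H_def algebra_simps)
    then show "ennreal \<bar>a\<bar> * (\<integral>\<^sup>+u. H (p + c * v + a * u) v \<partial>lborel) =
        ennreal \<bar>a\<bar> * (\<integral>\<^sup>+u. G (p + a * u + c * v, q + b * u + d * v) \<partial>lborel)" by simp
  qed (use a in auto)
  have 2: "(\<integral>\<^sup>+y. G (x, y) \<partial>lborel) = ennreal \<bar>m\<bar> * (\<integral>\<^sup>+v. H x v \<partial>lborel)" for x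
  proof (subst nn_integral_real_affine[of _ m "q + b / a * (x - p)"])
    have "q + b / a * (x - p) + m * v = q + d * v + b / a * (x - p - c * v)" for v
      using a by (simp add: m_def field_simps)
    then show "ennreal \<bar>m\<bar> * (\<integral>\<^sup>+v. G (x, q + b / a * (x - p) + m * v) \<partial>lborel) = ennreal \<bar>m\<bar> * (\<integral>\<^sup>+v. H x v \<partial>lborel)"
      by (simp only: H_def)
  qed (use m in auto)
  have "(\<integral>\<^sup>+y. \<integral>\<^sup>+x. G (x, y) \<partial>lborel \<partial>lborel) = (\<integral>\<^sup>+x. \<integral>\<^sup>+y. G (x, y) \<partial>lborel \<partial>lborel)"
    by (rule lborel_pair.Fubini') simp
  also have "\<dots> = ennreal \<bar>m\<bar> * (\<integral>\<^sup>+x. \<integral>\<^sup>+v. H x v \<partial>lborel \<partial>lborel)"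
    unfolding 2 by (rule nn_integral_cmult) simp
  also have "(\<integral>\<^sup>+x. \<integral>\<^sup>+v. H x v \<partial>lborel \<partial>lborel) = (\<integral>\<^sup>+v. \<integral>\<^sup>+x. H x v \<partial>lborel \<partial>lborel)"
    by (rule lborel_pair.Fubini'[symmetric]) simp
  also have "\<dots> = ennreal \<bar>a\<bar> * (\<integral>\<^sup>+v. \<integral>\<^sup>+u. G (p + a * u + c * v, q + b * u + d * v) \<partial>lborel \<partial>lborel)"
    unfolding 1 by (rule nn_integral_cmult) simp
  also have "ennreal \<bar>m\<bar> * (ennreal \<bar>a\<bar> * X) = ennreal \<bar>a * d - b * c\<bar> * X" for X
    using a by (simp add: m_def mult.assoc[symmetric] ennreal_mult[symmetric] abs_divide)
  finally show ?thesis .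
qed

lemma nn_integral_affine2:
  fixes G :: "real \<times> real \<Rightarrow> ennreal"
  assumes G[measurable]: "G \<in> borel_measurable borel" and D: "a * d - b * c \<noteq> 0"
  shows "(\<integral>\<^sup>+y. \<integral>\<^sup>+x. G (x, y) \<partial>lborel \<partial>lborel) =
    ennreal \<bar>a * d - b * c\<bar> * (\<integral>\<^sup>+v. \<integral>\<^sup>+u. G (p + a * u + c * v, q + b * u + d * v) \<partial>lborel \<partial>lborel)"
proof (cases "a = 0")
  case False
  then show ?thesis by (rule nn_integral_affine2_aux[OF G _ D])
next
  case True
  have G'[measurable]: "G \<in> borel_measurable (borel \<Otimes>\<^sub>M borel)" by (simp add: borel_prod)
  have c: "c \<noteq> 0" and D': "c * b - d * a \<noteq> 0" using True D by auto
  have "\<bar>c * b - d * a\<bar> = \<bar>a * d - b * c\<bar>" by (simp add: abs_minus_commute mult.commute)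
  then have "(\<integral>\<^sup>+y. \<integral>\<^sup>+x. G (x, y) \<partial>lborel \<partial>lborel) =
    ennreal \<bar>a * d - b * c\<bar> * (\<integral>\<^sup>+u. \<integral>\<^sup>+v. G (p + c * v + a * u, q + d * v + b * u) \<partial>lborel \<partial>lborel)"
    using nn_integral_affine2_aux[OF G c D', of p q] by simp
  also have "(\<integral>\<^sup>+u. \<integral>\<^sup>+v. G (p + c * v + a * u, q + d * v + b * u) \<partial>lborel \<partial>lborel)
     = (\<integral>\<^sup>+v. \<integral>\<^sup>+u. G (p + c * v + a * u, q + d * v + b * u) \<partial>lborel \<partial>lborel)"
    by (rule lborel_pair.Fubini') measurable
  finally show ?thesis by (simp add: ac_simps)
qed

lemma nn_integral_gauss:
  assumes k: "k > 0"
  shows "(\<integral>\<^sup>+x. ennreal (exp (- k * (x::real)\<^sup>2)) \<partial>lborel) = ennreal (sqrt (pi / k))"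
proof -
  have "normal_density 0 (1 / sqrt (2 * k)) x = sqrt (k / pi) * exp (- k * x\<^sup>2)" for x
    using k by (simp add: normal_density_def power_divide real_sqrt_divide field_simps)
  moreover have "(\<integral>\<^sup>+x. ennreal (normal_density 0 (1 / sqrt (2 * k)) x) \<partial>lborel) = 1"
    using k by (subst nn_integral_eq_integral) auto
  ultimately have "ennreal (sqrt (k / pi)) * (\<integral>\<^sup>+x. ennreal (exp (- k * (x::real)\<^sup>2)) \<partial>lborel) = 1"
    using k by (subst nn_integral_cmult[symmetric]) (simp_all add: ennreal_mult)
  then have "ennreal (sqrt (pi / k)) * (ennreal (sqrt (k / pi)) * (\<integral>\<^sup>+x. ennreal (exp (- k * (x::real)\<^sup>2)) \<partial>lborel)) = ennreal (sqrt (pi / k))"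
    by simp
  moreover have "sqrt (pi / k) * sqrt (k / pi) = 1" using k by (simp flip: real_sqrt_mult)
  ultimately show ?thesis
    using k by (simp add: mult.assoc[symmetric] ennreal_mult[symmetric])
qed

lemma nn_integral_exp_sq_vec2:
  assumes k: "k > 0"
  shows "(\<integral>\<^sup>+x. ennreal (exp (- k * (norm (x::real^2))\<^sup>2)) \<partial>lborel) = ennreal (pi / k)"
proof -
  have "(norm (vector [x, y] :: real^2))\<^sup>2 = x\<^sup>2 + y\<^sup>2" for x y
    unfolding power2_norm_eq_inner by (simp add: inner_vec_def sum_2 power2_eq_square)
  then have "(\<integral>\<^sup>+x. ennreal (exp (- k * (norm (x::real^2))\<^sup>2)) \<partial>lborel) =
     (\<integral>\<^sup>+y. \<integral>\<^sup>+x. ennreal (exp (- k * y\<^sup>2)) * ennreal (exp (- k * x\<^sup>2)) \<partial>lborel \<partial>lborel)"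
    by (subst nn_integral_lborel_vec2) (simp_all add: ring_distribs exp_add[symmetric] ennreal_mult[symmetric] add.commute exp_diff)
  also have "\<dots> = ennreal (sqrt (pi / k)) * ennreal (sqrt (pi / k))"
    by (simp add: nn_integral_cmult nn_integral_multc nn_integral_gauss[OF k, simplified])
  also have "\<dots> = ennreal (pi / k)" using k by (simp add: ennreal_mult[symmetric])
  finally show ?thesis .
qed

lemma integrable_exp_sq_vec2:
  assumes k: "k > 0"
  shows "integrable lborel (\<lambda>x::real^2. exp (- k * (norm x)\<^sup>2))"
    and "(LINT x|lborel. exp (- k * (norm (x::real^2))\<^sup>2)) = pi / k"
proof -
  have "has_bochner_integral lborel (\<lambda>x::real^2. exp (- k * (norm x)\<^sup>2)) (pi / k)"
    using nn_integral_exp_sq_vec2[OF k] k by (intro has_bochner_integral_nn_integral) auto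
  then show "integrable lborel (\<lambda>x::real^2. exp (- k * (norm x)\<^sup>2))"
    and "(LINT x|lborel. exp (- k * (norm (x::real^2))\<^sup>2)) = pi / k"
    by (auto simp: has_bochner_integral_iff)
qed

lemma gauss_eq_exp: "gauss t z = exp (- (1 / (4 * t)) * (norm z)\<^sup>2) / (4 * pi * t)"
  by (simp add: gauss_def)

lemma integral_gauss: "t > 0 \<Longrightarrow> (LINT z|lborel. gauss t (z :: real^2)) = 1"
  unfolding gauss_eq_exp[abs_def] using integrable_exp_sq_vec2[of "1 / (4 * t)"]
  by (auto simp del: minus_mult_minus)

text \<open>A Gaussian over a sector of angle pi/3 in skew coordinates: the form is the squared norm
  of u e1 + v e2 for unit vectors at that angle, the sector integral is (pi/3) / (2 k), and division
  by the Jacobian sqrt 3 / 2 gives the value.\<close>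

lemma nn_integral_quadrant_exp:
  assumes k: "k > 0"
  shows "(\<integral>\<^sup>+v. \<integral>\<^sup>+u. ennreal (exp (- k * (u\<^sup>2 + u * v + (v::real)\<^sup>2))) * indicator {0<..} u * indicator {0<..} v \<partial>lborel \<partial>lborel)
    = ennreal (pi / (3 * sqrt 3 * k))"
proof -
  \<comment> \<open>Substituting \<open>u = v s\<close> makes the inner integral elementary and leaves an arctangent.\<close>
  let ?I = "indicator {0<..} :: real \<Rightarrow> ennreal"
  let ?ff = "\<lambda>v s. v * exp (- k * (v\<^sup>2 * (1 + s + s\<^sup>2))) :: real"
  have pos: "1 + s + s\<^sup>2 > 0" for s :: real
  proof -
    have "1 + s + s\<^sup>2 = (s + 1 / 2)\<^sup>2 + 3 / 4" by (simp add: power2_eq_square algebra_simps)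
    also have "\<dots> > 0" by (simp add: add_nonneg_pos)
    finally show ?thesis .
  qed
  have "(\<integral>\<^sup>+v. \<integral>\<^sup>+u. ennreal (exp (- k * (u\<^sup>2 + u * v + (v::real)\<^sup>2))) * ?I u * ?I v \<partial>lborel \<partial>lborel)
     = (\<integral>\<^sup>+v. \<integral>\<^sup>+s. ennreal (?ff v s) * ?I s * ?I v \<partial>lborel \<partial>lborel)"
  proof (rule nn_integral_cong, cases)
    fix v :: real assume v: "v > 0"
    have "ennreal \<bar>v\<bar> * (ennreal (exp (- k * ((0 + v * s)\<^sup>2 + (0 + v * s) * v + v\<^sup>2))) * ?I (0 + v * s) * ?I v)
       = ennreal (?ff v s) * ?I s * ?I v" for s
    proof -
      have "(0 + v * s)\<^sup>2 + (0 + v * s) * v + v\<^sup>2 = v\<^sup>2 * (1 + s + s\<^sup>2)" by (simp add: power2_eq_square algebra_simps)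
      moreover have "?I (0 + v * s) = ?I s" using v by (simp add: indicator_def zero_less_mult_iff)
      ultimately show ?thesis using v by (simp add: ennreal_mult mult.assoc)
    qed
    note eq = this
    have "(\<integral>\<^sup>+u. ennreal (exp (- k * (u\<^sup>2 + u * v + v\<^sup>2))) * ?I u * ?I v \<partial>lborel)
      = ennreal \<bar>v\<bar> * (\<integral>\<^sup>+s. ennreal (exp (- k * ((0 + v * s)\<^sup>2 + (0 + v * s) * v + v\<^sup>2))) * ?I (0 + v * s) * ?I v \<partial>lborel)"
      using v by (intro nn_integral_real_affine) simp_all
    also have "\<dots> = (\<integral>\<^sup>+s. ennreal \<bar>v\<bar> * (ennreal (exp (- k * ((0 + v * s)\<^sup>2 + (0 + v * s) * v + v\<^sup>2))) * ?I (0 + v * s) * ?I v) \<partial>lborel)"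
      by (rule nn_integral_cmult[symmetric]) simp
    finally show "(\<integral>\<^sup>+u. ennreal (exp (- k * (u\<^sup>2 + u * v + v\<^sup>2))) * ?I u * ?I v \<partial>lborel)
       = (\<integral>\<^sup>+s. ennreal (?ff v s) * ?I s * ?I v \<partial>lborel)"
      unfolding eq .
  qed simp
  also have "\<dots> = (\<integral>\<^sup>+s. \<integral>\<^sup>+v. ennreal (?ff v s) * ?I s * ?I v \<partial>lborel \<partial>lborel)"
    by (rule lborel_pair.Fubini') measurable
  also have "\<dots> = (\<integral>\<^sup>+s. ennreal (1 / (2 * k * (1 + s + s\<^sup>2))) * ?I s \<partial>lborel)"
  proof (rule nn_integral_cong)
    fix s :: real
    have "(\<integral>\<^sup>+v. ennreal (?ff v s) * indicator {0..} v \<partial>lborel) = ennreal (0 - (- exp (- k * (0\<^sup>2 * (1 + s + s\<^sup>2))) / (2 * k * (1 + s + s\<^sup>2))))"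
    proof (rule nn_integral_FTC_atLeast)
      have "filterlim (\<lambda>v::real. k * (1 + s + s\<^sup>2) * v\<^sup>2) at_top at_top"
        using k pos[of s] by (intro filterlim_tendsto_pos_mult_at_top[OF tendsto_const] filterlim_pow_at_top filterlim_ident) auto
      then have "filterlim (\<lambda>v::real. - k * (v\<^sup>2 * (1 + s + s\<^sup>2))) at_bot at_top"
        unfolding filterlim_uminus_at_bot by (simp add: mult_ac)
      from tendsto_divide[OF tendsto_minus[OF filterlim_compose[OF exp_at_bot this]] tendsto_const[of "2 * k * (1 + s + s\<^sup>2)"]]
      show "((\<lambda>v. - exp (- k * (v\<^sup>2 * (1 + s + s\<^sup>2))) / (2 * k * (1 + s + s\<^sup>2))) \<longlongrightarrow> 0) at_top"
        using k pos[of s] by simp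
      show "((\<lambda>v. - exp (- k * (v\<^sup>2 * (1 + s + s\<^sup>2))) / (2 * k * (1 + s + s\<^sup>2))) has_real_derivative ?ff v s) (at v)" for v
        using k pos[of s] by (auto intro!: derivative_eq_intros simp: divide_simps)
    qed (use k in auto)
    also have "(\<integral>\<^sup>+v. ennreal (?ff v s) * indicator {0..} v \<partial>lborel) = (\<integral>\<^sup>+v. ennreal (?ff v s) * ?I v \<partial>lborel)"
      by (intro nn_integral_cong) (auto simp: indicator_def)
    finally show "(\<integral>\<^sup>+v. ennreal (?ff v s) * ?I s * ?I v \<partial>lborel) = ennreal (1 / (2 * k * (1 + s + s\<^sup>2))) * ?I s"
      by (simp add: indicator_def)
  qed
  also have "\<dots> = (\<integral>\<^sup>+s. ennreal (1 / (2 * k * (1 + s + s\<^sup>2))) * indicator {0..} s \<partial>lborel)"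
    by (intro nn_integral_cong_AE AE_I[where N="{0}"]) (auto simp: indicator_def)
  \<comment> \<open>The antiderivative comes from 4 (1 + s + s^2) = (2 s + 1)^2 + 3. The arctangent
    runs from pi/6 to pi/2, that is over the opening angle pi/3.\<close>
  also have "\<dots> = ennreal (1 / (sqrt 3 * k) * (pi / 2) - 1 / (sqrt 3 * k) * arctan ((2 * 0 + 1) / sqrt 3))"
  proof (rule nn_integral_FTC_atLeast)
    have "filterlim (\<lambda>s::real. (2 * s + 1) / sqrt 3) at_top at_top" by real_asymp
    then show "((\<lambda>s. 1 / (sqrt 3 * k) * arctan ((2 * s + 1) / sqrt 3)) \<longlongrightarrow> 1 / (sqrt 3 * k) * (pi / 2)) at_top"
      by (intro tendsto_intros filterlim_compose[OF tendsto_arctan_at_top])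
    fix s :: real
    have "((\<lambda>s. 1 / (sqrt 3 * k) * arctan ((2 * s + 1) / sqrt 3)) has_real_derivative
        1 / (sqrt 3 * k) * (inverse (1 + ((2 * s + 1) / sqrt 3)\<^sup>2) * (2 / sqrt 3))) (at s)"
      using k by (auto intro!: derivative_eq_intros)
    also have "1 / (sqrt 3 * k) * (inverse (1 + ((2 * s + 1) / sqrt 3)\<^sup>2) * (2 / sqrt 3)) = 1 / (2 * k * (1 + s + s\<^sup>2))"
    proof -
      define w where "w = 1 + s + s\<^sup>2"
      have w: "w > 0" using pos by (simp add: w_def)
      have "1 + ((2 * s + 1) / sqrt 3)\<^sup>2 = 4 / 3 * w"
        by (simp add: w_def power_divide power2_eq_square algebra_simps add_divide_distrib)
      then have "1 / (sqrt 3 * k) * (inverse (1 + ((2 * s + 1) / sqrt 3)\<^sup>2) * (2 / sqrt 3)) =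
          (2 * 3) / (4 * (sqrt 3 * sqrt 3) * k * w)"
        using k w by (simp add: divide_simps del: real_sqrt_mult_self)
      also have "\<dots> = 1 / (2 * k * w)" using k w by (simp add: divide_simps)
      finally show ?thesis by (simp add: w_def)
    qed
    finally show "((\<lambda>s. 1 / (sqrt 3 * k) * arctan ((2 * s + 1) / sqrt 3)) has_real_derivative 1 / (2 * k * (1 + s + s\<^sup>2))) (at s)" .
    show "0 \<le> 1 / (2 * k * (1 + s + s\<^sup>2))" using k pos[of s] by simp
  qed simp
  also have "arctan ((2 * 0 + 1) / sqrt 3) = pi / 6"
    using tan_30 by (intro arctan_unique) auto
  also have "1 / (sqrt 3 * k) * (pi / 2) - 1 / (sqrt 3 * k) * (pi / 6) = pi / (3 * sqrt 3 * k)"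
    using k by (simp add: field_simps)
  finally show ?thesis .
qed

subsection \<open>The affine Weyl group\<close>

text \<open>
  Affine maps \<open>(u, v) \<mapsto> (a u + b v + p, c u + d v + q)\<close> with integer coefficients are encoded as
  \<open>((a, b, c, d), p, q)\<close>. They act on the coordinates with respect to a vertex of the triangle and
  the two sides \<open>e1\<close>, \<open>e2\<close> issuing from it, so that the triangle is
  \<open>u > 0\<close>, \<open>v > 0\<close>, \<open>u + v < 1\<close>.
\<close>

type_synonym affine = "(int \<times> int \<times> int \<times> int) \<times> int \<times> int"

fun act_u :: "affine \<Rightarrow> real \<Rightarrow> real \<Rightarrow> real" where
  "act_u ((a, b, c, d), p, q) u v = a * u + b * v + p"

fun act_v :: "affine \<Rightarrow> real \<Rightarrow> real \<Rightarrow> real" where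
  "act_v ((a, b, c, d), p, q) u v = c * u + d * v + q"

fun aff_det :: "affine \<Rightarrow> real" where
  "aff_det ((a, b, c, d), p, q) = of_int (a * d - b * c)"

text \<open>Cramer's rule with multiplication by the determinant \<open>e\<close> in place of
  division: for e = 1 or e = -1 they coincide, and the entries stay integral.\<close>

fun aff_inv :: "affine \<Rightarrow> affine" where
  "aff_inv ((a, b, c, d), p, q) = (let e = a * d - b * c in
     ((e * d, - (e * b), - (e * c), e * a), e * (b * q - d * p), e * (c * p - a * q)))"

fun aff_comp :: "affine \<Rightarrow> affine \<Rightarrow> affine" where
  "aff_comp ((a, b, c, d), p, q) ((a', b', c', d'), p', q') =
     ((a * a' + b * c', a * b' + b * d', c * a' + d * c', c * b' + d * d'),
      a * p' + b * q' + p, c * p' + d * q' + q)"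

text \<open>The Weyl group of type A2 in the basis e1, e2: the identity, the three reflections in
  lines through the origin parallel to the sides, and the rotations by 2 pi/3 in both
  directions.\<close>

definition weyl_linear :: "(int \<times> int \<times> int \<times> int) set" where
  "weyl_linear = {(1, 0, 0, 1), (1, 1, 0, -1), (-1, 0, 1, 1), (0, -1, -1, 0), (-1, -1, 1, 0), (0, 1, -1, -1)}"

text \<open>The vertices of the tiling by triangles are all integer points, but the translations
  form only the sublattice of index 3 spanned by (1, 1), (2, -1) and (-1, 2). These are products of
  reflections in two parallel mirrors, hence twice an altitude.\<close>

definition weyl :: "affine set" where
  "weyl = {(m, p, q). m \<in> weyl_linear \<and> 3 dvd p - q}"

text \<open>The names of the reflection cases tell the side to which the mirror is parallel: v = 0,
  u = 0, or u + v = 1, whose barycentric coordinate is w = 1 - u - v. Glide reflections are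
  included.\<close>

lemma weyl_cases:
  assumes "g \<in> weyl"
  obtains (id) p q where "g = ((1, 0, 0, 1), p, q)" "3 dvd p - q"
    | (refl_v) p q where "g = ((1, 1, 0, -1), p, q)" "3 dvd p - q"
    | (refl_u) p q where "g = ((-1, 0, 1, 1), p, q)" "3 dvd p - q"
    | (refl_w) p q where "g = ((0, -1, -1, 0), p, q)" "3 dvd p - q"
    | (rot) p q where "g = ((-1, -1, 1, 0), p, q)" "3 dvd p - q"
    | (rot') p q where "g = ((0, 1, -1, -1), p, q)" "3 dvd p - q"
  using assms unfolding weyl_def weyl_linear_def by auto

text \<open>The squared norm of \<open>u e1 + v e2\<close> for unit side length.\<close>

definition hexform :: "real \<Rightarrow> real \<Rightarrow> real" where
  "hexform u v = u\<^sup>2 + u * v + v\<^sup>2"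

lemma hexform_ge: "u\<^sup>2 + v\<^sup>2 \<le> 2 * hexform u v"
proof -
  have "0 \<le> (u + v)\<^sup>2" by simp
  then show ?thesis by (simp add: hexform_def power2_eq_square algebra_simps)
qed

lemma hexform_weyl:
  assumes "g \<in> weyl"
  shows "hexform (act_u g u v - act_u g u' v') (act_v g u v - act_v g u' v') = hexform (u - u') (v - v')"
  using assms by (cases g rule: weyl_cases; hypsubst; simp (no_asm) add: hexform_def power2_eq_square algebra_simps)

lemma abs_aff_det: "g \<in> weyl \<Longrightarrow> \<bar>aff_det g\<bar> = 1"
  by (erule weyl_cases) simp_all

lemma act_aff_inv:
  assumes "g \<in> weyl"
  shows "act_u g (act_u (aff_inv g) u v) (act_v (aff_inv g) u v) = u"
    and "act_v g (act_u (aff_inv g) u v) (act_v (aff_inv g) u v) = v"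
  using assms unfolding atomize_conj by (cases g rule: weyl_cases; simp add: Let_def)

text \<open>The strict inequalities confine the integers p and q to one candidate at most in each
  case. For the two rotations the candidate is a rotation of the triangle about its own centroid,
  and it is the congruence modulo 3 that rules it out.\<close>

lemma weyl_unique:
  assumes g: "g \<in> weyl" and "u > 0" "v > 0" "u + v < 1"
    and "act_u g u v > 0" "act_v g u v > 0" "act_u g u v + act_v g u v < 1"
  shows "g = ((1, 0, 0, 1), 0, 0)"
  using g
proof (cases g rule: weyl_cases)
  case (id p q)
  then have "real_of_int p > -1" "real_of_int p < 1" "real_of_int q > -1" "real_of_int q < 1"
    using assms by simp_all
  then have "p = 0" "q = 0" by linarith+
  with id show ?thesis by simp
next
  case (refl_v p q)
  then have "real_of_int q > 0" "real_of_int q < 2" "real_of_int p > -1" "real_of_int p < 1"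
    using assms by simp_all
  then have "q = 1" "p = 0" by linarith+
  with refl_v show ?thesis by simp
next
  case (refl_u p q)
  then have "real_of_int p > 0" "real_of_int p < 2" "real_of_int q > -1" "real_of_int q < 1"
    using assms by simp_all
  then have "p = 1" "q = 0" by linarith+
  with refl_u show ?thesis by simp
next
  case (refl_w p q)
  then have "real_of_int p > 0" "real_of_int q > 0" "real_of_int (p + q) < 2"
    using assms by simp_all
  then have "p > 0" "q > 0" "p + q < 2" by linarith+
  then show ?thesis by linarith
next
  case (rot p q)
  then have "real_of_int q > -1" "real_of_int q < 1" "real_of_int p > 0" "real_of_int p < 2"
    using assms by simp_all
  then have "q = 0" "p = 1" by linarith+
  with rot show ?thesis by simp
next
  case (rot' p q)
  then have "real_of_int p > -1" "real_of_int p < 1" "real_of_int q > 0" "real_of_int q < 2"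
    using assms by simp_all
  then have "p = 0" "q = 1" by linarith+
  with rot' show ?thesis by simp
qed

text \<open>The reflections in the sides \<open>v = 0\<close>, \<open>u = 0\<close> and \<open>u + v = 1\<close> of the fundamental triangle.\<close>

definition side_reflections :: "affine set" where
  "side_reflections = {((1, 1, 0, -1), 0, 0), ((-1, 0, 1, 1), 0, 0), ((0, -1, -1, 0), 1, 1)}"

lemma side_reflection_comp:
  assumes s: "s \<in> side_reflections" and g: "g \<in> weyl"
  shows "aff_comp s g \<in> weyl" "aff_comp s (aff_comp s g) = g"
    "aff_det (aff_comp s g) = - aff_det g"
    "act_u (aff_comp s g) u v = act_u s (act_u g u v) (act_v g u v)"
    "act_v (aff_comp s g) u v = act_v s (act_u g u v) (act_v g u v)"
  using g s unfolding atomize_conj side_reflections_def weyl_def weyl_linear_def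
  by auto presburger+

lemma side_reflection_in_weyl: "side_reflections \<subseteq> weyl"
  by (auto simp: side_reflections_def weyl_def weyl_linear_def)

lemma bij_betw_side_reflection:
  assumes s: "s \<in> side_reflections"
  shows "bij_betw (aff_comp s) weyl weyl"
  by (rule bij_betw_byWitness[where f' = "aff_comp s"]) (use side_reflection_comp[OF s] in auto)

text \<open>The summable majorant of all image sums. The product form makes summability over pairs
  immediate, and the decay is polynomial, so that every Gaussian beats it.\<close>

fun weyl_weight :: "affine \<Rightarrow> real" where
  "weyl_weight (m, p, q) = inverse (1 + (of_int p)\<^sup>2) * inverse (1 + (of_int q)\<^sup>2)"

lemma countable_weyl[simp]: "countable weyl"
  by (rule countable_subset[OF subset_UNIV]) simp

lemma weyl_weight_pos: "weyl_weight g > 0"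
  by (cases g rule: weyl_weight.cases) (simp add: add_pos_nonneg)

lemma integrable_weyl_weight: "integrable (count_space weyl) weyl_weight"
proof -
  let ?r = "\<lambda>p :: int. inverse (1 + (of_int p)\<^sup>2) :: real"
  have nat: "Infinite_Set_Sum.abs_summable_on (\<lambda>n :: nat. inverse (1 + (of_nat n)\<^sup>2) :: real) UNIV"
  proof -
    have "summable (\<lambda>n. inverse (1 + (of_nat n)\<^sup>2) :: real)"
    proof (rule summable_comparison_test')
      show "summable (\<lambda>n. inverse ((of_nat n)\<^sup>2) :: real)"
        using inverse_power_summable[of 2, where ?'a = real] by simp
      fix n :: nat assume "n \<ge> 1"
      then show "norm (inverse (1 + (of_nat n)\<^sup>2) :: real) \<le> inverse ((of_nat n)\<^sup>2)"
        by (simp add: le_imp_inverse_le)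
    qed
    then show ?thesis by (simp add: Infinite_Set_Sum.abs_summable_on_nat_iff' add_pos_nonneg abs_of_pos)
  qed
  have "Infinite_Set_Sum.abs_summable_on ?r (range int)"
    using nat by (subst Infinite_Set_Sum.abs_summable_on_reindex_iff[symmetric]) auto
  moreover have "Infinite_Set_Sum.abs_summable_on ?r (range (\<lambda>n. - int n))"
    using nat by (subst Infinite_Set_Sum.abs_summable_on_reindex_iff[symmetric]) (auto intro!: inj_onI)
  ultimately have "Infinite_Set_Sum.abs_summable_on ?r (range int \<union> range (\<lambda>n. - int n))"
    by (rule Infinite_Set_Sum.abs_summable_on_union)
  moreover have "range int \<union> range (\<lambda>n. - int n) = UNIV"
  proof (intro equalityI subsetI)
    fix x :: int
    obtain n where "x = int n \<or> x = - int n" by (cases x rule: int_cases2) blast+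
    then show "x \<in> range int \<union> range (\<lambda>n. - int n)" by blast
  qed simp
  ultimately have r: "Infinite_Set_Sum.abs_summable_on ?r UNIV" by simp
  have "Infinite_Set_Sum.abs_summable_on (\<lambda>m. 1 :: real) weyl_linear"
    by (rule Infinite_Set_Sum.abs_summable_on_finite) (simp add: weyl_linear_def)
  from Infinite_Set_Sum.abs_summable_on_product[OF countableI_type countableI_type this
      Infinite_Set_Sum.abs_summable_on_product[OF countableI_type countableI_type r r]]
  have "Infinite_Set_Sum.abs_summable_on weyl_weight (weyl_linear \<times> UNIV \<times> UNIV)"
    by (rule Infinite_Set_Sum.abs_summable_on_cong[THEN iffD1, rotated 2]) auto
  then have "Infinite_Set_Sum.abs_summable_on weyl_weight weyl"
    by (rule Infinite_Set_Sum.abs_summable_on_subset) (auto simp: weyl_def)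
  then show ?thesis by (simp add: Infinite_Set_Sum.abs_summable_on_def)
qed

lemma inverse_square_le_weyl_weight:
  assumes "1 + (of_int p)\<^sup>2 + (of_int q)\<^sup>2 \<le> K"
  shows "inverse (K\<^sup>2) \<le> weyl_weight (m, p, q)"
proof -
  let ?a = "(of_int p)\<^sup>2 :: real" and ?b = "(of_int q)\<^sup>2 :: real"
  have "(1 + ?a) * (1 + ?b) \<le> (1 + ?a + ?b) * (1 + ?a + ?b)" by (intro mult_mono) auto
  also have "\<dots> \<le> K * K" using assms by (intro mult_mono) (auto intro: order_trans[OF _ assms])
  finally have "(1 + ?a) * (1 + ?b) \<le> K\<^sup>2" by (simp add: power2_eq_square)
  moreover have "0 < (1 + ?a) * (1 + ?b)" by (intro mult_pos_pos add_pos_nonneg) auto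
  ultimately have "inverse (K\<^sup>2) \<le> inverse ((1 + ?a) * (1 + ?b))" by (rule le_imp_inverse_le)
  then show ?thesis by (simp add: inverse_mult_distrib)
qed

subsection \<open>The equilateral triangle\<close>

lemma square_exp_le:
  fixes s \<kappa> :: real
  assumes "\<kappa> > 0" "s \<ge> 0"
  shows "(1 + s)\<^sup>2 * exp (- \<kappa> * s) \<le> (1 + 2 / \<kappa>)\<^sup>2"
proof -
  have "1 + s \<le> 1 + s + (2 / \<kappa> + \<kappa> * s / 2)" using assms by simp
  also have "\<dots> = (1 + 2 / \<kappa>) * (1 + \<kappa> * s / 2)"
    using assms by (simp add: distrib_left distrib_right)
  also have "\<dots> \<le> (1 + 2 / \<kappa>) * exp (\<kappa> * s / 2)"
    using assms by (intro mult_left_mono exp_ge_add_one_self) auto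
  finally have "(1 + s)\<^sup>2 \<le> ((1 + 2 / \<kappa>) * exp (\<kappa> * s / 2))\<^sup>2"
    using assms by (intro power_mono) auto
  also have "\<dots> = (1 + 2 / \<kappa>)\<^sup>2 * exp (\<kappa> * s)"
    by (simp add: power_mult_distrib flip: exp_double)
  finally have "(1 + s)\<^sup>2 * exp (- \<kappa> * s) \<le> ((1 + 2 / \<kappa>)\<^sup>2 * exp (\<kappa> * s)) * exp (- \<kappa> * s)"
    by (rule mult_right_mono) simp
  then show ?thesis by (simp add: mult.assoc flip: exp_add)
qed

lemma (in pair_sigma_finite) integrable_mult_pair:
  fixes f g :: "_ \<Rightarrow> real"
  assumes f: "integrable M1 f" and g: "integrable M2 g"
  shows "integrable (M1 \<Otimes>\<^sub>M M2) (\<lambda>(x, y). f x * g y)"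
  using f g by (intro Fubini_integrable) (auto simp: abs_mult)

text \<open>A vertex and the two sides issuing from it, known only through their Gram matrix. The
  orientation is left open, so the determinant \<open>jac\<close> may have either sign; its square
  is the Gram determinant.\<close>

locale equilateral =
  fixes c e1 e2 :: "real ^ 2" and L :: real
  assumes L: "L > 0" and e11: "e1 \<bullet> e1 = L\<^sup>2" and e22: "e2 \<bullet> e2 = L\<^sup>2" and e12: "e1 \<bullet> e2 = L\<^sup>2 / 2"
begin

definition "jac = e1 $ 1 * e2 $ 2 - e1 $ 2 * e2 $ 1"

lemma jac_square: "jac\<^sup>2 = 3 / 4 * L ^ 4"
proof -
  have "jac\<^sup>2 = (e1 \<bullet> e1) * (e2 \<bullet> e2) - (e1 \<bullet> e2)\<^sup>2"
    by (simp add: jac_def inner_vec_def sum_2 power2_eq_square algebra_simps)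
  also have "\<dots> = 3 / 4 * L ^ 4"
    unfolding e11 e22 e12 by (simp add: power2_eq_square power4_eq_xxxx)
  finally show ?thesis .
qed

lemma jac_nonzero: "jac \<noteq> 0"
  using jac_square L by auto

lemma abs_jac: "\<bar>jac\<bar> = sqrt 3 / 2 * L\<^sup>2"
proof -
  have "\<bar>jac\<bar>\<^sup>2 = (sqrt 3 / 2 * L\<^sup>2)\<^sup>2"
    by (simp add: jac_square power_mult_distrib power_divide)
  then show ?thesis by (rule power2_eq_imp_eq) auto
qed

definition pt :: "real \<Rightarrow> real \<Rightarrow> real ^ 2" where
  "pt u v = c + u *\<^sub>R e1 + v *\<^sub>R e2"

text \<open>\<open>cu\<close> and \<open>cv\<close> invert \<open>pt\<close> by Cramer's rule. They
  are the barycentric coordinates at the vertices c + e1 and c + e2.\<close>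

definition cu :: "real ^ 2 \<Rightarrow> real" where
  "cu x = ((x - c) $ 1 * e2 $ 2 - (x - c) $ 2 * e2 $ 1) / jac"

definition cv :: "real ^ 2 \<Rightarrow> real" where
  "cv x = ((x - c) $ 2 * e1 $ 1 - (x - c) $ 1 * e1 $ 2) / jac"

lemma cu_pt[simp]: "cu (pt u v) = u" and cv_pt[simp]: "cv (pt u v) = v"
proof -
  have "cu (pt u v) = u * jac / jac" "cv (pt u v) = v * jac / jac"
    unfolding cu_def cv_def pt_def by (simp_all add: jac_def algebra_simps)
  then show "cu (pt u v) = u" "cv (pt u v) = v" using jac_nonzero by simp_all
qed

lemma pt_cu_cv[simp]: "pt (cu x) (cv x) = x"
proof -
  have "jac *\<^sub>R (pt (cu x) (cv x) - c) = (jac * cu x) *\<^sub>R e1 + (jac * cv x) *\<^sub>R e2"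
    by (simp add: pt_def scaleR_add_right)
  also have "\<dots> = jac *\<^sub>R (x - c)"
    using jac_nonzero by (simp add: cu_def cv_def vec_eq_iff forall_2) (simp add: jac_def algebra_simps)
  finally show ?thesis using jac_nonzero by simp
qed

lemma continuous_on_cu: "continuous_on S cu" and continuous_on_cv: "continuous_on S cv"
  unfolding cu_def cv_def using jac_nonzero by (auto intro!: continuous_intros)

lemma continuous_on_pt[continuous_intros]:
  "continuous_on S f \<Longrightarrow> continuous_on S g \<Longrightarrow> continuous_on S (\<lambda>x. pt (f x) (g x))"
  unfolding pt_def by (intro continuous_intros)

lemma measurable_cu[measurable]: "cu \<in> borel_measurable borel"
  and measurable_cv[measurable]: "cv \<in> borel_measurable borel"
  by (simp_all add: borel_measurable_continuous_onI continuous_on_cu continuous_on_cv)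

lemma norm_pt_diff: "(norm (pt u v - pt u' v'))\<^sup>2 = L\<^sup>2 * hexform (u - u') (v - v')"
proof -
  have "pt u v - pt u' v' = (u - u') *\<^sub>R e1 + (v - v') *\<^sub>R e2"
    by (simp add: pt_def algebra_simps)
  then have "(norm (pt u v - pt u' v'))\<^sup>2 = (u - u')\<^sup>2 * (e1 \<bullet> e1) + 2 * (u - u') * (v - v') * (e1 \<bullet> e2) + (v - v')\<^sup>2 * (e2 \<bullet> e2)"
    unfolding power2_norm_eq_inner
    by (simp add: inner_add_left inner_add_right inner_commute power2_eq_square)
  also have "\<dots> = L\<^sup>2 * hexform (u - u') (v - v')"
    unfolding e11 e22 e12 hexform_def by (simp add: algebra_simps)
  finally show ?thesis .
qed

definition Y :: "affine \<Rightarrow> real ^ 2 \<Rightarrow> real ^ 2" where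
  "Y g z = pt (act_u g (cu z) (cv z)) (act_v g (cu z) (cv z))"

lemma cu_Y[simp]: "cu (Y g z) = act_u g (cu z) (cv z)"
  and cv_Y[simp]: "cv (Y g z) = act_v g (cu z) (cv z)"
  by (simp_all add: Y_def)

lemma norm_diff_eq: "(norm (x - y))\<^sup>2 = L\<^sup>2 * hexform (cu x - cu y) (cv x - cv y)"
  using norm_pt_diff[of "cu x" "cv x" "cu y" "cv y"] by simp

lemma norm_Y_diff:
  assumes "g \<in> weyl"
  shows "norm (Y g x - Y g y) = norm (x - y)"
proof -
  have "(norm (Y g x - Y g y))\<^sup>2 = (norm (x - y))\<^sup>2"
    by (simp add: norm_diff_eq hexform_weyl[OF assms])
  then show ?thesis by (simp add: power2_eq_iff_nonneg)
qed

lemma Y_aff_inv: "g \<in> weyl \<Longrightarrow> Y g (Y (aff_inv g) x) = x"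
  by (simp add: Y_def act_aff_inv)

lemma continuous_on_Y: "continuous_on S (Y g)"
proof -
  obtain a b a' b' p q where "g = ((a, b, a', b'), p, q)" by (metis surj_pair)
  then show ?thesis
    by (auto simp: Y_def[abs_def] intro!: continuous_intros continuous_on_cu continuous_on_cv)
qed

lemma measurable_Y[measurable]: "Y g \<in> borel_measurable borel"
  by (simp add: borel_measurable_continuous_onI continuous_on_Y)

text \<open>The linear part moves the coordinates of z by at most 2 R and those of x add R, so each
  translation entry is at most the coordinate displacement plus 3 R. Squaring gives 18 R^2 for each
  of the two entries, and \<open>hexform_ge\<close> turns the coordinate displacement into 4 / L^2
  times the squared distance.\<close>

lemma growth:
  assumes g: "(m, p, q) \<in> weyl" and R: "\<bar>cu x\<bar> \<le> R" "\<bar>cv x\<bar> \<le> R" "\<bar>cu z\<bar> \<le> R" "\<bar>cv z\<bar> \<le> R"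
  shows "1 + (of_int p)\<^sup>2 + (of_int q)\<^sup>2 \<le> (1 + 36 * R\<^sup>2 + 4 / L\<^sup>2) * (1 + (norm (x - Y (m, p, q) z))\<^sup>2)"
proof -
  let ?X = "cu x - cu (Y (m, p, q) z)" and ?Z = "cv x - cv (Y (m, p, q) z)"
  have "\<bar>of_int p\<bar> \<le> \<bar>?X\<bar> + 3 * R" "\<bar>of_int q\<bar> \<le> \<bar>?Z\<bar> + 3 * R"
    using g R by (auto simp: weyl_def weyl_linear_def)
  then have "(of_int p)\<^sup>2 \<le> (\<bar>?X\<bar> + 3 * R)\<^sup>2" "(of_int q)\<^sup>2 \<le> (\<bar>?Z\<bar> + 3 * R)\<^sup>2"
    by (metis abs_ge_zero power2_abs power_mono)+
  moreover have "(\<bar>a\<bar> + 3 * R)\<^sup>2 \<le> 2 * a\<^sup>2 + 18 * R\<^sup>2" for a :: real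
    using sum_squares_bound[of "\<bar>a\<bar>" "3 * R"] by (simp add: power2_sum power_mult_distrib)
  ultimately have "1 + (of_int p)\<^sup>2 + (of_int q)\<^sup>2 \<le> 1 + 36 * R\<^sup>2 + 2 * (?X\<^sup>2 + ?Z\<^sup>2)"
    by (smt (verit))
  also have "\<dots> \<le> 1 + 36 * R\<^sup>2 + 4 * hexform ?X ?Z" using hexform_ge[of ?X ?Z] by simp
  also have "\<dots> = 1 + 36 * R\<^sup>2 + 4 / L\<^sup>2 * (norm (x - Y (m, p, q) z))\<^sup>2"
    unfolding norm_diff_eq using L by simp
  also have "\<dots> \<le> (1 + 36 * R\<^sup>2 + 4 / L\<^sup>2) * (1 + (norm (x - Y (m, p, q) z))\<^sup>2)"
    by (simp add: distrib_left distrib_right)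
  finally show ?thesis .
qed

text \<open>Stated as a lower bound for 1, so that it can be inserted as a factor into any estimate:
  it brings in the summable weight at the price of a polynomial in the displacement, which the
  Gaussian pays.\<close>

lemma weight_growth:
  obtains K where "K > 0" "\<And>g x z. g \<in> weyl \<Longrightarrow> \<bar>cu x\<bar> \<le> R \<Longrightarrow> \<bar>cv x\<bar> \<le> R \<Longrightarrow> \<bar>cu z\<bar> \<le> R \<Longrightarrow> \<bar>cv z\<bar> \<le> R \<Longrightarrow>
     1 \<le> K * weyl_weight g * (1 + (norm (x - Y g z))\<^sup>2)\<^sup>2"
proof
  define k where "k = 1 + 36 * R\<^sup>2 + 4 / L\<^sup>2"
  have k: "k > 0" using L by (simp add: k_def add_pos_nonneg)
  then show "k\<^sup>2 > 0" by simp
  fix g x z assume g: "g \<in> weyl" and R: "\<bar>cu x\<bar> \<le> R" "\<bar>cv x\<bar> \<le> R" "\<bar>cu z\<bar> \<le> R" "\<bar>cv z\<bar> \<le> R"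
  obtain m p q where g_eq: "g = (m, p, q)" by (cases g)
  define A where "A = 1 + (norm (x - Y g z))\<^sup>2"
  have A: "A > 0" by (simp add: A_def add_pos_nonneg)
  have "inverse ((k * A)\<^sup>2) \<le> weyl_weight g"
    unfolding g_eq A_def by (intro inverse_square_le_weyl_weight growth[OF g[unfolded g_eq] R, folded k_def])
  then have "(k * A)\<^sup>2 * inverse ((k * A)\<^sup>2) \<le> (k * A)\<^sup>2 * weyl_weight g"
    by (rule mult_left_mono) simp
  then show "1 \<le> k\<^sup>2 * weyl_weight g * (1 + (norm (x - Y g z))\<^sup>2)\<^sup>2"
    using k A by (simp add: power_mult_distrib mult_ac flip: A_def)
qed

definition "tri = {x. 0 < cu x \<and> 0 < cv x \<and> cu x + cv x < 1}"

lemma open_tri: "open tri"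
  unfolding tri_def
  by (intro open_Collect_conj open_Collect_less continuous_intros continuous_on_cu continuous_on_cv)

lemma closure_tri: "closure tri \<subseteq> {x. 0 \<le> cu x \<and> 0 \<le> cv x \<and> cu x + cv x \<le> 1}"
proof (rule closure_minimal)
  show "closed {x. 0 \<le> cu x \<and> 0 \<le> cv x \<and> cu x + cv x \<le> 1}"
    by (intro closed_Collect_conj closed_Collect_le continuous_intros continuous_on_cu continuous_on_cv)
qed (auto simp: tri_def)

lemma bounded_tri: "bounded tri"
proof -
  have "tri \<subseteq> cball c (sqrt 3 * L)"
  proof
    fix x assume x: "x \<in> tri"
    then have b: "0 \<le> cu x" "cu x \<le> 1" "0 \<le> cv x" "cv x \<le> 1" by (auto simp: tri_def)
    have c: "cu c = 0" "cv c = 0" by (simp_all add: cu_def cv_def)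
    have "(cu x)\<^sup>2 \<le> 1" "(cv x)\<^sup>2 \<le> 1" "cu x * cv x \<le> 1"
      using b by (auto simp: power_le_one mult_le_one)
    then have "hexform (cu x) (cv x) \<le> 3" by (simp add: hexform_def)
    then have "(norm (x - c))\<^sup>2 \<le> L\<^sup>2 * 3"
      unfolding norm_diff_eq c by (simp add: mult_left_mono)
    also have "\<dots> = (sqrt 3 * L)\<^sup>2" by (simp add: power_mult_distrib)
    finally have "norm (x - c) \<le> sqrt 3 * L"
      using L by (simp add: power2_le_iff_abs_le)
    then show "x \<in> cball c (sqrt 3 * L)" by (simp add: dist_norm norm_minus_commute)
  qed
  then show ?thesis using bounded_cball bounded_subset by blast
qed

lemma frontier_tri:
  assumes "x \<in> frontier tri"
  obtains s where "s \<in> side_reflections" "Y s x = x"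
proof -
  have "x \<in> closure tri" "x \<notin> tri" using assms open_tri by (auto simp: frontier_def interior_open)
  then consider "cv x = 0" | "cu x = 0" | "cu x + cv x = 1"
    using closure_tri by (force simp: tri_def)
  then have "\<exists>s \<in> side_reflections. Y s x = x"
  proof cases
    case 1
    then show ?thesis
      by (intro bexI[of _ "((1, 1, 0, -1), 0, 0)"]) (use pt_cu_cv[of x] in \<open>simp_all add: side_reflections_def Y_def\<close>)
  next
    case 2
    then show ?thesis
      by (intro bexI[of _ "((-1, 0, 1, 1), 0, 0)"]) (use pt_cu_cv[of x] in \<open>simp_all add: side_reflections_def Y_def\<close>)
  next
    case 3
    then have eq: "1 - cv x = cu x" "1 - cu x = cv x" by simp_all
    have "Y ((0, -1, -1, 0), 1, 1) x = pt (1 - cv x) (1 - cu x)" by (simp add: Y_def)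
    also have "\<dots> = x" by (simp only: eq pt_cu_cv)
    finally show ?thesis by (intro bexI[of _ "((0, -1, -1, 0), 1, 1)"]) (auto simp: side_reflections_def)
  qed
  then show thesis using that by blast
qed

lemma nn_integral_pt:
  assumes [measurable]: "F \<in> borel_measurable borel"
  shows "(\<integral>\<^sup>+x. F x \<partial>lborel) = ennreal (sqrt 3 / 2 * L\<^sup>2) * (\<integral>\<^sup>+v. \<integral>\<^sup>+u. F (pt u v) \<partial>lborel \<partial>lborel)"
proof -
  have vec: "pt u v = vector [c $ 1 + e1 $ 1 * u + e2 $ 1 * v, c $ 2 + e1 $ 2 * u + e2 $ 2 * v]" for u v
    by (simp add: pt_def vec_eq_iff forall_2 mult.commute)
  have "(\<integral>\<^sup>+x. F x \<partial>lborel) = (\<integral>\<^sup>+y. \<integral>\<^sup>+x. F (vector [fst (x, y), snd (x, y)]) \<partial>lborel \<partial>lborel)"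
    by (simp add: nn_integral_lborel_vec2)
  also have "\<dots> = ennreal \<bar>e1 $ 1 * e2 $ 2 - e1 $ 2 * e2 $ 1\<bar> * (\<integral>\<^sup>+v. \<integral>\<^sup>+u. F (pt u v) \<partial>lborel \<partial>lborel)"
    unfolding vec using jac_nonzero
    by (subst nn_integral_affine2[where p = "c $ 1" and q = "c $ 2" and G = "\<lambda>z. F (vector [fst z, snd z])"])
       (simp_all add: jac_def)
  finally show ?thesis by (simp add: abs_jac flip: jac_def)
qed

end

subsection \<open>The method of images\<close>

lemma gauss_cong_norm: "norm z = norm z' \<Longrightarrow> gauss t z = gauss t z'"
  by (simp add: gauss_def)

lemma integral_affine_vec2:
  fixes H :: "real ^ 2 \<Rightarrow> real"
  assumes [measurable]: "H \<in> borel_measurable borel" and s: "s > 0"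
  shows "(LINT z|lborel. H z) = s\<^sup>2 * (LINT w|lborel. H (x0 + s *\<^sub>R w))"
proof -
  have "(LINT z|lborel. H z) = (LINT z|density (distr lborel borel (\<lambda>x. x0 + s *\<^sub>R x)) (\<lambda>_. ennreal (\<bar>s\<bar> ^ DIM(real ^ 2))). H z)"
    using lborel_affine[of s x0] s by simp
  also have "\<dots> = s\<^sup>2 * (LINT w|lborel. H (x0 + s *\<^sub>R w))"
    using s by (simp add: integral_density integral_distr)
  finally show ?thesis .
qed

lemma pair_sigma_finite_weyl: "pair_sigma_finite (count_space weyl) (lborel :: (real ^ 2) measure)"
  by (intro pair_sigma_finite.intro sigma_finite_measure_count_space_countable countable_weyl
      lborel.sigma_finite_measure_axioms)

context equilateral
begin

text \<open>The sum is a Bochner integral over counting measure, which makes the results on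
  parameter integrals and Fubini applicable to it.\<close>

definition image_kernel :: "real \<Rightarrow> real ^ 2 \<Rightarrow> real ^ 2 \<Rightarrow> real" where
  "image_kernel t x y = (LINT g|count_space weyl. aff_det g * gauss t (x - Y g y))"

lemma exp_weight:
  assumes \<kappa>: "\<kappa> > 0"
  obtains C where "C > 0" "\<And>g x z. g \<in> weyl \<Longrightarrow> \<bar>cu x\<bar> \<le> R \<Longrightarrow> \<bar>cv x\<bar> \<le> R \<Longrightarrow> \<bar>cu z\<bar> \<le> R \<Longrightarrow> \<bar>cv z\<bar> \<le> R \<Longrightarrow>
     exp (- \<kappa> * (norm (x - Y g z))\<^sup>2) \<le> C * weyl_weight g"
proof -
  obtain K where K: "K > 0" "\<And>g x z. g \<in> weyl \<Longrightarrow> \<bar>cu x\<bar> \<le> R \<Longrightarrow> \<bar>cv x\<bar> \<le> R \<Longrightarrow> \<bar>cu z\<bar> \<le> R \<Longrightarrow> \<bar>cv z\<bar> \<le> R \<Longrightarrow>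
     1 \<le> K * weyl_weight g * (1 + (norm (x - Y g z))\<^sup>2)\<^sup>2"
    using weight_growth by blast
  show thesis
  proof (rule that[of "K * (1 + 2 / \<kappa>)\<^sup>2"])
    show "K * (1 + 2 / \<kappa>)\<^sup>2 > 0" using K(1) \<kappa> by (intro mult_pos_pos zero_less_power add_pos_pos) auto
    fix g x z assume *: "g \<in> weyl" "\<bar>cu x\<bar> \<le> R" "\<bar>cv x\<bar> \<le> R" "\<bar>cu z\<bar> \<le> R" "\<bar>cv z\<bar> \<le> R"
    define s where "s = (norm (x - Y g z))\<^sup>2"
    have s: "s \<ge> 0" by (simp add: s_def)
    have "1 * exp (- \<kappa> * s) \<le> (K * weyl_weight g * (1 + s)\<^sup>2) * exp (- \<kappa> * s)"
      unfolding s_def by (intro mult_right_mono K *) simp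
    also have "\<dots> = K * weyl_weight g * ((1 + s)\<^sup>2 * exp (- \<kappa> * s))" by simp
    also have "\<dots> \<le> K * weyl_weight g * (1 + 2 / \<kappa>)\<^sup>2"
      using K weyl_weight_pos[of g] by (intro mult_left_mono square_exp_le \<kappa> s) simp
    finally show "exp (- \<kappa> * (norm (x - Y g z))\<^sup>2) \<le> K * (1 + 2 / \<kappa>)\<^sup>2 * weyl_weight g"
      by (simp add: s_def mult_ac)
  qed
qed

lemma gauss_weight:
  assumes t: "t > 0"
  obtains C where "C > 0" "\<And>g x z. g \<in> weyl \<Longrightarrow> \<bar>cu x\<bar> \<le> R \<Longrightarrow> \<bar>cv x\<bar> \<le> R \<Longrightarrow> \<bar>cu z\<bar> \<le> R \<Longrightarrow> \<bar>cv z\<bar> \<le> R \<Longrightarrow>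
     norm (aff_det g * gauss t (x - Y g z)) \<le> C * weyl_weight g"
proof -
  have "1 / (4 * t) > 0" using t by simp
  from exp_weight[OF this, of R] obtain C where C: "C > 0"
    "\<And>g x z. g \<in> weyl \<Longrightarrow> \<bar>cu x\<bar> \<le> R \<Longrightarrow> \<bar>cv x\<bar> \<le> R \<Longrightarrow> \<bar>cu z\<bar> \<le> R \<Longrightarrow> \<bar>cv z\<bar> \<le> R \<Longrightarrow>
     exp (- (1 / (4 * t)) * (norm (x - Y g z))\<^sup>2) \<le> C * weyl_weight g" by blast
  show thesis
  proof (rule that[of "C / (4 * pi * t)"])
    show "C / (4 * pi * t) > 0" using C t by simp
    fix g x z assume *: "g \<in> weyl" "\<bar>cu x\<bar> \<le> R" "\<bar>cv x\<bar> \<le> R" "\<bar>cu z\<bar> \<le> R" "\<bar>cv z\<bar> \<le> R"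
    have "norm (aff_det g * gauss t (x - Y g z)) = exp (- (1 / (4 * t)) * (norm (x - Y g z))\<^sup>2) / (4 * pi * t)"
      using abs_aff_det[OF *(1)] gauss_nonneg[OF t, of "x - Y g z"] t by (simp add: abs_mult gauss_eq_exp)
    also have "\<dots> \<le> C * weyl_weight g / (4 * pi * t)"
      using t C(2)[OF *] by (intro divide_right_mono) auto
    finally show "norm (aff_det g * gauss t (x - Y g z)) \<le> C / (4 * pi * t) * weyl_weight g" by simp
  qed
qed

lemma integrable_image_kernel:
  assumes t: "t > 0"
  shows "integrable (count_space weyl) (\<lambda>g. aff_det g * gauss t (x - Y g y))"
proof -
  define R where "R = max (max \<bar>cu x\<bar> \<bar>cv x\<bar>) (max \<bar>cu y\<bar> \<bar>cv y\<bar>)"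
  from gauss_weight[OF t, of R] obtain C where C: "C > 0"
    "\<And>g x z. g \<in> weyl \<Longrightarrow> \<bar>cu x\<bar> \<le> R \<Longrightarrow> \<bar>cv x\<bar> \<le> R \<Longrightarrow> \<bar>cu z\<bar> \<le> R \<Longrightarrow> \<bar>cv z\<bar> \<le> R \<Longrightarrow>
     norm (aff_det g * gauss t (x - Y g z)) \<le> C * weyl_weight g" by blast
  have "norm (aff_det g * gauss t (x - Y g y)) \<le> norm (C * weyl_weight g)" if "g \<in> weyl" for g
  proof -
    have "norm (aff_det g * gauss t (x - Y g y)) \<le> C * weyl_weight g"
      by (rule C(2)[OF that]) (auto simp: R_def le_max_iff_disj)
    also have "\<dots> \<le> norm (C * weyl_weight g)" unfolding real_norm_def by (rule abs_ge_self)
    finally show ?thesis .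
  qed
  note le = this
  show ?thesis
  proof (rule Bochner_Integration.integrable_bound)
    show "integrable (count_space weyl) (\<lambda>g. C * weyl_weight g)"
      by (intro integrable_mult_right integrable_weyl_weight)
    show "AE g in count_space weyl. norm (aff_det g * gauss t (x - Y g y)) \<le> norm (C * weyl_weight g)"
      by (rule AE_I2) (rule le, simp)
  qed simp
qed

lemma tri_coord_bound: "x \<in> tri \<Longrightarrow> \<bar>cu x\<bar> \<le> 1 \<and> \<bar>cv x\<bar> \<le> 1"
  by (auto simp: tri_def)

lemma continuous_on_image_kernel:
  assumes t: "t > 0"
  shows "continuous_on (tri \<times> tri) (\<lambda>(x, y). image_kernel t x y)"
proof -
  from gauss_weight[OF t, of 1] obtain C where C: "C > 0"
    "\<And>g x z. g \<in> weyl \<Longrightarrow> \<bar>cu x\<bar> \<le> 1 \<Longrightarrow> \<bar>cv x\<bar> \<le> 1 \<Longrightarrow> \<bar>cu z\<bar> \<le> 1 \<Longrightarrow> \<bar>cv z\<bar> \<le> 1 \<Longrightarrow>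
     norm (aff_det g * gauss t (x - Y g z)) \<le> C * weyl_weight g" by blast
  have "continuous_on (tri \<times> tri) (\<lambda>z. LINT g|count_space weyl. aff_det g * gauss t (fst z - Y g (snd z)))"
  proof (rule continuous_on_LINT_dominated)
    fix g
    have "continuous_on (tri \<times> tri) (\<lambda>z. Y g (snd z))"
      by (rule continuous_on_compose2[OF continuous_on_Y[of UNIV g] continuous_on_snd[OF continuous_on_id]]) simp
    then have "continuous_on (tri \<times> tri) (\<lambda>z. fst z - Y g (snd z))"
      by (intro continuous_on_diff continuous_on_fst continuous_on_id)
    then show "continuous_on (tri \<times> tri) (\<lambda>z. aff_det g * gauss t (fst z - Y g (snd z)))"
      unfolding gauss_def using t
      by (intro continuous_on_mult continuous_on_const continuous_on_divide continuous_on_exp continuous_on_minus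
          continuous_on_power continuous_on_norm) auto
  next
    fix z :: "(real ^ 2) \<times> (real ^ 2)"
    show "\<exists>U w. open U \<and> z \<in> U \<and> integrable (count_space weyl) w \<and>
      (\<forall>y\<in>tri \<times> tri \<inter> U. \<forall>g\<in>space (count_space weyl). norm (aff_det g * gauss t (fst y - Y g (snd y))) \<le> w g)"
      using integrable_weyl_weight tri_coord_bound
      by (intro exI[of _ UNIV] exI[of _ "\<lambda>g. C * weyl_weight g"]) (auto intro!: C(2)[unfolded real_norm_def])
  qed simp
  then show ?thesis by (simp add: image_kernel_def case_prod_beta)
qed

lemma image_kernel_boundary:
  assumes s: "s \<in> side_reflections" and x: "Y s x = x"
  shows "image_kernel t x y = 0"
proof -
  have "image_kernel t x y = (LINT g|count_space weyl. aff_det (aff_comp s g) * gauss t (x - Y (aff_comp s g) y))"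
    unfolding image_kernel_def by (rule integral_bij_count_space[OF bij_betw_side_reflection[OF s], symmetric])
  also have "\<dots> = (LINT g|count_space weyl. - (aff_det g * gauss t (x - Y g y)))"
  proof (rule Bochner_Integration.integral_cong[OF refl])
    fix g assume "g \<in> space (count_space weyl)"
    then have g: "g \<in> weyl" by simp
    have "Y (aff_comp s g) y = Y s (Y g y)"
      by (simp add: Y_def side_reflection_comp[OF s g])
    then have "norm (x - Y (aff_comp s g) y) = norm (Y s x - Y s (Y g y))" using x by simp
    also have "\<dots> = norm (x - Y g y)" using s side_reflection_in_weyl by (intro norm_Y_diff) auto
    finally have "gauss t (x - Y (aff_comp s g) y) = gauss t (x - Y g y)"
      by (rule gauss_cong_norm)
    then show "aff_det (aff_comp s g) * gauss t (x - Y (aff_comp s g) y) = - (aff_det g * gauss t (x - Y g y))"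
      by (simp add: side_reflection_comp[OF s g])
  qed
  also have "\<dots> = - image_kernel t x y" by (simp add: image_kernel_def)
  finally show ?thesis by simp
qed

end

section \<open>The initial-boundary value problem for a given datum\<close>

locale initial_datum = equilateral +
  fixes f :: "real ^ 2 \<Rightarrow> real"
  assumes f_cont: "continuous_on UNIV f" and f_supp: "compact_support_in tri f"
begin

abbreviation "WL \<equiv> count_space weyl \<Otimes>\<^sub>M (lborel :: (real ^ 2) measure)"

sublocale W: pair_sigma_finite "count_space weyl" "lborel :: (real ^ 2) measure"
  by (rule pair_sigma_finite_weyl)

lemma f_measurable[measurable]: "f \<in> borel_measurable borel"
  using f_cont by (rule borel_measurable_continuous_onI)

lemma f_tri: "f z \<noteq> 0 \<Longrightarrow> z \<in> tri"
  using f_supp closure_subset[of "{z. f z \<noteq> 0}"] by (auto simp: compact_support_in_def)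

lemma f_bounded: obtains B where "B > 0" "\<And>z. \<bar>f z\<bar> \<le> B"
proof -
  have "compact (f ` closure {z. f z \<noteq> 0})"
    using f_supp by (intro compact_continuous_image continuous_on_subset[OF f_cont]) (auto simp: compact_support_in_def)
  then obtain B where B: "B > 0" "\<And>z. z \<in> closure {z. f z \<noteq> 0} \<Longrightarrow> norm (f z) \<le> B"
    by (auto simp: bounded_pos dest!: compact_imp_bounded)
  have "\<bar>f z\<bar> \<le> B" for z
    using B(1) B(2)[of z] closure_subset[of "{z. f z \<noteq> 0}"] by (cases "f z = 0") auto
  with B(1) show thesis by (rule that)
qed

lemma f_integrable: "integrable lborel f"
proof -
  have "integrable lborel (\<lambda>z. indicator (closure {z. f z \<noteq> 0}) z *\<^sub>R f z)"
    using f_supp by (intro borel_integrable_compact continuous_on_subset[OF f_cont]) (auto simp: compact_support_in_def)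
  moreover have "(\<lambda>z. indicator (closure {z. f z \<noteq> 0}) z *\<^sub>R f z) = f"
    using closure_subset[of "{z. f z \<noteq> 0}"] by (auto simp: fun_eq_iff indicator_def)
  ultimately show ?thesis by simp
qed

lemma measurable_WL:
  assumes "\<And>g. g \<in> weyl \<Longrightarrow> (\<lambda>z. F (g, z)) \<in> borel_measurable borel"
  shows "F \<in> borel_measurable WL"
  by (rule measurable_pair_measure_countable1) (use assms in auto)

sublocale G: gauss_superposition WL "\<lambda>(g, z). Y g z" "\<lambda>(g, z). aff_det g * f z"
proof
  show "(\<lambda>(g, z). Y g z) \<in> borel_measurable WL" by (rule measurable_WL) simp
  show "(\<lambda>(g, z). aff_det g * f z) \<in> borel_measurable WL" by (rule measurable_WL) simp
  fix \<kappa> :: real assume \<kappa>: "\<kappa> > 0"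
  \<comment> \<open>The condition concerns the norm of \<open>Y g z\<close>, that is the
    displacement seen from x = 0; so \<open>R\<close> has to bound the coordinates of the origin as
    well as those of the triangle.\<close>
  define R where "R = max 1 (max \<bar>cu 0\<bar> \<bar>cv 0\<bar>)"
  from exp_weight[OF \<kappa>, of R] obtain C where C: "C > 0"
    "\<And>g x z. g \<in> weyl \<Longrightarrow> \<bar>cu x\<bar> \<le> R \<Longrightarrow> \<bar>cv x\<bar> \<le> R \<Longrightarrow> \<bar>cu z\<bar> \<le> R \<Longrightarrow> \<bar>cv z\<bar> \<le> R \<Longrightarrow>
     exp (- \<kappa> * (norm (x - Y g z))\<^sup>2) \<le> C * weyl_weight g" by blast
  have i: "integrable WL (\<lambda>(g, z). (C * weyl_weight g) * \<bar>f z\<bar>)"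
    using integrable_weyl_weight f_integrable by (intro W.integrable_mult_pair) auto
  show "integrable WL (\<lambda>\<omega>. exp (- \<kappa> * (norm (case \<omega> of (g, z) \<Rightarrow> Y g z))\<^sup>2) * (case \<omega> of (g, z) \<Rightarrow> aff_det g * f z))"
  proof (rule Bochner_Integration.integrable_bound[OF i])
    show "(\<lambda>\<omega>. exp (- \<kappa> * (norm (case \<omega> of (g, z) \<Rightarrow> Y g z))\<^sup>2) * (case \<omega> of (g, z) \<Rightarrow> aff_det g * f z)) \<in> borel_measurable WL"
      by (rule measurable_WL) simp
    show "AE \<omega> in WL. norm (exp (- \<kappa> * (norm (case \<omega> of (g, z) \<Rightarrow> Y g z))\<^sup>2) * (case \<omega> of (g, z) \<Rightarrow> aff_det g * f z))
        \<le> norm (case \<omega> of (g, z) \<Rightarrow> C * weyl_weight g * \<bar>f z\<bar>)"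
    proof (rule AE_I2)
      fix \<omega> assume "\<omega> \<in> space WL"
      then obtain g z where \<omega>: "\<omega> = (g, z)" and g: "g \<in> weyl" by (auto simp: space_pair_measure)
      show "norm (exp (- \<kappa> * (norm (case \<omega> of (g, z) \<Rightarrow> Y g z))\<^sup>2) * (case \<omega> of (g, z) \<Rightarrow> aff_det g * f z))
        \<le> norm (case \<omega> of (g, z) \<Rightarrow> C * weyl_weight g * \<bar>f z\<bar>)"
      proof (cases "f z = 0")
        case False
        from tri_coord_bound[OF f_tri[OF this]] have "exp (- \<kappa> * (norm (0 - Y g z))\<^sup>2) \<le> C * weyl_weight g"
          by (intro C g) (auto simp: R_def le_max_iff_disj)
        then have "exp (- \<kappa> * (norm (Y g z))\<^sup>2) * \<bar>f z\<bar> \<le> C * weyl_weight g * \<bar>f z\<bar>"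
          by (intro mult_right_mono) auto
        then show ?thesis using abs_aff_det[OF g] C(1) weyl_weight_pos[of g]
          by (simp add: \<omega> abs_mult)
      qed (simp add: \<omega>)
    qed
  qed
qed

text \<open>
  The solution with datum \<open>f\<close>, after the substitution \<open>z = g\<^sup>-\<^sup>1 x + \<surd>t w\<close> in each term of the image sum:
  in this form it makes sense, and is continuous, down to \<open>t = 0\<close>.
\<close>

definition v :: "real \<Rightarrow> real ^ 2 \<Rightarrow> real" where
  "v t x = (LINT (g, w)|WL. aff_det g * gauss 1 w * f (Y (aff_inv g) x + sqrt t *\<^sub>R w))"

text \<open>Where the integrand is nonzero, z = g^-1 x + sqrt t w lies in the triangle and the
  displacement |x - g z| is sqrt t |w|, so \<open>weight_growth\<close> yields the weight at the
  price (1 + t |w|^2)^2, uniformly down to t = 0. The exponential exp (- |w|^2 / 4) of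
  \<open>gauss 1 w\<close> is split into two equal halves: one absorbs this price through
  \<open>square_exp_le\<close> with \<kappa> = 1/8, the other keeps the majorant integrable in
  w.\<close>

lemma v_domination:
  assumes R: "R \<ge> 1" and T: "T \<ge> 0"
  obtains D where "integrable WL D" "\<And>t x g w. 0 \<le> t \<Longrightarrow> t \<le> T \<Longrightarrow> \<bar>cu x\<bar> \<le> R \<Longrightarrow> \<bar>cv x\<bar> \<le> R \<Longrightarrow> g \<in> weyl \<Longrightarrow>
     norm (aff_det g * gauss 1 w * f (Y (aff_inv g) x + sqrt t *\<^sub>R w)) \<le> D (g, w)"
proof -
  obtain K where K: "K > 0" "\<And>g x z. g \<in> weyl \<Longrightarrow> \<bar>cu x\<bar> \<le> R \<Longrightarrow> \<bar>cv x\<bar> \<le> R \<Longrightarrow> \<bar>cu z\<bar> \<le> R \<Longrightarrow> \<bar>cv z\<bar> \<le> R \<Longrightarrow>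
     1 \<le> K * weyl_weight g * (1 + (norm (x - Y g z))\<^sup>2)\<^sup>2"
    using weight_growth by blast
  obtain B where B: "B > 0" "\<And>z. \<bar>f z\<bar> \<le> B" using f_bounded by blast
  define E where "E = B * K * (1 + T)\<^sup>2 * (1 + 2 / (1 / 8))\<^sup>2 / (4 * pi)"
  have E: "E \<ge> 0" using B K T by (simp add: E_def)
  show thesis
  proof (rule that[of "\<lambda>(g, w). weyl_weight g * (E * exp (- (1 / 8) * (norm w)\<^sup>2))"])
    show "integrable WL (\<lambda>(g, w). weyl_weight g * (E * exp (- (1 / 8) * (norm w)\<^sup>2)))"
      by (intro W.integrable_mult_pair integrable_weyl_weight integrable_mult_right integrable_exp_sq_vec2) simp
    fix t x g and w :: "real ^ 2"
    assume t: "0 \<le> t" "t \<le> T" and x: "\<bar>cu x\<bar> \<le> R" "\<bar>cv x\<bar> \<le> R" and g: "g \<in> weyl"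
    let ?z = "Y (aff_inv g) x + sqrt t *\<^sub>R w"
    have wt: "weyl_weight g \<ge> 0" using weyl_weight_pos[of g] by simp
    show "norm (aff_det g * gauss 1 w * f ?z) \<le> (case (g, w) of (g, w) \<Rightarrow> weyl_weight g * (E * exp (- (1 / 8) * (norm w)\<^sup>2)))"
    proof (cases "f ?z = 0")
      case True
      then show ?thesis using wt E by simp
    next
      case False
      from tri_coord_bound[OF f_tri[OF this]] R have z: "\<bar>cu ?z\<bar> \<le> R" "\<bar>cv ?z\<bar> \<le> R" by auto
      have "norm (x - Y g ?z) = norm (Y g (Y (aff_inv g) x) - Y g ?z)" by (simp add: Y_aff_inv[OF g])
      also have "\<dots> = sqrt t * norm w" unfolding norm_Y_diff[OF g] using t by simp
      finally have n: "(norm (x - Y g ?z))\<^sup>2 = t * (norm w)\<^sup>2" using t by (simp add: power_mult_distrib)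
      define s where "s = (norm w)\<^sup>2"
      have s: "s \<ge> 0" by (simp add: s_def)
      have "1 + t * s \<le> (1 + T) * (1 + s)" using t T s by (simp add: distrib_left distrib_right mult_right_mono add_increasing)
      then have "(1 + t * s)\<^sup>2 \<le> ((1 + T) * (1 + s))\<^sup>2" using t s by (intro power_mono) auto
      then have "(1 + (norm (x - Y g ?z))\<^sup>2)\<^sup>2 \<le> (1 + T)\<^sup>2 * (1 + s)\<^sup>2" by (simp add: n s_def power_mult_distrib)
      then have "K * weyl_weight g * (1 + (norm (x - Y g ?z))\<^sup>2)\<^sup>2 \<le> K * weyl_weight g * ((1 + T)\<^sup>2 * (1 + s)\<^sup>2)"
        using K wt by (intro mult_left_mono) auto
      with K(2)[OF g x z] have 1: "1 \<le> K * weyl_weight g * ((1 + T)\<^sup>2 * (1 + s)\<^sup>2)" by linarith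
      have gs: "gauss 1 w = exp (- (1 / 8) * s) * exp (- (1 / 8) * s) / (4 * pi)"
        by (simp add: gauss_def s_def flip: exp_add)
      have "norm (aff_det g * gauss 1 w * f ?z) = gauss 1 w * \<bar>f ?z\<bar>"
        using abs_aff_det[OF g] gauss_nonneg[of 1 w] by (simp add: abs_mult)
      also have "\<dots> \<le> gauss 1 w * B" using gauss_nonneg[of 1 w] by (intro mult_left_mono B) auto
      also have "\<dots> \<le> (K * weyl_weight g * ((1 + T)\<^sup>2 * (1 + s)\<^sup>2)) * (gauss 1 w * B)"
        using mult_right_mono[OF 1, of "gauss 1 w * B"] gauss_nonneg[of 1 w] B by simp
      also have "\<dots> = (B * K * (1 + T)\<^sup>2 * weyl_weight g * exp (- (1 / 8) * s) / (4 * pi)) * ((1 + s)\<^sup>2 * exp (- (1 / 8) * s))"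
        by (simp add: gs)
      also have "\<dots> \<le> (B * K * (1 + T)\<^sup>2 * weyl_weight g * exp (- (1 / 8) * s) / (4 * pi)) * (1 + 2 / (1 / 8))\<^sup>2"
        using B K wt s by (intro mult_left_mono square_exp_le) auto
      also have "\<dots> = weyl_weight g * (E * exp (- (1 / 8) * s))" by (simp add: E_def)
      finally show ?thesis by (simp add: s_def)
    qed
  qed
qed

lemma v_measurable: "(\<lambda>(g, w). aff_det g * gauss 1 w * f (Y (aff_inv g) x + sqrt t *\<^sub>R w)) \<in> borel_measurable WL"
  by (rule measurable_WL) simp

lemma v_integrable:
  assumes "t \<ge> 0"
  shows "integrable WL (\<lambda>(g, w). aff_det g * gauss 1 w * f (Y (aff_inv g) x + sqrt t *\<^sub>R w))"
proof -
  define R where "R = max 1 (max \<bar>cu x\<bar> \<bar>cv x\<bar>)"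
  have "R \<ge> 1" by (simp add: R_def)
  from v_domination[OF this assms] obtain D where D: "integrable WL D" "\<And>t' x g w. 0 \<le> t' \<Longrightarrow> t' \<le> t \<Longrightarrow> \<bar>cu x\<bar> \<le> R \<Longrightarrow> \<bar>cv x\<bar> \<le> R \<Longrightarrow> g \<in> weyl \<Longrightarrow>
     norm (aff_det g * gauss 1 w * f (Y (aff_inv g) x + sqrt t' *\<^sub>R w)) \<le> D (g, w)" by blast
  show ?thesis
    by (rule Bochner_Integration.integrable_bound[OF D(1) v_measurable AE_I2])
      (use assms in \<open>auto simp: R_def space_pair_measure intro!: order_trans[OF D(2) abs_ge_self, unfolded real_norm_def]\<close>)
qed

lemma continuous_on_v: "continuous_on ({0..} \<times> UNIV) (\<lambda>(t, x). v t x)"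
proof -
  have "continuous_on ({0..} \<times> UNIV) (\<lambda>tx. LINT \<omega>|WL. (case \<omega> of (g, w) \<Rightarrow>
      aff_det g * gauss 1 w * f (Y (aff_inv g) (snd tx) + sqrt (fst tx) *\<^sub>R w)))"
  proof (rule continuous_on_LINT_dominated)
    fix \<omega> :: "affine \<times> (real ^ 2)"
    obtain g w where \<omega>: "\<omega> = (g, w)" by (cases \<omega>)
    have "continuous_on ({0..} \<times> UNIV) (\<lambda>tx :: real \<times> (real ^ 2). Y (aff_inv g) (snd tx) + sqrt (fst tx) *\<^sub>R w)"
      by (intro continuous_intros continuous_on_compose2[OF continuous_on_Y[of UNIV]]) auto
    then have "continuous_on ({0..} \<times> UNIV) (\<lambda>tx :: real \<times> (real ^ 2). f (Y (aff_inv g) (snd tx) + sqrt (fst tx) *\<^sub>R w))"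
      by (rule continuous_on_compose2[OF f_cont]) simp
    then show "continuous_on ({0..} \<times> UNIV) (\<lambda>tx. (case \<omega> of (g, w) \<Rightarrow>
      aff_det g * gauss 1 w * f (Y (aff_inv g) (snd tx) + sqrt (fst tx) *\<^sub>R w)))"
      unfolding \<omega> by (auto intro!: continuous_intros)
  next
    fix tx :: "real \<times> (real ^ 2)"
    show "(\<lambda>(g, w). aff_det g * gauss 1 w * f (Y (aff_inv g) (snd tx) + sqrt (fst tx) *\<^sub>R w)) \<in> borel_measurable WL"
      by (rule v_measurable)
    obtain t0 x0 where tx: "tx = (t0, x0)" by (cases tx)
    define R where "R = max 1 (max (\<bar>cu x0\<bar> + 1) (\<bar>cv x0\<bar> + 1))"
    define U where "U = {..<\<bar>t0\<bar> + 1} \<times> {x. \<bar>cu x\<bar> < \<bar>cu x0\<bar> + 1 \<and> \<bar>cv x\<bar> < \<bar>cv x0\<bar> + 1}"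
    have "R \<ge> 1" "\<bar>t0\<bar> + 1 \<ge> 0" by (simp_all add: R_def)
    from v_domination[OF this] obtain D where D: "integrable WL D" "\<And>t x g w. 0 \<le> t \<Longrightarrow> t \<le> \<bar>t0\<bar> + 1 \<Longrightarrow> \<bar>cu x\<bar> \<le> R \<Longrightarrow> \<bar>cv x\<bar> \<le> R \<Longrightarrow> g \<in> weyl \<Longrightarrow>
     norm (aff_det g * gauss 1 w * f (Y (aff_inv g) x + sqrt t *\<^sub>R w)) \<le> D (g, w)" by blast
    have "open U" unfolding U_def
      by (intro open_Times open_lessThan open_Collect_conj open_Collect_less continuous_intros continuous_on_cu continuous_on_cv)
    moreover have "tx \<in> U" by (auto simp: tx U_def)
    moreover have "norm (case \<omega> of (g, w) \<Rightarrow> aff_det g * gauss 1 w * f (Y (aff_inv g) (snd y) + sqrt (fst y) *\<^sub>R w)) \<le> D \<omega>"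
      if "y \<in> {0..} \<times> UNIV \<inter> U" "\<omega> \<in> space WL" for y \<omega>
    proof -
      obtain g w where \<omega>: "\<omega> = (g, w)" by (cases \<omega>)
      have g: "g \<in> weyl" using that by (simp add: \<omega> space_pair_measure)
      obtain t x where y: "y = (t, x)" by (cases y)
      show ?thesis unfolding \<omega> y prod.case fst_conv snd_conv
        by (rule D(2)[OF _ _ _ _ g]) (use that in \<open>auto simp: y U_def R_def\<close>)
    qed
    ultimately show "\<exists>U w. open U \<and> tx \<in> U \<and> integrable WL w \<and> (\<forall>y\<in>{0..} \<times> UNIV \<inter> U. \<forall>\<omega>\<in>space WL.
        norm (case \<omega> of (g, w) \<Rightarrow> aff_det g * gauss 1 w * f (Y (aff_inv g) (snd y) + sqrt (fst y) *\<^sub>R w)) \<le> w \<omega>)"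
      using D(1) by (intro exI[of _ U] exI[of _ D]) blast
  qed
  then show ?thesis by (simp add: v_def case_prod_unfold)
qed

lemma U_integrable:
  "t > 0 \<Longrightarrow> integrable WL (\<lambda>(g, z). gauss t (x - Y g z) * (aff_det g * f z))"
  using G.integrable_U[of t x] by (simp add: case_prod_unfold)

lemma U_eq: "G.U t x = (LINT (g, z)|WL. gauss t (x - Y g z) * (aff_det g * f z))"
  unfolding G.U_def by (simp add: case_prod_unfold)

lemma v_eq_U:
  assumes t: "t > 0"
  shows "v t x = G.U t x"
proof -
  have "v t x = (LINT g|count_space weyl. LINT w|lborel. aff_det g * gauss 1 w * f (Y (aff_inv g) x + sqrt t *\<^sub>R w))"
    unfolding v_def using v_integrable[of t x] t by (subst W.integral_fst) auto
  also have "\<dots> = (LINT g|count_space weyl. LINT z|lborel. gauss t (x - Y g z) * (aff_det g * f z))"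
  proof (rule Bochner_Integration.integral_cong[OF refl])
    fix g assume "g \<in> space (count_space weyl)"
    then have g: "g \<in> weyl" by simp
    have "(sqrt t)\<^sup>2 * (gauss t (x - Y g (Y (aff_inv g) x + sqrt t *\<^sub>R w)) * (aff_det g * f (Y (aff_inv g) x + sqrt t *\<^sub>R w)))
       = aff_det g * gauss 1 w * f (Y (aff_inv g) x + sqrt t *\<^sub>R w)" for w
    proof -
      let ?z = "Y (aff_inv g) x + sqrt t *\<^sub>R w"
      have "norm (x - Y g ?z) = norm (Y g (Y (aff_inv g) x) - Y g ?z)" by (simp add: Y_aff_inv[OF g])
      also have "\<dots> = sqrt t * norm w" unfolding norm_Y_diff[OF g] using t by simp
      finally have "(norm (x - Y g ?z))\<^sup>2 = t * (norm w)\<^sup>2" using t by (simp add: power_mult_distrib)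
      then have "t * gauss t (x - Y g ?z) = gauss 1 w" using t by (simp add: gauss_def)
      then have "gauss 1 w = t * gauss t (x - Y g ?z)" by simp
      then show ?thesis using t by simp
    qed
    note eq = this
    have "(LINT z|lborel. gauss t (x - Y g z) * (aff_det g * f z)) = (sqrt t)\<^sup>2 * (LINT w|lborel.
        gauss t (x - Y g (Y (aff_inv g) x + sqrt t *\<^sub>R w)) * (aff_det g * f (Y (aff_inv g) x + sqrt t *\<^sub>R w)))"
      using t by (intro integral_affine_vec2) auto
    also have "\<dots> = (LINT w|lborel. (sqrt t)\<^sup>2 *
        (gauss t (x - Y g (Y (aff_inv g) x + sqrt t *\<^sub>R w)) * (aff_det g * f (Y (aff_inv g) x + sqrt t *\<^sub>R w))))"
      by (rule integral_mult_right_zero[symmetric])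
    finally show "(LINT w|lborel. aff_det g * gauss 1 w * f (Y (aff_inv g) x + sqrt t *\<^sub>R w)) =
       (LINT z|lborel. gauss t (x - Y g z) * (aff_det g * f z))"
      unfolding eq by (rule sym)
  qed
  also have "\<dots> = G.U t x"
    unfolding U_eq using U_integrable[OF t, of x] by (subst W.integral_fst) auto
  finally show ?thesis .
qed

text \<open>The double integral of \<open>v_eq_U\<close> with the group sum taken innermost.\<close>

lemma U_eq_image_kernel:
  assumes t: "t > 0"
  shows "G.U t x = (LINT y:tri|lborel. image_kernel t x y * f y)"
proof -
  have "G.U t x = (LINT y|lborel. LINT g|count_space weyl. gauss t (x - Y g y) * (aff_det g * f y))"
    unfolding U_eq using U_integrable[OF t, of x] by (subst W.integral_snd) auto
  also have "\<dots> = (LINT y|lborel. image_kernel t x y * f y)"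
  proof (rule Bochner_Integration.integral_cong[OF refl])
    fix y
    have "(LINT g|count_space weyl. gauss t (x - Y g y) * (aff_det g * f y)) = (LINT g|count_space weyl. (aff_det g * gauss t (x - Y g y)) * f y)"
      by (simp add: mult_ac)
    then show "(LINT g|count_space weyl. gauss t (x - Y g y) * (aff_det g * f y)) = image_kernel t x y * f y"
      by (simp add: image_kernel_def)
  qed
  also have "\<dots> = (LINT y:tri|lborel. image_kernel t x y * f y)"
    unfolding set_lebesgue_integral_def
    by (rule Bochner_Integration.integral_cong[OF refl]) (use f_tri in \<open>auto simp: indicator_def\<close>)
  finally show ?thesis .
qed

text \<open>The other images of the open triangle are disjoint from it, so only the identity contributes at \<open>t = 0\<close>.\<close>

lemma v_initial:
  assumes x: "x \<in> closure tri"
  shows "v 0 x = f x"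
proof -
  let ?i = "((1, 0, 0, 1), 0, 0) :: affine"
  have i: "?i \<in> weyl" by (simp add: weyl_def weyl_linear_def)
  have Yi: "Y (aff_inv ?i) z = z" for z by (simp add: Y_def)
  have zero: "f (Y (aff_inv g) x) = 0" if g: "g \<in> weyl" "g \<noteq> ?i" for g
  proof (rule ccontr)
    assume "f (Y (aff_inv g) x) \<noteq> 0"
    then have "x \<in> Y (aff_inv g) -` tri" using f_tri by simp
    \<comment> \<open>The point x is only in the closure; openness of the preimage moves it to a
      nearby point inside the triangle, where \<open>weyl_unique\<close> applies.\<close>
    moreover have "open (Y (aff_inv g) -` tri)"
      using continuous_open_vimage[OF open_tri] continuous_on_Y[of UNIV "aff_inv g"]
      by (simp add: open_vimage open_tri)
    ultimately obtain x' where x': "x' \<in> tri" "Y (aff_inv g) x' \<in> tri"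
      using x open_Int_closure_eq_empty[of "Y (aff_inv g) -` tri" tri] by blast
    have "g = ?i"
    proof (rule weyl_unique[OF g(1), where u = "cu (Y (aff_inv g) x')" and v = "cv (Y (aff_inv g) x')"])
      have "Y g (Y (aff_inv g) x') = x'" by (rule Y_aff_inv[OF g(1)])
      then have "act_u g (cu (Y (aff_inv g) x')) (cv (Y (aff_inv g) x')) = cu x'"
         "act_v g (cu (Y (aff_inv g) x')) (cv (Y (aff_inv g) x')) = cv x'"
        by (metis cu_Y cv_Y)+
      then show "0 < act_u g (cu (Y (aff_inv g) x')) (cv (Y (aff_inv g) x'))"
        "0 < act_v g (cu (Y (aff_inv g) x')) (cv (Y (aff_inv g) x'))"
        "act_u g (cu (Y (aff_inv g) x')) (cv (Y (aff_inv g) x')) + act_v g (cu (Y (aff_inv g) x')) (cv (Y (aff_inv g) x')) < 1"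
        using x'(1) by (simp_all add: tri_def)
    qed (use x'(2) in \<open>simp_all only: tri_def mem_Collect_eq\<close>)
    with g show False by simp
  qed
  have "v 0 x = (LINT g|count_space weyl. LINT w|lborel. aff_det g * gauss 1 w * f (Y (aff_inv g) x + sqrt 0 *\<^sub>R w))"
    unfolding v_def using v_integrable[of 0 x] by (subst W.integral_fst) auto
  also have "\<dots> = (LINT g|count_space weyl. aff_det g * f (Y (aff_inv g) x))"
    using integral_gauss[of 1] by (intro Bochner_Integration.integral_cong refl) simp
  also have "\<dots> = (LINT g|count_space weyl. indicator {?i} g *\<^sub>R f x)"
    by (intro Bochner_Integration.integral_cong refl) (use zero Yi in \<open>auto simp: indicator_def\<close>)
  also have "\<dots> = f x"
    using i by (simp add: measure_count_space)
  finally show ?thesis .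
qed

lemma v_boundary:
  assumes x: "x \<in> frontier tri" and t: "t \<ge> 0"
  shows "v t x = 0"
proof (cases "t = 0")
  case True
  have "x \<in> closure tri" "x \<notin> tri" using x open_tri by (auto simp: frontier_def interior_open)
  then show ?thesis using v_initial[of x] f_tri[of x] True by auto
next
  case False
  with t have t: "t > 0" by simp
  obtain s where "s \<in> side_reflections" "Y s x = x" using frontier_tri[OF x] by blast
  then show ?thesis
    unfolding v_eq_U[OF t] U_eq_image_kernel[OF t] by (simp add: image_kernel_boundary)
qed

lemma dirichlet_heat_solution_v: "dirichlet_heat_solution tri f v"
  unfolding dirichlet_heat_solution_def
proof (intro conjI allI impI ballI)
  show "continuous_on ({0..} \<times> closure tri) (\<lambda>(t, x). v t x)"
    by (rule continuous_on_subset[OF continuous_on_v]) auto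
  fix t :: real assume t: "t > 0"
  have vU: "v t = G.U t" using v_eq_U[OF t] by auto
  show "C2_on tri (v t)" unfolding vU by (rule G.C2_on_U[OF t])
  fix x
  have "((\<lambda>s. G.U s x) has_real_derivative laplacian (v t) x) (at t)"
    unfolding vU by (rule G.heat_equation_U[OF t]) simp
  then show "((\<lambda>s. v s x) has_real_derivative laplacian (v t) x) (at t)"
    by (rule has_field_derivative_transform_within_open[where S = "{0<..}"]) (use t v_eq_U in auto)
qed (use v_initial v_boundary in auto)

end

section \<open>Identification of the Dirichlet heat kernel\<close>

context equilateral
begin

lemma dirichlet_heat_kernel_tri:
  "dirichlet_heat_kernel tri = (\<lambda>t x y. if t > 0 \<and> x \<in> tri \<and> y \<in> tri then image_kernel t x y else 0)"
proof (rule dirichlet_heat_kernel_eqI[OF open_tri bounded_tri])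
  let ?k = "\<lambda>t x y. if t > 0 \<and> x \<in> tri \<and> y \<in> tri then image_kernel t x y else 0"
  show "is_dirichlet_heat_kernel tri ?k"
    unfolding is_dirichlet_heat_kernel_def
  proof (intro conjI allI impI)
    fix t :: real assume t: "t > 0"
    show "continuous_on (tri \<times> tri) (\<lambda>(x, y). ?k t x y)"
      using continuous_on_image_kernel[OF t] t by (subst continuous_on_cong[OF refl]) auto
  next
    fix f :: "real ^ 2 \<Rightarrow> real" assume "continuous_on UNIV f \<and> compact_support_in tri f"
    then interpret initial_datum c e1 e2 L f by unfold_locales auto
    have "v t x = (LINT y:tri|lborel. ?k t x y * f y)" if "t > 0" "x \<in> tri" for t x
    proof -
      have "v t x = (LINT y:tri|lborel. image_kernel t x y * f y)"
        using v_eq_U[OF that(1)] U_eq_image_kernel[OF that(1)] by simp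
      also have "\<dots> = (LINT y:tri|lborel. ?k t x y * f y)"
        using open_tri that by (intro set_lebesgue_integral_cong) auto
      finally show ?thesis .
    qed
    then show "\<exists>u. dirichlet_heat_solution tri f u \<and> (\<forall>t>0. \<forall>x\<in>tri. u t x = (LINT y:tri|lborel. ?k t x y * f y))"
      using dirichlet_heat_solution_v by blast
  qed auto
qed

end

subsection \<open>Integrals over the coordinate simplex\<close>

lemma borel_measurable_hexform[measurable (raw)]:
  assumes [measurable]: "f \<in> borel_measurable M" "g \<in> borel_measurable M"
  shows "(\<lambda>z. hexform (f z) (g z)) \<in> borel_measurable M"
  unfolding hexform_def by measurable

text \<open>Integration over the triangle in the coordinates u, v, without the Jacobian. Being
  valued in \<open>ennreal\<close>, it allows exchanges and substitutions with measurability
  alone.\<close>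

definition simplex_integral :: "(real \<Rightarrow> real \<Rightarrow> real) \<Rightarrow> ennreal" where
  "simplex_integral F = (\<integral>\<^sup>+v. \<integral>\<^sup>+u. ennreal (F u v) * indicator {0<..} u * indicator {0<..} v * indicator {..<1} (u + v) \<partial>lborel \<partial>lborel)"

text \<open>The cyclic permutation of the barycentric coordinates preserves area: replace u by w = 1
  - u - v in the inner integral, then exchange the order. Thus one side or one vertex stands for all
  three.\<close>

lemma simplex_integral_rotate:
  assumes [measurable]: "case_prod F \<in> borel_measurable (borel \<Otimes>\<^sub>M borel)"
  shows "simplex_integral (\<lambda>u v. F v (1 - u - v)) = simplex_integral F"
proof -
  have "(\<integral>\<^sup>+u. ennreal (F v (1 - u - v)) * indicator {0<..} u * indicator {0<..} v * indicator {..<1} (u + v) \<partial>lborel)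
      = (\<integral>\<^sup>+w. ennreal (F v w) * indicator {0<..} v * indicator {0<..} w * indicator {..<1} (v + w) \<partial>lborel)" for v
  proof -
    have "(\<integral>\<^sup>+w. ennreal (F v w) * indicator {0<..} v * indicator {0<..} w * indicator {..<1} (v + w) \<partial>lborel)
      = ennreal \<bar>-1\<bar> * (\<integral>\<^sup>+u. ennreal (F v (1 - v + -1 * u)) * indicator {0<..} v * indicator {0<..} (1 - v + -1 * u) * indicator {..<1} (v + (1 - v + -1 * u)) \<partial>lborel)"
      by (rule nn_integral_real_affine) auto
    also have "\<dots> = (\<integral>\<^sup>+u. ennreal (F v (1 - u - v)) * indicator {0<..} u * indicator {0<..} v * indicator {..<1} (u + v) \<partial>lborel)"
      by (simp, intro nn_integral_cong) (auto simp: indicator_def algebra_simps)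
    finally show ?thesis by simp
  qed
  then have "simplex_integral (\<lambda>u v. F v (1 - u - v)) =
      (\<integral>\<^sup>+v. \<integral>\<^sup>+w. ennreal (F v w) * indicator {0<..} v * indicator {0<..} w * indicator {..<1} (v + w) \<partial>lborel \<partial>lborel)"
    unfolding simplex_integral_def by simp
  also have "\<dots> = simplex_integral F"
    unfolding simplex_integral_def by (rule lborel_pair.Fubini') measurable
  finally show ?thesis .
qed

text \<open>
  The constant corner corrections of a reflection in a side and of the reflection in the parallel line
  through the opposite vertex cancel.
\<close>

lemma simplex_integral_symmetrized:
  assumes [measurable]: "\<phi> \<in> borel_measurable borel" and nn: "\<And>s. \<phi> s \<ge> 0"
  shows "simplex_integral (\<lambda>u v. \<phi> u + \<phi> (1 - u)) = (\<integral>\<^sup>+u. ennreal (\<phi> u) * indicator {0<..<1} u \<partial>lborel)"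
proof -
  have "simplex_integral (\<lambda>u v. \<phi> u + \<phi> (1 - u)) =
     (\<integral>\<^sup>+u. \<integral>\<^sup>+v. ennreal (\<phi> u + \<phi> (1 - u)) * indicator {0<..} u * indicator {0<..} v * indicator {..<1} (u + v) \<partial>lborel \<partial>lborel)"
    unfolding simplex_integral_def by (rule lborel_pair.Fubini') measurable
  \<comment> \<open>The slice at height u has length 1 - u. After u is replaced by 1 - u in the
    second term its weight becomes u, and the two weights add up to 1.\<close>
  also have "\<dots> = (\<integral>\<^sup>+u. ennreal ((1 - u) * \<phi> u) * indicator {0<..<1} u + ennreal ((1 - u) * \<phi> (1 - u)) * indicator {0<..<1} u \<partial>lborel)"
  proof (rule nn_integral_cong)
    fix u :: real
    have "(\<integral>\<^sup>+v. ennreal (\<phi> u + \<phi> (1 - u)) * indicator {0<..} u * indicator {0<..} v * indicator {..<1} (u + v) \<partial>lborel)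
       = (\<integral>\<^sup>+v. (ennreal (\<phi> u + \<phi> (1 - u)) * indicator {0<..<1} u) * indicator {0<..<1 - u} v \<partial>lborel)"
      by (intro nn_integral_cong) (auto simp: indicator_def)
    also have "\<dots> = (ennreal (\<phi> u + \<phi> (1 - u)) * indicator {0<..<1} u) * emeasure lborel {0<..<1 - u}"
      by (rule nn_integral_cmult_indicator) simp
    also have "\<dots> = ennreal ((1 - u) * \<phi> u) * indicator {0<..<1} u + ennreal ((1 - u) * \<phi> (1 - u)) * indicator {0<..<1} u"
    proof (cases "0 < u \<and> u < 1")
      case True
      then have "ennreal (\<phi> u + \<phi> (1 - u)) * ennreal (1 - u) = ennreal ((1 - u) * \<phi> u) + ennreal ((1 - u) * \<phi> (1 - u))"
      proof -
        have "ennreal (\<phi> u + \<phi> (1 - u)) * ennreal (1 - u) = ennreal ((\<phi> u + \<phi> (1 - u)) * (1 - u))"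
          using nn True by (intro ennreal_mult[symmetric]) auto
        also have "(\<phi> u + \<phi> (1 - u)) * (1 - u) = (1 - u) * \<phi> u + (1 - u) * \<phi> (1 - u)"
          by (simp add: algebra_simps)
        finally show ?thesis using nn True by (simp add: ennreal_plus)
      qed
      then show ?thesis using True by simp
    qed simp
    finally show "(\<integral>\<^sup>+v. ennreal (\<phi> u + \<phi> (1 - u)) * indicator {0<..} u * indicator {0<..} v * indicator {..<1} (u + v) \<partial>lborel)
       = ennreal ((1 - u) * \<phi> u) * indicator {0<..<1} u + ennreal ((1 - u) * \<phi> (1 - u)) * indicator {0<..<1} u" .
  qed
  also have "\<dots> = (\<integral>\<^sup>+u. ennreal ((1 - u) * \<phi> u) * indicator {0<..<1} u \<partial>lborel) + (\<integral>\<^sup>+u. ennreal ((1 - u) * \<phi> (1 - u)) * indicator {0<..<1} u \<partial>lborel)"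
    by (rule nn_integral_add) auto
  also have "(\<integral>\<^sup>+u. ennreal ((1 - u) * \<phi> (1 - u)) * indicator {0<..<1} u \<partial>lborel) = (\<integral>\<^sup>+u. ennreal (u * \<phi> u) * indicator {0<..<1} u \<partial>lborel)"
  proof -
    have "(\<integral>\<^sup>+u. ennreal (u * \<phi> u) * indicator {0<..<1} u \<partial>lborel) =
        ennreal \<bar>-1\<bar> * (\<integral>\<^sup>+u. ennreal ((1 + -1 * u) * \<phi> (1 + -1 * u)) * indicator {0<..<1} (1 + -1 * u) \<partial>lborel)"
      by (rule nn_integral_real_affine) auto
    also have "\<dots> = (\<integral>\<^sup>+u. ennreal ((1 - u) * \<phi> (1 - u)) * indicator {0<..<1} u \<partial>lborel)"
      by (simp, intro nn_integral_cong) (auto simp: indicator_def)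
    finally show ?thesis by simp
  qed
  also have "(\<integral>\<^sup>+u. ennreal ((1 - u) * \<phi> u) * indicator {0<..<1} u \<partial>lborel) + (\<integral>\<^sup>+u. ennreal (u * \<phi> u) * indicator {0<..<1} u \<partial>lborel)
     = (\<integral>\<^sup>+u. ennreal ((1 - u) * \<phi> u) * indicator {0<..<1} u + ennreal (u * \<phi> u) * indicator {0<..<1} u \<partial>lborel)"
    by (rule nn_integral_add[symmetric]) auto
  also have "\<dots> = (\<integral>\<^sup>+u. ennreal (\<phi> u) * indicator {0<..<1} u \<partial>lborel)"
  proof (rule nn_integral_cong)
    fix u
    show "ennreal ((1 - u) * \<phi> u) * indicator {0<..<1} u + ennreal (u * \<phi> u) * indicator {0<..<1} u = ennreal (\<phi> u) * indicator {0<..<1} u"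
    proof (cases "u \<in> {0<..<1}")
      case True
      then have "ennreal ((1 - u) * \<phi> u) + ennreal (u * \<phi> u) = ennreal ((1 - u) * \<phi> u + u * \<phi> u)"
        using nn[of u] by (intro ennreal_plus[symmetric]) auto
      also have "(1 - u) * \<phi> u + u * \<phi> u = \<phi> u" by (simp add: algebra_simps)
      finally show ?thesis using True by simp
    qed simp
  qed
  finally show ?thesis .
qed

text \<open>Half of the Gaussian integral over the line, minus the tail beyond 1; there s^2 \<ge> s,
  so the tail is at most that of exp (- k s).\<close>

lemma nn_integral_gauss_unit_interval:
  assumes k: "k > 0"
  obtains r where "(\<integral>\<^sup>+s. ennreal (exp (- k * s\<^sup>2)) * indicator {0<..<1} s \<partial>lborel) = ennreal r"
    "r \<ge> 0" "r \<le> sqrt (pi / k) / 2" "sqrt (pi / k) / 2 - exp (- k) / k \<le> r"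
proof -
  let ?e = "\<lambda>s :: real. ennreal (exp (- k * s\<^sup>2))"
  define A where "A = (\<integral>\<^sup>+s. ?e s * indicator {0<..<1} s \<partial>lborel)"
  define B where "B = (\<integral>\<^sup>+s. ?e s * indicator {1..} s \<partial>lborel)"
  define H where "H = (\<integral>\<^sup>+s. ?e s * indicator {0<..} s \<partial>lborel)"
  have H_AB: "H = A + B"
  proof -
    have "A + B = (\<integral>\<^sup>+s. ?e s * indicator {0<..<1} s + ?e s * indicator {1..} s \<partial>lborel)"
      unfolding A_def B_def by (rule nn_integral_add[symmetric]) auto
    also have "\<dots> = H" unfolding H_def by (intro nn_integral_cong) (auto simp: indicator_def)
    finally show ?thesis by simp
  qed
  have neg: "(\<integral>\<^sup>+s. ?e s * indicator {..<0} s \<partial>lborel) = H"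
  proof -
    have "(\<integral>\<^sup>+s. ?e s * indicator {..<0} s \<partial>lborel) = ennreal \<bar>-1\<bar> * (\<integral>\<^sup>+s. ?e (0 + -1 * s) * indicator {..<0} (0 + -1 * s) \<partial>lborel)"
      by (rule nn_integral_real_affine) auto
    also have "\<dots> = H" unfolding H_def by (simp, intro nn_integral_cong) (auto simp: indicator_def)
    finally show ?thesis .
  qed
  have "ennreal (sqrt (pi / k)) = (\<integral>\<^sup>+s. ?e s \<partial>lborel)" by (rule nn_integral_gauss[OF k, symmetric])
  also have "\<dots> = (\<integral>\<^sup>+s. ?e s * indicator {..<0} s + ?e s * indicator {0<..} s \<partial>lborel)"
    by (intro nn_integral_cong_AE AE_I[where N="{0}"]) (auto simp: indicator_def)
  also have "\<dots> = H + H" using neg unfolding H_def by (subst nn_integral_add) auto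
  finally have HH: "H + H = ennreal (sqrt (pi / k))" by simp
  then obtain h where h: "H = ennreal h" "h \<ge> 0" by (cases H) auto
  with HH k have h_eq: "h = sqrt (pi / k) / 2" by (simp add: ennreal_plus[symmetric] del: ennreal_plus)
  have "A \<le> H" by (simp add: H_AB)
  then obtain r where r: "A = ennreal r" "r \<ge> 0" using h by (cases A) (auto simp: top_unique)
  have "B \<le> H" by (simp add: H_AB add_increasing)
  then obtain b where b: "B = ennreal b" "b \<ge> 0" using h by (cases B) (auto simp: top_unique)
  have rb: "h = r + b" using H_AB h r b by (simp add: ennreal_plus[symmetric] del: ennreal_plus)
  have "B \<le> (\<integral>\<^sup>+s. ennreal (exp (- k * s)) * indicator {1..} s \<partial>lborel)"
    unfolding B_def
  proof (rule nn_integral_mono)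
    fix s :: real
    have "exp (- k * s\<^sup>2) \<le> exp (- k * s)" if "s \<ge> 1"
      using that k by (simp add: power2_eq_square)
    then show "?e s * indicator {1..} s \<le> ennreal (exp (- k * s)) * indicator {1..} s"
      by (auto simp: indicator_def intro: ennreal_leI)
  qed
  also have "\<dots> = ennreal (0 - (- exp (- k * 1) / k))"
  proof (rule nn_integral_FTC_atLeast)
    have "filterlim (\<lambda>s. - k * s) at_bot at_top"
      using k by (simp add: filterlim_uminus_at_bot filterlim_tendsto_pos_mult_at_top[OF tendsto_const _ filterlim_ident])
    from tendsto_divide[OF tendsto_minus[OF filterlim_compose[OF exp_at_bot this]] tendsto_const[of k]]
    show "((\<lambda>s. - exp (- k * s) / k) \<longlongrightarrow> 0) at_top" using k by simp
  qed (use k in \<open>auto intro!: derivative_eq_intros\<close>)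
  finally have "b \<le> exp (- k) / k" using b k by (simp add: ennreal_le_iff)
  with r rb b h_eq have "r \<le> sqrt (pi / k) / 2" "sqrt (pi / k) / 2 - exp (- k) / k \<le> r" by linarith+
  with r show thesis unfolding A_def by (rule that)
qed

text \<open>The full sector minus the part beyond the opposite side. There the form is at least 3/4,
  the squared height of the unit triangle; half of the exponent gives the factor exp (- 3 k / 8),
  and the other half is integrated over the whole sector with k / 2, which doubles the
  value.\<close>

lemma simplex_integral_exp_hexform:
  assumes k: "k > 0"
  obtains r where "simplex_integral (\<lambda>u v. exp (- k * hexform u v)) = ennreal r"
    "r \<ge> 0" "r \<le> pi / (3 * sqrt 3 * k)" "pi / (3 * sqrt 3 * k) * (1 - 2 * exp (- (3 / 8) * k)) \<le> r"
proof -
  let ?Q = "\<lambda>k u v. ennreal (exp (- k * hexform u v)) * indicator {0<..} u * indicator {0<..} v"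
  have quad: "(\<integral>\<^sup>+v. \<integral>\<^sup>+u. ?Q k u v \<partial>lborel \<partial>lborel) = ennreal (pi / (3 * sqrt 3 * k))" if "k > 0" for k
    using nn_integral_quadrant_exp[OF that] by (simp add: hexform_def)
  define A where "A = simplex_integral (\<lambda>u v. exp (- k * hexform u v))"
  define B where "B = (\<integral>\<^sup>+v. \<integral>\<^sup>+u. ?Q k u v * indicator {1..} (u + v) \<partial>lborel \<partial>lborel)"
  have AB: "ennreal (pi / (3 * sqrt 3 * k)) = A + B"
  proof -
    have "(\<integral>\<^sup>+u. ?Q k u v \<partial>lborel) = (\<integral>\<^sup>+u. ?Q k u v * indicator {..<1} (u + v) \<partial>lborel) + (\<integral>\<^sup>+u. ?Q k u v * indicator {1..} (u + v) \<partial>lborel)" for v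
      by (subst nn_integral_add[symmetric]) (auto intro!: nn_integral_cong simp: indicator_def)
    then show ?thesis
      unfolding quad[OF k, symmetric] A_def B_def simplex_integral_def
      by (simp add: nn_integral_add)
  qed
  then have "A \<le> ennreal (pi / (3 * sqrt 3 * k))" "B \<le> ennreal (pi / (3 * sqrt 3 * k))" by (simp_all add: add_increasing)
  then obtain r b where r: "A = ennreal r" "r \<ge> 0" and b: "B = ennreal b" "b \<ge> 0"
    by (cases A; cases B) (auto simp: top_unique)
  have rb: "pi / (3 * sqrt 3 * k) = r + b"
    using AB k r b by (simp add: ennreal_plus[symmetric] del: ennreal_plus)
  have "B \<le> (\<integral>\<^sup>+v. \<integral>\<^sup>+u. ennreal (exp (- (3 / 8) * k)) * ?Q (k / 2) u v \<partial>lborel \<partial>lborel)"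
    unfolding B_def
  proof (intro nn_integral_mono)
    fix u v :: real
    have "exp (- k * hexform u v) \<le> exp (- (3 / 8) * k) * exp (- (k / 2) * hexform u v)" if "u > 0" "v > 0" "u + v \<ge> 1"
    proof -
      have "0 \<le> (u - v)\<^sup>2" by simp
      moreover have "1 \<le> (u + v)\<^sup>2" using that by (simp add: one_le_power)
      moreover have "4 * hexform u v = 3 * (u + v)\<^sup>2 + (u - v)\<^sup>2" by (simp add: hexform_def power2_eq_square algebra_simps)
      ultimately have "hexform u v \<ge> 3 / 4" by linarith
      then have "(k / 2) * (3 / 4) \<le> (k / 2) * hexform u v" using k by (intro mult_left_mono) auto
      then show ?thesis by (simp flip: exp_add)
    qed
    then show "?Q k u v * indicator {1..} (u + v) \<le> ennreal (exp (- (3 / 8) * k)) * ?Q (k / 2) u v"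
      by (auto simp: indicator_def ennreal_mult[symmetric] intro!: ennreal_leI)
  qed
  also have "\<dots> = ennreal (exp (- (3 / 8) * k)) * (\<integral>\<^sup>+v. \<integral>\<^sup>+u. ?Q (k / 2) u v \<partial>lborel \<partial>lborel)"
    by (simp add: nn_integral_cmult)
  also have "\<dots> = ennreal (exp (- (3 / 8) * k)) * ennreal (pi / (3 * sqrt 3 * (k / 2)))"
    by (subst quad) (use k in simp_all)
  also have "\<dots> = ennreal (exp (- (3 / 8) * k) * (pi / (3 * sqrt 3 * (k / 2))))"
    using k by (intro ennreal_mult[symmetric]) auto
  finally have "b \<le> exp (- (3 / 8) * k) * (pi / (3 * sqrt 3 * (k / 2)))"
    using b k by (simp add: ennreal_le_iff)
  also have "\<dots> = pi / (3 * sqrt 3 * k) * (2 * exp (- (3 / 8) * k))" by simp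
  finally have "b \<le> pi / (3 * sqrt 3 * k) * (2 * exp (- (3 / 8) * k))" .
  then have "pi / (3 * sqrt 3 * k) * (1 - 2 * exp (- (3 / 8) * k)) \<le> r" using rb by (simp add: right_diff_distrib)
  with r b rb show thesis by (intro that[of r]) (simp_all add: A_def)
qed

lemma abs_integral_le_integral:
  fixes f g :: "'z \<Rightarrow> real"
  assumes "integrable M f" "integrable M g" "\<And>x. x \<in> space M \<Longrightarrow> \<bar>f x\<bar> \<le> g x"
  shows "\<bar>LINT x|M. f x\<bar> \<le> (LINT x|M. g x)"
proof -
  have "\<bar>LINT x|M. f x\<bar> \<le> (LINT x|M. \<bar>f x\<bar>)" by (rule integral_abs_bound)
  also have "\<dots> \<le> (LINT x|M. g x)" by (rule integral_mono) (use assms in auto)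
  finally show ?thesis .
qed

lemma integral_count_space_split:
  fixes f :: "'z \<Rightarrow> real"
  assumes f: "integrable (count_space A) f" and B: "finite B" "B \<subseteq> A"
  shows "(LINT a|count_space A. f a) = (\<Sum>b\<in>B. f b) + (LINT a|count_space A. indicator (- B) a * f a)"
proof -
  have i: "integrable (count_space A) (\<lambda>a. indicator C a * f a)" for C
    by (rule Bochner_Integration.integrable_bound[OF f]) (auto simp: indicator_def)
  have "(LINT a|count_space A. f a) = (LINT a|count_space A. indicator B a * f a + indicator (- B) a * f a)"
    by (intro Bochner_Integration.integral_cong refl) (simp add: indicator_def)
  also have "\<dots> = (LINT a|count_space A. indicator B a * f a) + (LINT a|count_space A. indicator (- B) a * f a)"
    by (rule Bochner_Integration.integral_add[OF i i])
  also have "(LINT a|count_space A. indicator B a * f a) = (\<Sum>b\<in>B. f b)"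
  proof -
    have s: "{a \<in> A. indicator B a * f a \<noteq> 0} \<subseteq> B" by (auto simp: indicator_def)
    have "(LINT a|count_space A. indicator B a * f a) = (\<Sum>a | a \<in> A \<and> indicator B a * f a \<noteq> 0. indicator B a * f a)"
      by (rule lebesgue_integral_count_space_finite_support) (rule finite_subset[OF s B(1)])
    also have "\<dots> = (\<Sum>b\<in>B. indicator B b * f b)"
      by (rule sum.mono_neutral_left[OF B(1) s]) (use B in auto)
    finally show ?thesis by simp
  qed
  finally show ?thesis .
qed

subsection \<open>The trace\<close>

text \<open>The elements of the affine Weyl group with a fixed point in the closed triangle.\<close>

definition stabilizers :: "affine set" where
  "stabilizers = {((1, 0, 0, 1), 0, 0),
     ((1, 1, 0, -1), 0, 0), ((1, 1, 0, -1), -1, 2),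
     ((-1, 0, 1, 1), 0, 0), ((-1, 0, 1, 1), 2, -1),
     ((0, -1, -1, 0), 0, 0), ((0, -1, -1, 0), 1, 1),
     ((-1, -1, 1, 0), 0, 0), ((-1, -1, 1, 0), 2, -1), ((-1, -1, 1, 0), 1, 1),
     ((0, 1, -1, -1), 0, 0), ((0, 1, -1, -1), 1, 1), ((0, 1, -1, -1), -1, 2)}"

lemma stabilizers_subset: "stabilizers \<subseteq> weyl"
  by (auto simp: stabilizers_def weyl_def weyl_linear_def)

lemma one_le_square:
  fixes x :: real
  assumes "\<bar>x\<bar> \<ge> 1"
  shows "1 \<le> x\<^sup>2"
  using power_mono[OF assms, of 2] by simp

text \<open>The rotations of \<open>W\<close> are those about the points with integer coordinates.\<close>

lemma hexform_lattice_far: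
  fixes u v :: real and i j :: int
  assumes "u > 0" "v > 0" "u + v < 1" and ij: "(i, j) \<notin> {(0, 0), (1, 0), (0, 1)}"
  shows "3 / 4 \<le> hexform (u - i) (v - j)"
proof -
  let ?A = "u - i" and ?B = "v - j"
  \<comment> \<open>Three ways of completing the square, one for each side direction: a gap of at
    least 1 in u, v or u + v already gives 3/4. The last serves the integer point (1, 1), the only
    excluded corner of the unit square.\<close>
  have 1: "4 * hexform ?A ?B = 3 * ?A\<^sup>2 + (2 * ?B + ?A)\<^sup>2"
    and 2: "4 * hexform ?A ?B = 3 * ?B\<^sup>2 + (2 * ?A + ?B)\<^sup>2"
    and 3: "4 * hexform ?A ?B = 3 * (?A + ?B)\<^sup>2 + (?A - ?B)\<^sup>2"
    by (simp_all add: hexform_def power2_eq_square algebra_simps)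
  consider "i \<le> -1 \<or> i \<ge> 2" | "j \<le> -1 \<or> j \<ge> 2" | "i = 1" "j = 1"
    using ij by (auto; linarith)
  then show ?thesis
  proof cases
    case 1
    then have "real_of_int i \<le> -1 \<or> real_of_int i \<ge> 2" by linarith
    then have "\<bar>?A\<bar> \<ge> 1" using assms by linarith
    then show ?thesis using \<open>4 * hexform ?A ?B = 3 * ?A\<^sup>2 + _\<close> one_le_square[of ?A] zero_le_power2[of "2 * ?B + ?A"] by linarith
  next
    case 2
    then have "real_of_int j \<le> -1 \<or> real_of_int j \<ge> 2" by linarith
    then have "\<bar>?B\<bar> \<ge> 1" using assms by linarith
    then show ?thesis using \<open>4 * hexform ?A ?B = 3 * ?B\<^sup>2 + _\<close> one_le_square[of ?B] zero_le_power2[of "2 * ?A + ?B"] by linarith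
  next
    case 3
    then have "\<bar>?A + ?B\<bar> \<ge> 1" using assms by simp
    then show ?thesis using \<open>4 * hexform ?A ?B = 3 * (?A + ?B)\<^sup>2 + _\<close> one_le_square[of "?A + ?B"] zero_le_power2[of "?A - ?B"] by linarith
  qed
qed

text \<open>Common core of the three families of glide reflections: up to scaling, \<open>X\<close>
  is the displacement along the mirror and \<open>Z\<close> the one across it. A nonzero glide is a
  multiple of 3, so X^2 \<ge> 9 is enough. Without glide the mirror is the line s = n, and excluding
  n = 0 (through a side) and n = 1 (through the opposite vertex) leaves it at distance at least 1 in
  s.\<close>

lemma hexform_reflection_far:
  fixes s :: real and m n :: int
  assumes s: "0 < s" "s < 1" and m: "3 dvd m" and X: "\<bar>X\<bar> = \<bar>real_of_int m\<bar>" and h: "4 * h = 3 * Z\<^sup>2 + X\<^sup>2"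
    and Z: "m = 0 \<Longrightarrow> \<bar>Z\<bar> = 2 * \<bar>s - n\<bar> \<and> n \<noteq> 0 \<and> n \<noteq> 1"
  shows "1 \<le> h"
proof (cases "m = 0")
  case False
  with m have "\<bar>m\<bar> \<ge> 3" by (auto simp: dvd_def abs_mult)
  then have "\<bar>X\<bar> \<ge> 3" using X by linarith
  then have "X\<^sup>2 \<ge> 9" using power_mono[of 3 "\<bar>X\<bar>" 2] by simp
  then show ?thesis using h zero_le_power2[of Z] by linarith
next
  case True
  with Z have n: "\<bar>Z\<bar> = 2 * \<bar>s - n\<bar>" "n \<le> -1 \<or> n \<ge> 2" by auto
  then have "real_of_int n \<le> -1 \<or> real_of_int n \<ge> 2" by linarith
  then have "\<bar>s - n\<bar> \<ge> 1" using s by linarith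
  then have "\<bar>Z\<bar> \<ge> 2" using n by simp
  then have "Z\<^sup>2 \<ge> 4" using power_mono[of 2 "\<bar>Z\<bar>" 2] by simp
  then show ?thesis using h zero_le_power2[of X] by linarith
qed

text \<open>A translation moves by a positive integer value of the form. A rotation moves by 3 times
  the squared distance to its centre, an integer point other than the three vertices, hence by at
  least 9/4. Reflections are settled by the previous lemma.\<close>

lemma displacement_ge_one:
  fixes u v :: real
  assumes g: "g \<in> weyl" "g \<notin> stabilizers" and uv: "u > 0" "v > 0" "u + v < 1"
  shows "1 \<le> hexform (u - act_u g u v) (v - act_v g u v)"
  using g(1)
proof (cases g rule: weyl_cases)
  case (id p q)
  with g(2) have pq: "p \<noteq> 0 \<or> q \<noteq> 0" by (auto simp: stabilizers_def)
  have "0 \<le> p\<^sup>2 + p * q + q\<^sup>2" "p\<^sup>2 + p * q + q\<^sup>2 \<noteq> 0"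
  proof -
    have *: "4 * (p\<^sup>2 + p * q + q\<^sup>2) = 3 * (p + q)\<^sup>2 + (p - q)\<^sup>2" by (simp add: power2_eq_square algebra_simps)
    then show "0 \<le> p\<^sup>2 + p * q + q\<^sup>2" by (smt (verit) zero_le_power2)
    show "p\<^sup>2 + p * q + q\<^sup>2 \<noteq> 0"
    proof
      assume "p\<^sup>2 + p * q + q\<^sup>2 = 0"
      with * have "3 * (p + q)\<^sup>2 + (p - q)\<^sup>2 = 0" by simp
      then have "p + q = 0 \<and> p - q = 0"
        by (smt (verit) zero_le_power2 zero_eq_power2)
      with pq show False by simp
    qed
  qed
  then have "real_of_int (p\<^sup>2 + p * q + q\<^sup>2) \<ge> 1" by linarith
  then show ?thesis by (simp add: id hexform_def)
next
  case (refl_v p q)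
  show ?thesis
  proof (rule hexform_reflection_far[where s = v and m = "2 * p + q" and n = "- p" and Z = "2 * v - q" and X = "of_int (2 * p + q)"])
    show "3 dvd 2 * p + q" using refl_v by presburger
    show "\<bar>2 * v - q\<bar> = 2 * \<bar>v - real_of_int (- p)\<bar> \<and> - p \<noteq> 0 \<and> - p \<noteq> 1" if "2 * p + q = 0"
    proof -
      have q: "q = - (2 * p)" using that by simp
      have "- p \<noteq> 0 \<and> - p \<noteq> 1" using g(2) unfolding refl_v(1) q stabilizers_def by auto
      moreover have "\<bar>2 * v - q\<bar> = 2 * \<bar>v - real_of_int (- p)\<bar>" unfolding q by (auto simp: abs_if)
      ultimately show ?thesis by blast
    qed
  qed (use uv in \<open>simp_all add: refl_v(1) hexform_def power2_eq_square algebra_simps\<close>)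
next
  case (refl_u p q)
  show ?thesis
  proof (rule hexform_reflection_far[where s = u and m = "2 * q + p" and n = "- q" and Z = "2 * u - p" and X = "of_int (2 * q + p)"])
    show "3 dvd 2 * q + p" using refl_u by presburger
    show "\<bar>2 * u - p\<bar> = 2 * \<bar>u - real_of_int (- q)\<bar> \<and> - q \<noteq> 0 \<and> - q \<noteq> 1" if "2 * q + p = 0"
    proof -
      have q: "p = - (2 * q)" using that by simp
      have "- q \<noteq> 0 \<and> - q \<noteq> 1" using g(2) unfolding refl_u(1) q stabilizers_def by auto
      moreover have "\<bar>2 * u - p\<bar> = 2 * \<bar>u - real_of_int (- q)\<bar>" unfolding q by (auto simp: abs_if)
      ultimately show ?thesis by blast
    qed
  qed (use uv in \<open>simp_all add: refl_u(1) hexform_def power2_eq_square algebra_simps\<close>)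
next
  case (refl_w p q)
  show ?thesis
  proof (rule hexform_reflection_far[where s = "u + v" and m = "q - p" and n = p and Z = "2 * (u + v) - p - q" and X = "of_int (q - p)"])
    show "3 dvd q - p" using refl_w by presburger
    show "\<bar>2 * (u + v) - p - q\<bar> = 2 * \<bar>u + v - real_of_int p\<bar> \<and> p \<noteq> 0 \<and> p \<noteq> 1" if "q - p = 0"
    proof -
      have q: "q = p" using that by simp
      have "p \<noteq> 0 \<and> p \<noteq> 1" using g(2) unfolding refl_w(1) q stabilizers_def by auto
      moreover have "\<bar>2 * (u + v) - p - q\<bar> = 2 * \<bar>u + v - real_of_int p\<bar>" unfolding q by (auto simp: abs_if)
      ultimately show ?thesis by blast
    qed
  qed (use uv in \<open>simp_all add: refl_w(1) hexform_def power2_eq_square algebra_simps\<close>)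
next
  case (rot p q)
  \<comment> \<open>The fixed point equation is 3 u = p - q, v = u + q; the congruence modulo 3
    makes the centre (i, i + q) an integer point. The inverse rotations below are handled in the
    same way.\<close>
  then obtain i where p: "p = q + 3 * i" by (metis add.commute diff_add_cancel dvdE)
  have "(i, i + q) \<notin> {(0, 0), (1, 0), (0, 1)}"
    using g(2) unfolding rot(1) p stabilizers_def by auto
  from hexform_lattice_far[OF uv this] have "3 / 4 \<le> hexform (u - i) (v - (i + q))" by simp
  moreover have "hexform (u - act_u g u v) (v - act_v g u v) = 3 * hexform (u - i) (v - (i + q))"
    unfolding rot(1) p by (simp add: hexform_def power2_eq_square algebra_simps)
  ultimately show ?thesis by linarith
next
  case (rot' p q)
  then obtain k where p: "p = q + 3 * k" by (metis add.commute diff_add_cancel dvdE)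
  have "(q + 2 * k, - k) \<notin> {(0, 0), (1, 0), (0, 1)}"
    using g(2) unfolding rot'(1) p stabilizers_def by auto
  from hexform_lattice_far[OF uv this] have "3 / 4 \<le> hexform (u - (q + 2 * k)) (v - (- k))" by simp
  moreover have "hexform (u - act_u g u v) (v - act_v g u v) = 3 * hexform (u - (q + 2 * k)) (v - (- k))"
    unfolding rot'(1) p by (simp add: hexform_def power2_eq_square algebra_simps)
  ultimately show ?thesis by linarith
qed

lemma exp_minus_le_inverse: "x > 0 \<Longrightarrow> exp (- x) \<le> 1 / x" for x :: real
proof -
  assume x: "x > 0"
  have "x \<le> exp x" using exp_ge_add_one_self[of x] by linarith
  then show ?thesis using x by (simp add: exp_minus inverse_eq_divide frac_le)
qed

context equilateral
begin

definition "cw x = 1 - cu x - cv x"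

lemma measurable_cw[measurable]: "cw \<in> borel_measurable borel"
  unfolding cw_def by measurable

text \<open>The factor 3 in \<open>k\<close> normalizes all exponents at once. Reflecting in the
  side with barycentric coordinate s moves a point by sqrt 3 L s, a rotation moves it by sqrt 3
  times the distance to the vertex. In \<psi> the side reflection is paired with the one in the
  parallel line through the opposite vertex; the coefficient 2 of \<eta> counts the two rotations
  about each vertex.\<close>

lemma sum_stabilizers:
  assumes t: "t > 0"
  defines "k \<equiv> 3 * L\<^sup>2 / (4 * t)"
  defines "\<psi> \<equiv> \<lambda>s. exp (- k * s\<^sup>2) + exp (- k * (1 - s)\<^sup>2)"
  defines "\<eta> \<equiv> \<lambda>u v. exp (- k * hexform u v)"
  shows "(\<Sum>g\<in>stabilizers. aff_det g * gauss t (x - Y g x)) =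
    (1 - (\<psi> (cu x) + \<psi> (cv x) + \<psi> (cw x)) + 2 * (\<eta> (cu x) (cv x) + \<eta> (cv x) (cw x) + \<eta> (cw x) (cu x))) / (4 * pi * t)"
proof -
  define r where "r g = hexform (cu x - act_u g (cu x) (cv x)) (cv x - act_v g (cu x) (cv x)) / 3" for g
  have g: "gauss t (x - Y g x) = exp (- k * r g) / (4 * pi * t)" for g
    using t by (simp add: gauss_def norm_diff_eq k_def r_def)
  have "(\<Sum>g\<in>stabilizers. aff_det g * gauss t (x - Y g x)) = (\<Sum>g\<in>stabilizers. aff_det g * exp (- k * r g)) / (4 * pi * t)"
    unfolding g by (simp add: sum_divide_distrib)
  moreover have
    "r ((1, 0, 0, 1), 0, 0) = 0"
    "r ((1, 1, 0, -1), 0, 0) = (cv x)\<^sup>2"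
    "r ((1, 1, 0, -1), -1, 2) = (1 - cv x)\<^sup>2"
    "r ((-1, 0, 1, 1), 0, 0) = (cu x)\<^sup>2"
    "r ((-1, 0, 1, 1), 2, -1) = (1 - cu x)\<^sup>2"
    "r ((0, -1, -1, 0), 0, 0) = (1 - cw x)\<^sup>2"
    "r ((0, -1, -1, 0), 1, 1) = (cw x)\<^sup>2"
    "r ((-1, -1, 1, 0), 0, 0) = hexform (cu x) (cv x)"
    "r ((-1, -1, 1, 0), 2, -1) = hexform (cv x) (cw x)"
    "r ((-1, -1, 1, 0), 1, 1) = hexform (cw x) (cu x)"
    "r ((0, 1, -1, -1), 0, 0) = hexform (cu x) (cv x)"
    "r ((0, 1, -1, -1), 1, 1) = hexform (cv x) (cw x)"
    "r ((0, 1, -1, -1), -1, 2) = hexform (cw x) (cu x)"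
    unfolding r_def by (simp_all add: hexform_def cw_def power2_eq_square) (simp_all add: field_simps)
  ultimately show ?thesis
    by (simp add: stabilizers_def \<psi>_def \<eta>_def)
qed

lemma has_bochner_integral_tri:
  assumes F[measurable]: "case_prod F \<in> borel_measurable (borel \<Otimes>\<^sub>M borel)" and nn: "\<And>u v. F u v \<ge> 0"
    and r: "simplex_integral F = ennreal r" "r \<ge> 0"
  shows "has_bochner_integral lborel (\<lambda>x. indicator tri x *\<^sub>R F (cu x) (cv x)) (sqrt 3 / 2 * L\<^sup>2 * r)"
proof (rule has_bochner_integral_nn_integral)
  have "tri \<in> sets borel" using open_tri by simp
  then have m: "(\<lambda>x. indicator tri x *\<^sub>R F (cu x) (cv x)) \<in> borel_measurable borel" by measurable
  then show "(\<lambda>x. indicator tri x *\<^sub>R F (cu x) (cv x)) \<in> borel_measurable lborel" by simp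
  have "(\<integral>\<^sup>+x. ennreal (indicator tri x *\<^sub>R F (cu x) (cv x)) \<partial>lborel) =
     ennreal (sqrt 3 / 2 * L\<^sup>2) * (\<integral>\<^sup>+v. \<integral>\<^sup>+u. ennreal (indicator tri (pt u v) *\<^sub>R F (cu (pt u v)) (cv (pt u v))) \<partial>lborel \<partial>lborel)"
    by (rule nn_integral_pt) (rule measurable_compose[OF m], simp)
  also have "(\<integral>\<^sup>+v. \<integral>\<^sup>+u. ennreal (indicator tri (pt u v) *\<^sub>R F (cu (pt u v)) (cv (pt u v))) \<partial>lborel \<partial>lborel) = simplex_integral F"
    unfolding simplex_integral_def
    by (intro nn_integral_cong) (auto simp: tri_def indicator_def)
  finally show "(\<integral>\<^sup>+x. ennreal (indicator tri x *\<^sub>R F (cu x) (cv x)) \<partial>lborel) = ennreal (sqrt 3 / 2 * L\<^sup>2 * r)"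
    using r by (simp add: ennreal_mult[symmetric])
qed (use nn r in auto)

lemma has_bochner_integral_tri_cyclic:
  assumes F[measurable]: "case_prod F \<in> borel_measurable (borel \<Otimes>\<^sub>M borel)" and nn: "\<And>u v. F u v \<ge> 0"
    and r: "simplex_integral F = ennreal r" "r \<ge> 0"
  shows "has_bochner_integral lborel (\<lambda>x. indicator tri x *\<^sub>R (F (cu x) (cv x) + F (cv x) (cw x) + F (cw x) (cu x))) (3 * (sqrt 3 / 2 * L\<^sup>2 * r))"
proof -
  define F1 where "F1 u v = F v (1 - u - v)" for u v
  define F2 where "F2 u v = F1 v (1 - u - v)" for u v
  have m1[measurable]: "case_prod F1 \<in> borel_measurable (borel \<Otimes>\<^sub>M borel)" unfolding F1_def by measurable
  have m2[measurable]: "case_prod F2 \<in> borel_measurable (borel \<Otimes>\<^sub>M borel)" unfolding F2_def by measurable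
  have r1: "simplex_integral F1 = ennreal r"
    using simplex_integral_rotate[OF F] r by (simp add: F1_def[abs_def])
  have r2: "simplex_integral F2 = ennreal r"
    using simplex_integral_rotate[OF m1] r1 by (simp add: F2_def[abs_def])
  have "has_bochner_integral lborel (\<lambda>x. indicator tri x *\<^sub>R F (cu x) (cv x) + indicator tri x *\<^sub>R F1 (cu x) (cv x) + indicator tri x *\<^sub>R F2 (cu x) (cv x))
    (sqrt 3 / 2 * L\<^sup>2 * r + sqrt 3 / 2 * L\<^sup>2 * r + sqrt 3 / 2 * L\<^sup>2 * r)"
    by (intro has_bochner_integral_add has_bochner_integral_tri F m1 m2 r r1 r2) (simp_all add: nn F1_def F2_def)
  moreover have "F1 (cu x) (cv x) = F (cv x) (cw x)" "F2 (cu x) (cv x) = F (cw x) (cu x)" for x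
    by (simp_all add: F1_def F2_def cw_def)
  moreover have "3 * (sqrt 3 / 2 * L\<^sup>2 * r) = sqrt 3 / 2 * L\<^sup>2 * r + sqrt 3 / 2 * L\<^sup>2 * r + sqrt 3 / 2 * L\<^sup>2 * r" by simp
  ultimately show ?thesis by (simp only: scaleR_add_right)
qed

text \<open>The quadratic Taylor bound exp (- s / (4 t)) \<le> 32 t^2 / s^2 leaves one power of t
  after the prefactor 1 / (4 pi t), with constant 32 / (4 pi) = 8 / pi. Since s \<ge> L^2, the
  polynomial (1 + s)^2 of \<open>weight_growth\<close> is at most (1 / L^2 + 1)^2 s^2, so s cancels
  and the weight can be summed.\<close>

lemma image_kernel_remainder:
  obtains C where "C \<ge> 0" "\<And>t x. t > 0 \<Longrightarrow> x \<in> tri \<Longrightarrow>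
    \<bar>image_kernel t x x - (\<Sum>g\<in>stabilizers. aff_det g * gauss t (x - Y g x))\<bar> \<le> C * t"
proof -
  obtain K where K: "K > 0" "\<And>g x z. g \<in> weyl \<Longrightarrow> \<bar>cu x\<bar> \<le> 1 \<Longrightarrow> \<bar>cv x\<bar> \<le> 1 \<Longrightarrow> \<bar>cu z\<bar> \<le> 1 \<Longrightarrow> \<bar>cv z\<bar> \<le> 1 \<Longrightarrow>
     1 \<le> K * weyl_weight g * (1 + (norm (x - Y g z))\<^sup>2)\<^sup>2"
    using weight_growth by blast
  define D where "D = 8 / pi * (K * (1 / L\<^sup>2 + 1)\<^sup>2)"
  have D: "D \<ge> 0" using K by (simp add: D_def)
  have bound: "\<bar>aff_det g * gauss t (x - Y g x)\<bar> \<le> D * t * weyl_weight g"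
    if t: "t > 0" and x: "x \<in> tri" and g: "g \<in> weyl" "g \<notin> stabilizers" for t x g
  proof -
    define s where "s = (norm (x - Y g x))\<^sup>2"
    have "1 \<le> hexform (cu x - act_u g (cu x) (cv x)) (cv x - act_v g (cu x) (cv x))"
      using x by (intro displacement_ge_one g) (auto simp: tri_def)
    then have "L\<^sup>2 * 1 \<le> s" unfolding s_def norm_diff_eq cu_Y cv_Y by (intro mult_left_mono) auto
    then have sL: "L\<^sup>2 \<le> s" by simp
    with L have s: "s > 0" by (smt (verit) zero_less_power)
    have "1 \<le> s / L\<^sup>2" using sL L by simp
    then have "(1 + s)\<^sup>2 \<le> ((1 / L\<^sup>2 + 1) * s)\<^sup>2" using s by (intro power_mono) (simp_all add: distrib_right)
    moreover have wK: "0 \<le> K * weyl_weight g" using K weyl_weight_pos[of g] by simp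
    ultimately have "K * weyl_weight g * (1 + s)\<^sup>2 \<le> K * weyl_weight g * ((1 / L\<^sup>2 + 1) * s)\<^sup>2"
      by (intro mult_left_mono)
    moreover have "1 \<le> K * weyl_weight g * (1 + s)\<^sup>2"
      unfolding s_def using tri_coord_bound[OF x] by (intro K g) auto
    ultimately have 1: "1 \<le> K * weyl_weight g * (1 / L\<^sup>2 + 1)\<^sup>2 * s\<^sup>2" by (simp add: power_mult_distrib mult_ac)
    have "exp (- s / (4 * t)) \<le> 32 * t\<^sup>2 / s\<^sup>2"
    proof -
      have "(s / (4 * t))\<^sup>2 / 2 \<le> exp (s / (4 * t))"
        using exp_lower_Taylor_quadratic[of "s / (4 * t)"] s t by (smt (verit) divide_pos_pos)
      then have "s\<^sup>2 / (32 * t\<^sup>2) \<le> exp (s / (4 * t))" by (simp add: power_divide)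
      then have "inverse (exp (s / (4 * t))) \<le> inverse (s\<^sup>2 / (32 * t\<^sup>2))"
        using s t by (intro le_imp_inverse_le) auto
      then show ?thesis by (simp add: exp_minus)
    qed
    then have "gauss t (x - Y g x) \<le> 32 * t\<^sup>2 / s\<^sup>2 / (4 * pi * t)"
      unfolding gauss_def s_def[symmetric] using t by (intro divide_right_mono) auto
    also have "\<dots> = 8 / pi * t / s\<^sup>2 * 1" using t s by (simp add: divide_simps power2_eq_square)
    also have "\<dots> \<le> 8 / pi * t / s\<^sup>2 * (K * weyl_weight g * (1 / L\<^sup>2 + 1)\<^sup>2 * s\<^sup>2)"
      using t s by (intro mult_left_mono 1) auto
    also have "\<dots> = D * t * weyl_weight g" using s by (simp add: D_def)
    finally show ?thesis using abs_aff_det[OF g(1)] gauss_nonneg[OF t, of "x - Y g x"] by (simp add: abs_mult)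
  qed
  define W where "W = (LINT g|count_space weyl. weyl_weight g)"
  show thesis
  proof (rule that[of "D * W"])
    have "W \<ge> 0" unfolding W_def
      by (intro Bochner_Integration.integral_nonneg less_imp_le weyl_weight_pos)
    with D show "D * W \<ge> 0" by (rule mult_nonneg_nonneg)
    fix t :: real and x assume t: "t > 0" and x: "x \<in> tri"
    have i: "integrable (count_space weyl) (\<lambda>g. indicator (- stabilizers) g * (aff_det g * gauss t (x - Y g x)))"
      by (rule Bochner_Integration.integrable_bound[OF integrable_image_kernel[OF t, of x x]]) (auto simp: indicator_def)
    have "image_kernel t x x = (\<Sum>g\<in>stabilizers. aff_det g * gauss t (x - Y g x)) +
        (LINT g|count_space weyl. indicator (- stabilizers) g * (aff_det g * gauss t (x - Y g x)))"
      unfolding image_kernel_def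
      by (rule integral_count_space_split[OF integrable_image_kernel[OF t] _ stabilizers_subset]) (simp add: stabilizers_def)
    moreover have "\<bar>LINT g|count_space weyl. indicator (- stabilizers) g * (aff_det g * gauss t (x - Y g x))\<bar>
       \<le> (LINT g|count_space weyl. D * t * weyl_weight g)"
    proof (rule abs_integral_le_integral)
      fix g assume "g \<in> space (count_space weyl)"
      then have g: "g \<in> weyl" by simp
      show "\<bar>indicator (- stabilizers) g * (aff_det g * gauss t (x - Y g x))\<bar> \<le> D * t * weyl_weight g"
        using bound[OF t x g] D t weyl_weight_pos[of g] by (cases "g \<in> stabilizers") auto
    qed (use integrable_weyl_weight i in simp_all)
    ultimately show "\<bar>image_kernel t x x - (\<Sum>g\<in>stabilizers. aff_det g * gauss t (x - Y g x))\<bar> \<le> D * W * t"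
      by (simp add: W_def mult_ac)
  qed
qed

lemma bounded_image_kernel:
  assumes t: "t > 0"
  obtains C where "\<And>x. x \<in> tri \<Longrightarrow> \<bar>image_kernel t x x\<bar> \<le> C"
proof -
  from gauss_weight[OF t, of 1] obtain C where C: "C > 0"
    "\<And>g x z. g \<in> weyl \<Longrightarrow> \<bar>cu x\<bar> \<le> 1 \<Longrightarrow> \<bar>cv x\<bar> \<le> 1 \<Longrightarrow> \<bar>cu z\<bar> \<le> 1 \<Longrightarrow> \<bar>cv z\<bar> \<le> 1 \<Longrightarrow>
     norm (aff_det g * gauss t (x - Y g z)) \<le> C * weyl_weight g" by blast
  have "\<bar>image_kernel t x x\<bar> \<le> (LINT g|count_space weyl. C * weyl_weight g)" if x: "x \<in> tri" for x
    unfolding image_kernel_def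
  proof (rule abs_integral_le_integral)
    show "integrable (count_space weyl) (\<lambda>g. aff_det g * gauss t (x - Y g x))"
      by (rule integrable_image_kernel[OF t])
    show "integrable (count_space weyl) (\<lambda>g. C * weyl_weight g)"
      by (intro integrable_mult_right integrable_weyl_weight)
    show "\<bar>aff_det g * gauss t (x - Y g x)\<bar> \<le> C * weyl_weight g" if "g \<in> space (count_space weyl)" for g
      unfolding real_norm_def[symmetric] using that tri_coord_bound[OF x] by (intro C) auto
  qed
  then show thesis by (rule that)
qed

lemma emeasure_tri_finite: "emeasure lborel tri < \<infinity>"
  using emeasure_bounded_finite[OF bounded_tri] by simp

text \<open>Needed because the trace is a Bochner integral, 0 by convention for a function that is
  not integrable; integrability permits the comparison with the finite sum.\<close>

lemma integrable_image_kernel_diagonal: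
  assumes t: "t > 0"
  shows "set_integrable lborel tri (\<lambda>x. image_kernel t x x)"
proof -
  obtain C where C: "\<And>x. x \<in> tri \<Longrightarrow> \<bar>image_kernel t x x\<bar> \<le> C" using bounded_image_kernel[OF t] by blast
  have tri: "tri \<in> sets borel" using open_tri by simp
  have "continuous_on tri (\<lambda>x. (\<lambda>(x, y). image_kernel t x y) (x, x))"
    by (rule continuous_on_compose2[OF continuous_on_image_kernel[OF t]]) (auto intro!: continuous_intros)
  then have m: "(\<lambda>x. indicator tri x *\<^sub>R image_kernel t x x) \<in> borel_measurable borel"
    using tri by (intro borel_measurable_continuous_on_indicator) auto
  have "integrable lborel (\<lambda>x. indicator tri x *\<^sub>R C)"
    using emeasure_tri_finite tri by simp
  then show ?thesis
    unfolding set_integrable_def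
    by (rule Bochner_Integration.integrable_bound) (use m C in \<open>auto simp: indicator_def intro: order_trans[OF _ abs_ge_self]\<close>)
qed

lemma partition_function_asymptotics:
  obtains C where "\<And>t. t > 0 \<Longrightarrow>
    \<bar>dirichlet_partition_function tri t - (measure lborel tri / (4 * pi * t) - 3 * L / (8 * sqrt (pi * t)) + 1 / 3)\<bar> \<le> C * t"
proof -
  obtain C where C: "C \<ge> 0" "\<And>t x. t > 0 \<Longrightarrow> x \<in> tri \<Longrightarrow>
    \<bar>image_kernel t x x - (\<Sum>g\<in>stabilizers. aff_det g * gauss t (x - Y g x))\<bar> \<le> C * t"
    using image_kernel_remainder by blast
  define A where "A = measure lborel tri"
  \<comment> \<open>The three sources of error: the remainder, the Gaussian tails of the reflections
    (3 times sqrt 3 / (6 pi)), and the sector tails of the rotations (6 times 1/9 times 8/3). The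
    common factor is 1 / (k t).\<close>
  define E where "E = C * A + (sqrt 3 / (2 * pi) + 16 / 9) * (4 / (3 * L\<^sup>2))"
  show thesis
  proof (rule that[of E])
    fix t :: real assume t: "t > 0"
    define k where "k = 3 * L\<^sup>2 / (4 * t)"
    have k: "k > 0" using L t by (simp add: k_def)
    define \<psi> where "\<psi> s = exp (- k * s\<^sup>2) + exp (- k * (1 - s)\<^sup>2)" for s
    define \<eta> where "\<eta> u v = exp (- k * hexform u v)" for u v
    define J where "J = sqrt 3 / 2 * L\<^sup>2"
    define S where "S x = (\<Sum>g\<in>stabilizers. aff_det g * gauss t (x - Y g x))" for x
    have J: "J > 0" using L by (simp add: J_def)
    have S_eq: "S x = (1 - (\<psi> (cu x) + \<psi> (cv x) + \<psi> (cw x)) + 2 * (\<eta> (cu x) (cv x) + \<eta> (cv x) (cw x) + \<eta> (cw x) (cu x))) / (4 * pi * t)" for x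
      unfolding S_def \<psi>_def \<eta>_def k_def by (rule sum_stabilizers[OF t])
    obtain r1 where r1: "(\<integral>\<^sup>+s. ennreal (exp (- k * s\<^sup>2)) * indicator {0<..<1} s \<partial>lborel) = ennreal r1"
      "r1 \<ge> 0" "r1 \<le> sqrt (pi / k) / 2" "sqrt (pi / k) / 2 - exp (- k) / k \<le> r1"
      using nn_integral_gauss_unit_interval[OF k] by blast
    obtain r2 where r2: "simplex_integral \<eta> = ennreal r2"
      "r2 \<ge> 0" "r2 \<le> pi / (3 * sqrt 3 * k)" "pi / (3 * sqrt 3 * k) * (1 - 2 * exp (- (3 / 8) * k)) \<le> r2"
      using simplex_integral_exp_hexform[OF k] unfolding \<eta>_def[abs_def] by blast
    have \<psi>_int: "simplex_integral (\<lambda>u v. \<psi> u) = ennreal r1"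
      unfolding \<psi>_def r1(1)[symmetric] by (rule simplex_integral_symmetrized) auto
    have tri: "tri \<in> sets borel" using open_tri by simp
    have h0: "has_bochner_integral lborel (\<lambda>x. indicator tri x *\<^sub>R (1 :: real)) A"
      using emeasure_tri_finite tri by (simp add: has_bochner_integral_iff A_def)
    have h1: "has_bochner_integral lborel (\<lambda>x. indicator tri x *\<^sub>R (\<psi> (cu x) + \<psi> (cv x) + \<psi> (cw x))) (3 * (J * r1))"
      unfolding J_def by (rule has_bochner_integral_tri_cyclic[OF _ _ \<psi>_int r1(2)]) (auto simp: \<psi>_def)
    have [measurable]: "case_prod \<eta> \<in> borel_measurable (borel \<Otimes>\<^sub>M borel)"
      unfolding \<eta>_def by measurable
    have h2: "has_bochner_integral lborel (\<lambda>x. indicator tri x *\<^sub>R (\<eta> (cu x) (cv x) + \<eta> (cv x) (cw x) + \<eta> (cw x) (cu x))) (3 * (J * r2))"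
      unfolding J_def by (rule has_bochner_integral_tri_cyclic[OF _ _ r2(1,2)]) (auto simp: \<eta>_def)
    have "has_bochner_integral lborel (\<lambda>x. (indicator tri x *\<^sub>R 1 - indicator tri x *\<^sub>R (\<psi> (cu x) + \<psi> (cv x) + \<psi> (cw x))
        + 2 * (indicator tri x *\<^sub>R (\<eta> (cu x) (cv x) + \<eta> (cv x) (cw x) + \<eta> (cw x) (cu x)))) / (4 * pi * t))
       ((A - 3 * (J * r1) + 2 * (3 * (J * r2))) / (4 * pi * t))"
      by (intro has_bochner_integral_divide_zero has_bochner_integral_add has_bochner_integral_diff has_bochner_integral_mult_right h0 h1 h2)
    then have S_int: "has_bochner_integral lborel (\<lambda>x. indicator tri x *\<^sub>R S x) ((A - 3 * (J * r1) + 6 * (J * r2)) / (4 * pi * t))"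
      by (rule has_bochner_integral_cong[THEN iffD1, rotated 3]) (auto simp: S_eq indicator_def)
    have Z: "dirichlet_partition_function tri t = (LINT x:tri|lborel. image_kernel t x x)"
      unfolding dirichlet_partition_function_def dirichlet_heat_kernel_tri
      using tri t by (intro set_lebesgue_integral_cong) auto
    have ik: "integrable lborel (\<lambda>x. indicator tri x *\<^sub>R image_kernel t x x)"
      using integrable_image_kernel_diagonal[OF t] by (simp add: set_integrable_def)
    have "\<bar>LINT x|lborel. indicator tri x *\<^sub>R image_kernel t x x - indicator tri x *\<^sub>R S x\<bar> \<le> (LINT x|lborel. C * t * indicator tri x)"
    proof (rule abs_integral_le_integral)
      show "integrable lborel (\<lambda>x. indicator tri x *\<^sub>R image_kernel t x x - indicator tri x *\<^sub>R S x)"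
        using ik S_int by (intro Bochner_Integration.integrable_diff) (auto simp: has_bochner_integral_iff)
      show "integrable lborel (\<lambda>x. C * t * indicator tri x)"
        using emeasure_tri_finite tri by simp
    qed (use C(2)[OF t] in \<open>auto simp: indicator_def S_def\<close>)
    also have "\<dots> = C * A * t" using emeasure_tri_finite tri by (simp add: A_def)
    also have "(LINT x|lborel. indicator tri x *\<^sub>R image_kernel t x x - indicator tri x *\<^sub>R S x)
       = dirichlet_partition_function tri t - (A - 3 * (J * r1) + 6 * (J * r2)) / (4 * pi * t)"
      unfolding Z set_lebesgue_integral_def
      by (subst Bochner_Integration.integral_diff) (use ik S_int in \<open>auto simp: has_bochner_integral_iff\<close>)
    finally have rest: "\<bar>dirichlet_partition_function tri t - (A - 3 * (J * r1) + 6 * (J * r2)) / (4 * pi * t)\<bar> \<le> C * A * t" by simp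
    have exp_k: "exp (- k) \<le> 4 / (3 * L\<^sup>2) * t"
      using exp_minus_le_inverse[OF k] by (simp add: k_def)
    have exp_k': "exp (- (3 / 8) * k) \<le> 8 / 3 * (4 / (3 * L\<^sup>2) * t)"
      using exp_minus_le_inverse[of "3 / 8 * k"] k by (simp add: k_def)
    \<comment> \<open>The share of one side in the perimeter term.\<close>
    have "J * (sqrt (pi / k) / 2) / (4 * pi * t) = L / (8 * sqrt (pi * t))"
    proof -
      have "pi / k = 4 * (pi * t) / (3 * L\<^sup>2)" using t L by (simp add: k_def)
      then have "sqrt (pi / k) = 2 * sqrt (pi * t) / (sqrt 3 * L)" using L by (simp add: real_sqrt_divide real_sqrt_mult)
      then have "J * (sqrt (pi / k) / 2) / (4 * pi * t) = L * sqrt (pi * t) / (8 * (pi * t))"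
        using t L by (simp add: J_def power2_eq_square)
      also have "pi * t = sqrt (pi * t) * sqrt (pi * t)" using t by simp
      finally show ?thesis using t by (simp add: divide_simps del: real_sqrt_mult_self)
    qed
    moreover have "J * (exp (- k) / k) / (4 * pi * t) = sqrt 3 / (6 * pi) * exp (- k)"
      using t L by (simp add: J_def k_def field_simps)
    moreover have "J * (sqrt (pi / k) / 2) / (4 * pi * t) - J * (exp (- k) / k) / (4 * pi * t) \<le> J * r1 / (4 * pi * t)"
      unfolding diff_divide_distrib[symmetric] right_diff_distrib[symmetric]
      using r1(4) J t by (intro divide_right_mono mult_left_mono) auto
    moreover have "J * r1 / (4 * pi * t) \<le> J * (sqrt (pi / k) / 2) / (4 * pi * t)"
      using r1(3) J t by (intro divide_right_mono mult_left_mono) auto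
    moreover have "sqrt 3 / (6 * pi) * exp (- k) \<le> sqrt 3 / (6 * pi) * (4 / (3 * L\<^sup>2) * t)"
      using exp_k by (intro mult_left_mono) auto
    ultimately have refl: "\<bar>J * r1 / (4 * pi * t) - L / (8 * sqrt (pi * t))\<bar> \<le> sqrt 3 / (6 * pi) * (4 / (3 * L\<^sup>2) * t)"
      by linarith
    \<comment> \<open>The share of one rotation; the six of them make up 1/3.\<close>
    have P: "J * (pi / (3 * sqrt 3 * k)) / (4 * pi * t) = 1 / 18"
      using t L by (simp add: J_def k_def field_simps)
    have "J * (pi / (3 * sqrt 3 * k) * (1 - 2 * exp (- (3 / 8) * k))) / (4 * pi * t) \<le> J * r2 / (4 * pi * t)"
      using r2(4) J t by (intro divide_right_mono mult_left_mono) auto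
    moreover have "J * (pi / (3 * sqrt 3 * k) * (1 - 2 * exp (- (3 / 8) * k))) / (4 * pi * t)
        = J * (pi / (3 * sqrt 3 * k)) / (4 * pi * t) * (1 - 2 * exp (- (3 / 8) * k))" by simp
    moreover have "J * r2 / (4 * pi * t) \<le> J * (pi / (3 * sqrt 3 * k)) / (4 * pi * t)"
      using r2(3) J t by (intro divide_right_mono mult_left_mono) auto
    ultimately have rot: "\<bar>J * r2 / (4 * pi * t) - 1 / 18\<bar> \<le> 1 / 9 * (8 / 3 * (4 / (3 * L\<^sup>2) * t))"
      unfolding P using exp_k' by (simp add: right_diff_distrib)
    have split: "(A - 3 * (J * r1) + 6 * (J * r2)) / (4 * pi * t) = A / (4 * pi * t) - 3 * (J * r1 / (4 * pi * t)) + 6 * (J * r2 / (4 * pi * t))"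
      by (simp add: add_divide_distrib diff_divide_distrib)
    have "E * t = C * A * t + 3 * (sqrt 3 / (6 * pi) * (4 / (3 * L\<^sup>2) * t)) + 6 * (1 / 9 * (8 / 3 * (4 / (3 * L\<^sup>2) * t)))"
      by (simp add: E_def distrib_right distrib_left add_divide_distrib mult_ac)
    moreover have "3 * L / (8 * sqrt (pi * t)) = 3 * (L / (8 * sqrt (pi * t)))" by simp
    ultimately show "\<bar>dirichlet_partition_function tri t - (measure lborel tri / (4 * pi * t) - 3 * L / (8 * sqrt (pi * t)) + 1 / 3)\<bar> \<le> E * t"
      using rest refl rot unfolding split A_def[symmetric] by linarith
  qed
qed

text \<open>The vertices are not collinear because Cauchy-Schwarz is strict for \<open>e1\<close>
  and \<open>e2\<close>. With \<open>c\<close> listed last, the weights of a convex combination are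
  \<open>cu\<close>, \<open>cv\<close>, \<open>cw\<close> in this order.\<close>

lemma interior_convex_hull_eq_tri: "interior (convex hull {c + e1, c + e2, c}) = tri"
proof -
  have nc: "\<not> collinear {c + e1, c + e2, c}"
  proof
    assume "collinear {c + e1, c + e2, c}"
    then have "collinear {0, e1, e2}"
      using collinear_3[of "c + e1" c "c + e2"] by (simp add: insert_commute)
    then have "\<bar>e1 \<bullet> e2\<bar> = norm e1 * norm e2"
      by (simp add: norm_cauchy_schwarz_equal)
    moreover have "norm e1 = L" "norm e2 = L"
      using e11 e22 L by (simp_all add: norm_eq_sqrt_inner)
    ultimately show False using e12 L by (simp add: power2_eq_square)
  qed
  have eq: "x *\<^sub>R (c + e1) + y *\<^sub>R (c + e2) + z *\<^sub>R c = pt x y" if "x + y + z = 1" for x y z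
  proof -
    have "x *\<^sub>R (c + e1) + y *\<^sub>R (c + e2) + z *\<^sub>R c = (x + y + z) *\<^sub>R c + x *\<^sub>R e1 + y *\<^sub>R e2"
      by (simp add: algebra_simps)
    then show ?thesis by (simp add: that pt_def)
  qed
  have "interior (convex hull {c + e1, c + e2, c}) =
      {w. \<exists>x y z. 0 < x \<and> 0 < y \<and> 0 < z \<and> x + y + z = 1 \<and> x *\<^sub>R (c + e1) + y *\<^sub>R (c + e2) + z *\<^sub>R c = w}"
    by (rule interior_convex_hull_3_minimal[OF nc]) simp
  also have "\<dots> = tri"
  proof (intro equalityI subsetI)
    fix w assume "w \<in> {w. \<exists>x y z. 0 < x \<and> 0 < y \<and> 0 < z \<and> x + y + z = 1 \<and> x *\<^sub>R (c + e1) + y *\<^sub>R (c + e2) + z *\<^sub>R c = w}"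
    then obtain x y z where "0 < x" "0 < y" "0 < z" "x + y + z = 1" "w = pt x y" using eq by auto
    then show "w \<in> tri" by (simp add: tri_def)
  next
    fix w assume w: "w \<in> tri"
    have "cu w *\<^sub>R (c + e1) + cv w *\<^sub>R (c + e2) + cw w *\<^sub>R c = w"
      by (subst eq) (simp_all add: cw_def)
    moreover have "0 < cu w" "0 < cv w" "0 < cw w" "cu w + cv w + cw w = 1"
      using w by (simp_all add: tri_def cw_def)
    ultimately show "w \<in> {w. \<exists>x y z. 0 < x \<and> 0 < y \<and> 0 < z \<and> x + y + z = 1 \<and> x *\<^sub>R (c + e1) + y *\<^sub>R (c + e2) + z *\<^sub>R c = w}"
      by blast
  qed
  finally show ?thesis .
qed

end

theorem mainTheorem9:
  fixes a b c :: "real ^ 2" and L :: real and \<Omega> :: "(real ^ 2) set"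
  assumes "L > 0"
    and "dist a b = L" and "dist b c = L" and "dist c a = L"
    and "\<Omega> = interior (convex hull {a, b, c})"
  shows "(\<lambda>t. dirichlet_partition_function \<Omega> t
            - (measure lborel \<Omega> / (4 * pi * t)
               - (dist a b + dist b c + dist c a) / (8 * sqrt (pi * t))
               + 1 / 3)) \<in> o[at_right 0](\<lambda>_. 1)"
proof -
  have e11: "(a - c) \<bullet> (a - c) = L\<^sup>2" and e22: "(b - c) \<bullet> (b - c) = L\<^sup>2" and ab: "(a - b) \<bullet> (a - b) = L\<^sup>2"
    using assms by (simp_all add: dist_norm norm_minus_commute flip: power2_norm_eq_inner)
  \<comment> \<open>Law of cosines: the third side fixes the angle at c.\<close>
  have "(a - b) \<bullet> (a - b) = (a - c) \<bullet> (a - c) - 2 * ((a - c) \<bullet> (b - c)) + (b - c) \<bullet> (b - c)"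
    by (simp add: inner_diff_left inner_diff_right inner_commute)
  then have e12: "(a - c) \<bullet> (b - c) = L\<^sup>2 / 2" using e11 e22 ab by simp
  interpret equilateral c "a - c" "b - c" L
    by unfold_locales (use assms e11 e22 e12 in auto)
  have \<Omega>: "\<Omega> = tri" using interior_convex_hull_eq_tri assms by simp
  have perimeter: "dist a b + dist b c + dist c a = 3 * L" using assms by simp
  obtain C where C: "\<And>t. t > 0 \<Longrightarrow>
    \<bar>dirichlet_partition_function tri t - (measure lborel tri / (4 * pi * t) - 3 * L / (8 * sqrt (pi * t)) + 1 / 3)\<bar> \<le> C * t"
    using partition_function_asymptotics by blast
  show ?thesis
    unfolding \<Omega> perimeter
  proof (rule smalloI_tendsto)
    have "((\<lambda>t. C * t) \<longlongrightarrow> C * 0) (at_right 0)" by (intro tendsto_intros)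
    then have C0: "((\<lambda>t. C * t) \<longlongrightarrow> 0) (at_right 0)" by simp
    have "\<forall>\<^sub>F t in at_right 0. norm ((dirichlet_partition_function tri t
        - (measure lborel tri / (4 * pi * t) - 3 * L / (8 * sqrt (pi * t)) + 1 / 3)) / 1) \<le> C * t"
      unfolding real_norm_def div_by_1 by (rule eventually_mono[OF eventually_at_right_less C])
    then show "((\<lambda>t. (dirichlet_partition_function tri t
        - (measure lborel tri / (4 * pi * t) - 3 * L / (8 * sqrt (pi * t)) + 1 / 3)) / 1) \<longlongrightarrow> 0) (at_right 0)"
      using C0 by (rule Lim_null_comparison)
  qed simp
qed

end
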